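(* Let $(X,d,\mu,\mathcal E,\mathcal F)$ be a sub-Gaussian Dirichlet space with parameters $d_H,d_W$ that satisfies $wBE(\kappa)$ with $\kappa=d_W-\lambda_1^\#$. If $f\in BV(X)\cap L^2(X,\mu)$ is Hölder continuous with exponent $\kappa$, then $f\in\mathcal F$ and its energy measure $\nu_f$ is absolutely continuous with respect to any BV measure $\gamma_f$ associated with $f$. Moreover, there exists a constant $C>0$ independent of $f$ such that $$\nu_f\le C\,\|f\|_{\infty,\kappa}\,\underline\gamma_f,$$ where $\|f\|_{\infty,\kappa}$ denotes the $\kappa$-Hölder seminorm of $f$ and $\underline\gamma_f$ denotes the $\liminf$ measure of the family of measures $\mathcal M_rf\,d\mu$, $r>0$.
   Context: A sub-Gaussian Dirichlet space $(X,d,\mu,\mathcal E,\mathcal F)$ with parameters $d_H,d_W$ means: $(X,d,\mu)$ is a locally compact metric measure space, $\mu$ is a Radon measure with support $X$, $(\mathcal E,\mathcal F)$ is a Dirichlet form on $L^2(X,\mu)$, and (i) every ball $B(x,r)=\{y: d(x,y)<r\}$, $x\in X$, $0<r<\infty$, has compact closure; (ii) $\mu$ is Ahlfors $d_H$-regular: there are $c_1,c_2,d_H\in(0,\infty)$ with $c_1r^{d_H}\le\mu(B(x,r))\le c_2r^{d_H}$ for all $x\in X$, $r\in[0,\infty)$; (iii) $\mathcal E$ is regular and strongly local (i.e. $\mathcal E(u,v)=0$ for $u,v\in\mathcal F$ with compact supports such that $u$ is constant in a neighborhood of the support of $v$); (iv) the heat semigroup $\{P_t\}$ of $(\mathcal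 E,\mathcal F)$ has a continuous heat kernel $p_t(x,y)$ (so $P_tg(x)=\int_Xp_t(x,y)g(y)\,d\mu(y)$) satisfying, for some $c_3,c_4,c_5,c_6\in(0,\infty)$ and $d_W\in(2,\infty)$, $$c_5t^{-d_H/d_W}\exp\Big(-c_6\Big(\tfrac{d(x,y)^{d_W}}{t}\Big)^{\frac1{d_W-1}}\Big)\le p_t(x,y)\le c_3t^{-d_H/d_W}\exp\Big(-c_4\Big(\tfrac{d(x,y)^{d_W}}{t}\Big)^{\frac1{d_W-1}}\Big)$$ for $\mu\times\mu$-a.e. $(x,y)$ and all $t>0$. In this setting $P_t1=1$. $X$ satisfies $wBE(\kappa)$ if $0<\kappa<d_W$ and there is $C>0$ such that $|P_tg(x)-P_tg(y)|\le C\frac{d(x,y)^\kappa}{t^{\kappa/d_W}}\|g\|_{L^\infty(X,\mu)}$ for all $t>0$, $g\in L^\infty(X,\mu)$, $x,y\in X$. Let $\Delta_r=\{(x,y)\in X\times X: d(x,y)<r\}$. For $\lambda>0$, $KS^{\lambda,1}(X)$ is the set of $f\in L^1(X,\mu)$ such that $\limsup_{r\to0^+}\iint_{\Delta_r}\frac{|f(y)-f(x)|}{r^\lambda\mu(B(x,r))}\,d\mu(y)\,d\mu(x)<\infty$. Set $\lambda_1^\#=\sup\{\lambda>0: KS^{\lambda,1}(X)\text{ contains non-constant functions}\}$ and $BV(X)=KS^{\lambda_1^\#,1}(X)$. For $f\in L^1(X,\mu)$ let $\mathcal M_rf(y)=\frac1{r^{d_W-\kappa}\mu(B(y,r))}\int_{B(y,r)}|f(x)-f(y)|\,d\mu(x)$.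 For $f\in BV(X)$, a BV measure associated with $f$ is a Radon measure $\gamma_f$ on $X$ for which there is a sequence $r_n\searrow0$ such that $\lim_n\int_Xg\,\mathcal M_{r_n}f\,d\mu=\int_Xg\,d\gamma_f$ for every $g\in C_0(X)$ (the sup-norm closure of $C_c(X)$). Energy measure: for $f\in\mathcal F\cap L^\infty(X,\mu)$, $\nu_f$ is the Radon measure with $\int_X\phi\,d\nu_f=\mathcal E(f\phi,f)-\frac12\mathcal E(\phi,f^2)$ for all $\phi\in\mathcal F\cap C_c(X)$; it is extended to all $f\in\mathcal F$ by truncation. $\liminf$ measure (Sion): for a family $(\mu_r)_{r>0}$ of Radon measures on $X$, $$\underline\mu(A)=\inf_{U\text{ open},\,A\subset U}\ \sup_{K\text{ compact},\,K\subset U}\underline\mu^*(K),\qquad\underline\mu^*(K)=\inf\Big\{\sum_i\liminf_{r\to0^+}\mu_r(U_i): U_i\text{ open},\ K\subset\bigcup_iU_i\Big\}.$$ *)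

theory Defs
  imports "HOL-Probability.Probability"
begin

text \<open>
  Elements of \<open>L\<^sup>1\<close>, \<open>L\<^sup>2\<close> and \<open>L\<^sup>\<infinity>\<close> are represented by real-valued Borel functions rather than by
  classes modulo a.e. equality; a form domain \<open>F\<close> is a set of such functions that is closed under
  a.e. equality, and the form does not distinguish a.e. equal functions.
\<close>

section \<open>Function spaces and Radon measures\<close>

definition L2 :: "'a measure \<Rightarrow> ('a \<Rightarrow> real) set" where
  "L2 M = {f \<in> borel_measurable M. integrable M (\<lambda>x. (f x)\<^sup>2)}"

definition Linf :: "'a measure \<Rightarrow> ('a \<Rightarrow> real) set" where
  "Linf M = {g \<in> borel_measurable M. esssup M (\<lambda>x. ereal \<bar>g x\<bar>) < \<infinity>}"

definition Linf_norm :: "'a measure \<Rightarrow> ('a \<Rightarrow> real) \<Rightarrow> real" where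
  "Linf_norm M g = real_of_ereal (esssup M (\<lambda>x. ereal \<bar>g x\<bar>))"

definition Cc :: "('a::topological_space \<Rightarrow> real) set" where
  "Cc = {g. continuous_on UNIV g \<and> compact (closure {x. g x \<noteq> 0})}"

text \<open>The closure of \<open>Cc\<close> in the supremum norm.\<close>

definition C0 :: "('a::topological_space \<Rightarrow> real) set" where
  "C0 = {g. \<forall>\<epsilon>>0. \<exists>h\<in>Cc. \<forall>x. \<bar>g x - h x\<bar> \<le> \<epsilon>}"

definition radon_measure :: "'a::topological_space measure \<Rightarrow> bool" where
  "radon_measure M \<longleftrightarrow>
     sets M = sets borel \<and>
     (\<forall>K. compact K \<longrightarrow> emeasure M K < \<infinity>) \<and>
     (\<forall>A\<in>sets borel. emeasure M A = (INF U\<in>{U. open U \<and> A \<subseteq> U}. emeasure M U)) \<and>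
     (\<forall>U. open U \<longrightarrow> emeasure M U = (SUP K\<in>{K. compact K \<and> K \<subseteq> U}. emeasure M K))"

text \<open>The support of a function defined up to a.e. equality, i.e. the support of \<open>\<bar>u\<bar> dM\<close>.\<close>

definition ess_support :: "'a::topological_space measure \<Rightarrow> ('a \<Rightarrow> real) \<Rightarrow> 'a set" where
  "ess_support M u = - \<Union>{U. open U \<and> (AE x in M. x \<in> U \<longrightarrow> u x = 0)}"

definition hoelder :: "real \<Rightarrow> ('a::metric_space \<Rightarrow> real) \<Rightarrow> bool" where
  "hoelder \<kappa> f \<longleftrightarrow> (\<exists>L. \<forall>x y. \<bar>f x - f y\<bar> \<le> L * dist x y powr \<kappa>)"

definition hoelder_seminorm :: "real \<Rightarrow> ('a::metric_space \<Rightarrow> real) \<Rightarrow> real" where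
  "hoelder_seminorm \<kappa> f = Sup {\<bar>f x - f y\<bar> / dist x y powr \<kappa> | x y. x \<noteq> y}"

section \<open>Dirichlet forms\<close>

definition E1 ::
  "'a measure \<Rightarrow> (('a \<Rightarrow> real) \<Rightarrow> ('a \<Rightarrow> real) \<Rightarrow> real) \<Rightarrow> ('a \<Rightarrow> real) \<Rightarrow> real" where
  "E1 M E u = E u u + (\<integral>x. (u x)\<^sup>2 \<partial>M)"

locale dirichlet_form =
  fixes M :: "'a measure"
    and F :: "('a \<Rightarrow> real) set"
    and E :: "('a \<Rightarrow> real) \<Rightarrow> ('a \<Rightarrow> real) \<Rightarrow> real"
  assumes F_subset_L2: "F \<subseteq> L2 M"
    and F_AE_cong: "\<And>u v. u \<in> F \<Longrightarrow> v \<in> borel_measurable M \<Longrightarrow> (AE x in M. u x = v x) \<Longrightarrow> v \<in> F"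
    and E_AE_cong: "\<And>u v w. u \<in> F \<Longrightarrow> v \<in> F \<Longrightarrow> w \<in> F \<Longrightarrow> (AE x in M. u x = v x) \<Longrightarrow> E u w = E v w"
    and F_zero: "(\<lambda>x. 0) \<in> F"
    and F_lincomb: "\<And>a b u v. u \<in> F \<Longrightarrow> v \<in> F \<Longrightarrow> (\<lambda>x. a * u x + b * v x) \<in> F"
    and F_dense: "\<And>g \<epsilon>. g \<in> L2 M \<Longrightarrow> \<epsilon> > 0 \<Longrightarrow> \<exists>u\<in>F. (\<integral>x. (g x - u x)\<^sup>2 \<partial>M) < \<epsilon>"
    and E_lincomb: "\<And>a b u v w. u \<in> F \<Longrightarrow> v \<in> F \<Longrightarrow> w \<in> F \<Longrightarrow>
           E (\<lambda>x. a * u x + b * v x) w = a * E u w + b * E v w"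
    and E_sym: "\<And>u v. u \<in> F \<Longrightarrow> v \<in> F \<Longrightarrow> E u v = E v u"
    and E_nonneg: "\<And>u. u \<in> F \<Longrightarrow> 0 \<le> E u u"
    and E_closed: "\<And>u :: nat \<Rightarrow> 'a \<Rightarrow> real. (\<And>n. u n \<in> F) \<Longrightarrow>
           (\<And>\<epsilon>. \<epsilon> > 0 \<Longrightarrow> \<exists>N. \<forall>m\<ge>N. \<forall>n\<ge>N. E1 M E (\<lambda>x. u m x - u n x) < \<epsilon>) \<Longrightarrow>
           \<exists>v\<in>F. (\<lambda>n. E1 M E (\<lambda>x. u n x - v x)) \<longlonglongrightarrow> 0"
    and E_markov: "\<And>u. u \<in> F \<Longrightarrow>
           (\<lambda>x. min 1 (max 0 (u x))) \<in> F \<and>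
           E (\<lambda>x. min 1 (max 0 (u x))) (\<lambda>x. min 1 (max 0 (u x))) \<le> E u u"

definition regular_form ::
  "'a::topological_space measure \<Rightarrow> ('a \<Rightarrow> real) set \<Rightarrow> (('a \<Rightarrow> real) \<Rightarrow> ('a \<Rightarrow> real) \<Rightarrow> real) \<Rightarrow> bool"
  where
  "regular_form M F E \<longleftrightarrow>
     (\<forall>u\<in>F. \<forall>\<epsilon>>0. \<exists>\<phi>\<in>F \<inter> Cc. E1 M E (\<lambda>x. u x - \<phi> x) < \<epsilon>) \<and>
     (\<forall>g\<in>Cc. \<forall>\<epsilon>>0. \<exists>\<phi>\<in>F \<inter> Cc. \<forall>x. \<bar>g x - \<phi> x\<bar> < \<epsilon>)"

definition strongly_local_form ::
  "'a::topological_space measure \<Rightarrow> ('a \<Rightarrow> real) set \<Rightarrow> (('a \<Rightarrow> real) \<Rightarrow> ('a \<Rightarrow> real) \<Rightarrow> real) \<Rightarrow> bool"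
  where
  "strongly_local_form M F E \<longleftrightarrow>
     (\<forall>u\<in>F. \<forall>v\<in>F. compact (ess_support M u) \<and> compact (ess_support M v) \<and>
        (\<exists>U c. open U \<and> ess_support M v \<subseteq> U \<and> (AE x in M. x \<in> U \<longrightarrow> u x = c))
        \<longrightarrow> E u v = 0)"

text \<open>
  \<open>P\<close> is the heat semigroup of \<open>(E, F)\<close>: a strongly continuous symmetric contraction semigroup on
  \<open>L\<^sup>2\<close> whose generator is the generator \<open>\<L>\<close> of the form, where \<open>\<L> u = w\<close> iff \<open>u \<in> F\<close> and
  \<open>E u v = - \<integral> w v dM\<close> for all \<open>v \<in> F\<close>.
\<close>

definition heat_semigroup ::
  "'a measure \<Rightarrow> ('a \<Rightarrow> real) set \<Rightarrow> (('a \<Rightarrow> real) \<Rightarrow> ('a \<Rightarrow> real) \<Rightarrow> real)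
    \<Rightarrow> (real \<Rightarrow> ('a \<Rightarrow> real) \<Rightarrow> ('a \<Rightarrow> real)) \<Rightarrow> bool" where
  "heat_semigroup M F E P \<longleftrightarrow>
     (\<forall>t>0. \<forall>g\<in>L2 M. P t g \<in> L2 M) \<and>
     (\<forall>t>0. \<forall>g\<in>L2 M. \<forall>h\<in>L2 M. \<forall>a b.
        AE x in M. P t (\<lambda>y. a * g y + b * h y) x = a * P t g x + b * P t h x) \<and>
     (\<forall>t>0. \<forall>g\<in>L2 M. (\<integral>x. (P t g x)\<^sup>2 \<partial>M) \<le> (\<integral>x. (g x)\<^sup>2 \<partial>M)) \<and>
     (\<forall>t>0. \<forall>g\<in>L2 M. \<forall>h\<in>L2 M. (\<integral>x. P t g x * h x \<partial>M) = (\<integral>x. g x * P t h x \<partial>M)) \<and>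
     (\<forall>s>0. \<forall>t>0. \<forall>g\<in>L2 M. AE x in M. P (s + t) g x = P s (P t g) x) \<and>
     (\<forall>g\<in>L2 M. ((\<lambda>t. \<integral>x. (P t g x - g x)\<^sup>2 \<partial>M) \<longlongrightarrow> 0) (at_right 0)) \<and>
     (\<forall>u\<in>L2 M. \<forall>w\<in>L2 M.
        ((\<lambda>t. \<integral>x. ((P t u x - u x) / t - w x)\<^sup>2 \<partial>M) \<longlongrightarrow> 0) (at_right 0) \<longleftrightarrow>
        u \<in> F \<and> (\<forall>v\<in>F. E u v = - (\<integral>x. w x * v x \<partial>M)))"

text \<open>The integral operators with kernel \<open>p\<close>; these also give the action of the semigroup on \<open>L\<^sup>\<infinity>\<close>.\<close>

definition heat_op ::
  "'a measure \<Rightarrow> (real \<Rightarrow> 'a \<Rightarrow> 'a \<Rightarrow> real) \<Rightarrow> real \<Rightarrow> ('a \<Rightarrow> real) \<Rightarrow> ('a \<Rightarrow> real)" where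
  "heat_op M p t g x = (\<integral>y. p t x y * g y \<partial>M)"

text \<open>The function to which the sub-Gaussian heat kernel bounds compare.\<close>

definition sub_gaussian :: "real \<Rightarrow> real \<Rightarrow> real \<Rightarrow> real \<Rightarrow> real \<Rightarrow> 'a::metric_space \<Rightarrow> 'a \<Rightarrow> real" where
  "sub_gaussian dH dW c c' t x y =
     c * t powr (- dH / dW) * exp (- c' * ((dist x y powr dW / t) powr (1 / (dW - 1))))"

text \<open>
  The sort constraint \<open>second_countable_topology\<close> is no restriction: by \<open>relatively_compact_balls\<close>
  the space is a countable union of compact metric spaces, hence separable.
\<close>

locale sub_gaussian_dirichlet_space = dirichlet_form M F E
  for M :: "'a::{metric_space, second_countable_topology} measure"
    and F :: "('a \<Rightarrow> real) set"
    and E :: "('a \<Rightarrow> real) \<Rightarrow> ('a \<Rightarrow> real) \<Rightarrow> real" +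
  fixes p :: "real \<Rightarrow> 'a \<Rightarrow> 'a \<Rightarrow> real"
    and dH dW :: real
  assumes locally_compact: "locally compact (UNIV :: 'a set)"
    and radon: "radon_measure M"
    and full_support: "\<And>U. open U \<Longrightarrow> U \<noteq> {} \<Longrightarrow> 0 < emeasure M U"
    and relatively_compact_balls: "\<And>x r. 0 < r \<Longrightarrow> compact (closure (ball (x::'a) r))"
    and dH_pos: "0 < dH"
    and ahlfors_regular: "\<exists>c1>0. \<exists>c2>0. \<forall>x. \<forall>r\<ge>0.
           ennreal (c1 * r powr dH) \<le> emeasure M (ball x r) \<and>
           emeasure M (ball x r) \<le> ennreal (c2 * r powr dH)"
    and regular: "regular_form M F E"
    and strongly_local: "strongly_local_form M F E"
    and dW_gt_2: "2 < dW"
    and kernel_continuous: "\<And>t. 0 < t \<Longrightarrow> continuous_on UNIV (\<lambda>(x, y). p t x y)"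
    and kernel_semigroup: "heat_semigroup M F E (heat_op M p)"
    and kernel_bounds: "\<exists>c3>0. \<exists>c4>0. \<exists>c5>0. \<exists>c6>0. \<forall>t>0. AE (x, y) in M \<Otimes>\<^sub>M M.
           sub_gaussian dH dW c5 c6 t x y \<le> p t x y \<and> p t x y \<le> sub_gaussian dH dW c3 c4 t x y"

definition wBE ::
  "'a::metric_space measure \<Rightarrow> (real \<Rightarrow> 'a \<Rightarrow> 'a \<Rightarrow> real) \<Rightarrow> real \<Rightarrow> real \<Rightarrow> bool" where
  "wBE M p dW \<kappa> \<longleftrightarrow> 0 < \<kappa> \<and> \<kappa> < dW \<and>
     (\<exists>C>0. \<forall>t>0. \<forall>g\<in>Linf M. \<forall>x y.
        \<bar>heat_op M p t g x - heat_op M p t g y\<bar>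
          \<le> C * (dist x y powr \<kappa> / t powr (\<kappa> / dW)) * Linf_norm M g)"

section \<open>Korevaar--Schoen and BV functions\<close>

definition near_diagonal :: "real \<Rightarrow> ('a::metric_space \<times> 'a) set" where
  "near_diagonal r = {(x, y). dist x y < r}"

definition KS1 :: "'a::metric_space measure \<Rightarrow> real \<Rightarrow> ('a \<Rightarrow> real) set" where
  "KS1 M l = {f. integrable M f \<and>
     Limsup (at_right 0) (\<lambda>r.
       \<integral>\<^sup>+x. (\<integral>\<^sup>+y. ennreal (\<bar>f y - f x\<bar> / (r powr l * measure M (ball x r)))
                  * indicator (near_diagonal r) (x, y) \<partial>M) \<partial>M) < \<infinity>}"

text \<open>The supremum is taken in the extended reals, so that it is meaningful without knowing
  that the set is nonempty and bounded.\<close>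

definition lambda1 :: "'a::metric_space measure \<Rightarrow> ereal" where
  "lambda1 M = Sup (ereal ` {l. l > 0 \<and> (\<exists>f\<in>KS1 M l. \<not> (\<exists>c. AE x in M. f x = c))})"

definition BV :: "'a::metric_space measure \<Rightarrow> ('a \<Rightarrow> real) set" where
  "BV M = KS1 M (real_of_ereal (lambda1 M))"

definition M_op ::
  "'a::metric_space measure \<Rightarrow> real \<Rightarrow> real \<Rightarrow> real \<Rightarrow> ('a \<Rightarrow> real) \<Rightarrow> 'a \<Rightarrow> real" where
  "M_op M dW \<kappa> r f y =
     1 / (r powr (dW - \<kappa>) * measure M (ball y r)) * (LINT x:ball y r|M. \<bar>f x - f y\<bar>)"

text \<open>Integrability of every \<open>g \<in> C0\<close> is required explicitly, since the library integral of a
  non-integrable function is 0.\<close>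

definition bv_measure ::
  "'a::metric_space measure \<Rightarrow> real \<Rightarrow> real \<Rightarrow> ('a \<Rightarrow> real) \<Rightarrow> 'a measure \<Rightarrow> bool" where
  "bv_measure M dW \<kappa> f \<gamma> \<longleftrightarrow> radon_measure \<gamma> \<and>
     (\<exists>r :: nat \<Rightarrow> real. (\<forall>n. 0 < r n) \<and> decseq r \<and> r \<longlonglongrightarrow> 0 \<and>
        (\<forall>g\<in>C0. integrable \<gamma> g \<and>
           (\<lambda>n. \<integral>x. g x * M_op M dW \<kappa> (r n) f x \<partial>M) \<longlonglongrightarrow> (\<integral>x. g x \<partial>\<gamma>)))"

section \<open>Energy measures\<close>

definition is_energy_measure ::
  "('a::topological_space \<Rightarrow> real) set \<Rightarrow> (('a \<Rightarrow> real) \<Rightarrow> ('a \<Rightarrow> real) \<Rightarrow> real)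
    \<Rightarrow> ('a \<Rightarrow> real) \<Rightarrow> 'a measure \<Rightarrow> bool" where
  "is_energy_measure F E f \<nu> \<longleftrightarrow> radon_measure \<nu> \<and>
     (\<forall>\<phi>\<in>F \<inter> Cc. (\<integral>x. \<phi> x \<partial>\<nu>) = E (\<lambda>x. f x * \<phi> x) f - 1 / 2 * E \<phi> (\<lambda>x. (f x)\<^sup>2))"

definition truncate :: "nat \<Rightarrow> ('a \<Rightarrow> real) \<Rightarrow> 'a \<Rightarrow> real" where
  "truncate n f x = max (- real n) (min (real n) (f x))"

definition energy_measure ::
  "'a::topological_space measure \<Rightarrow> ('a \<Rightarrow> real) set \<Rightarrow> (('a \<Rightarrow> real) \<Rightarrow> ('a \<Rightarrow> real) \<Rightarrow> real)
    \<Rightarrow> ('a \<Rightarrow> real) \<Rightarrow> 'a measure" where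
  "energy_measure M F E f =
     (if f \<in> Linf M then THE \<nu>. is_energy_measure F E f \<nu>
      else measure_of UNIV (sets borel)
             (\<lambda>A. lim (\<lambda>n. emeasure (THE \<nu>. is_energy_measure F E (truncate n f) \<nu>) A)))"

section \<open>The lower limit of a family of measures\<close>

definition liminf_premeasure :: "(real \<Rightarrow> 'a::topological_space measure) \<Rightarrow> 'a set \<Rightarrow> ennreal" where
  "liminf_premeasure m K =
     Inf {(\<Sum>i. Liminf (at_right 0) (\<lambda>r. emeasure (m r) (U i))) | U :: nat \<Rightarrow> 'a set.
          (\<forall>i. open (U i)) \<and> K \<subseteq> (\<Union>i. U i)}"

definition liminf_measure :: "(real \<Rightarrow> 'a::topological_space measure) \<Rightarrow> 'a set \<Rightarrow> ennreal" where
  "liminf_measure m A =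
     (INF U\<in>{U. open U \<and> A \<subseteq> U}. SUP K\<in>{K. compact K \<and> K \<subseteq> U}. liminf_premeasure m K)"

end

(*
  Write P_t for the heat semigroup.  The approximating forms (1/t) <u - P_t u, v> increase to E as t
  decreases to 0 and characterise its domain.  Comparing P_{s+t} 1 with P_s 1 P_t 1 for large t, the
  weak Bakry-Emery estimate and the two-sided kernel bounds give P_t 1 = 1.  Hence for bounded u the
  approximating form is the integral of
    m_t(x) = (1/2t) \<integral> p_t(x,y) (u(x) - u(y))^2 dM(y),
  and m_t dM converges vaguely to the energy measure of u as t tends to 0.

  Near the diagonal (d(x,y) < r, r = A t^(1/dW)) the Hoelder bound turns one factor |f(x) - f(y)| into
  L r^\<kappa>, so this part of m_t is at most K L times the M_op of f at the single scale r.  Far from the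
  diagonal p_t is at most p_{Ct}/(2C), which contributes at most m_{Ct}/2.  Therefore
    m_t <= K L M_op r f + m_{Ct}/2,
  and since m_t and m_{Ct} have the same vague limit, half of the energy measure is bounded by
  K L times any lower limit of M_op r f dM.
*)

theory Submission
  imports Defs
begin

text \<open>The definition of the heat semigroup ties it to the form only through the generator, so
  no spectral calculus is at hand. Its place is taken by the minimisers u of E(v,v) + n ||v - g||^2:
  they lie in the domain of the generator, where the approximating forms converge by definition, and
  they tend to g in form norm whenever the minima stay bounded. What is proved of the monotonicity
  in t is the comparison of 2t with t, which is why C is taken to be a power of 2.

  That f belongs to the domain must be settled before any vague limit can be taken. It follows from
  the integrated inequality: the mass of m_{Ct} is at most that of m_t, which is finite for each
  fixed t, so half of it can be absorbed and the approximating forms remain bounded as t decreases.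

  The energy measure is a definite description over test functions in both F and Cc, and its
  functional is meaningful only there. Existence and uniqueness are therefore derived from a Riesz
  theorem for algebras of cutoff functions rather than for all of Cc. Regularity of the form
  supplies these cutoffs.\<close>

section \<open>Nonnegative symmetric bilinear forms\<close>

lemma discriminant_bound:
  fixes a b c :: real
  assumes "\<And>s. 0 \<le> a + 2 * s * b + s\<^sup>2 * c" and "0 \<le> c"
  shows "b\<^sup>2 \<le> a * c"
proof (cases "c = 0")
  case True
  have "b = 0"
  proof (rule ccontr)
    assume "b \<noteq> 0"
    \<comment> \<open>With c = 0 the polynomial is affine in s; this s gives it the value
      -1.\<close>
    then show False
      using assms(1)[of "- (a + 1) / (2 * b)"] True by (simp add: field_simps)
  qed
  then show ?thesis using True by simp
next
  case False
  with assms have c: "c > 0" by simp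
  have "0 \<le> a + 2 * (- b / c) * b + (- b / c)\<^sup>2 * c" by (rule assms)
  also have "\<dots> = a - b\<^sup>2 / c" using c by (simp add: field_simps power2_eq_square)
  finally show ?thesis using c by (simp add: field_simps)
qed

text \<open>Serves the Dirichlet form, the L2 inner product, their combinations and the
  approximating forms alike. Only semidefiniteness is asked: functions, not a.e. classes, are the
  elements.\<close>

locale pos_form =
  fixes V :: "('a \<Rightarrow> real) set" and B :: "('a \<Rightarrow> real) \<Rightarrow> ('a \<Rightarrow> real) \<Rightarrow> real"
  assumes V_lincomb: "\<And>a b u v. u \<in> V \<Longrightarrow> v \<in> V \<Longrightarrow> (\<lambda>x. a * u x + b * v x) \<in> V"
    and B_lincomb: "\<And>a b u v w. u \<in> V \<Longrightarrow> v \<in> V \<Longrightarrow> w \<in> V \<Longrightarrow>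
           B (\<lambda>x. a * u x + b * v x) w = a * B u w + b * B v w"
    and B_sym: "\<And>u v. u \<in> V \<Longrightarrow> v \<in> V \<Longrightarrow> B u v = B v u"
    and B_nonneg: "\<And>u. u \<in> V \<Longrightarrow> 0 \<le> B u u"
begin

lemma V_diff: "u \<in> V \<Longrightarrow> v \<in> V \<Longrightarrow> (\<lambda>x. u x - v x) \<in> V"
  using V_lincomb[of u v 1 "-1"] by simp

lemma V_scale: "u \<in> V \<Longrightarrow> (\<lambda>x. a * u x) \<in> V"
  using V_lincomb[of u u a 0] by simp

lemma B_lincomb_right:
  assumes "u \<in> V" "v \<in> V" "w \<in> V"
  shows "B w (\<lambda>x. a * u x + b * v x) = a * B w u + b * B w v"
  using assms B_lincomb[of u v w a b] B_sym V_lincomb by simp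

lemma B_diff: "u \<in> V \<Longrightarrow> v \<in> V \<Longrightarrow> w \<in> V \<Longrightarrow> B (\<lambda>x. u x - v x) w = B u w - B v w"
  using B_lincomb[of u v w 1 "-1"] by simp

lemma B_quadratic:
  assumes "u \<in> V" "v \<in> V"
  shows "B (\<lambda>x. a * u x + b * v x) (\<lambda>x. a * u x + b * v x) =
    a\<^sup>2 * B u u + 2 * a * b * B u v + b\<^sup>2 * B v v"
  using assms by (simp add: B_lincomb B_lincomb_right V_lincomb B_sym[of v u] power2_eq_square algebra_simps)

lemma B_diff_quadratic:
  assumes "u \<in> V" "v \<in> V"
  shows "B (\<lambda>x. u x - v x) (\<lambda>x. u x - v x) = B u u - 2 * B u v + B v v"
  using B_quadratic[OF assms, of 1 "-1"] by simp

lemma Cauchy_Schwarz: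
  assumes "u \<in> V" "v \<in> V"
  shows "(B u v)\<^sup>2 \<le> B u u * B v v"
proof (rule discriminant_bound)
  fix s :: real
  show "0 \<le> B u u + 2 * s * B u v + s\<^sup>2 * B v v"
    using B_nonneg[OF V_lincomb[OF assms, of 1 s]] B_quadratic[OF assms, of 1 s] by simp
qed (use assms B_nonneg in auto)

lemma Cauchy_Schwarz_abs:
  assumes "u \<in> V" "v \<in> V"
  shows "\<bar>B u v\<bar> \<le> sqrt (B u u) * sqrt (B v v)"
  using real_sqrt_le_mono[OF Cauchy_Schwarz[OF assms]] by (simp add: real_sqrt_mult)

lemma tendsto_form:
  assumes u: "\<And>n. u n \<in> V" and v: "v \<in> V" and w: "w \<in> V"
    and lim: "(\<lambda>n. B (\<lambda>x. u n x - v x) (\<lambda>x. u n x - v x)) \<longlonglongrightarrow> 0"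
  shows "(\<lambda>n. B (u n) w) \<longlonglongrightarrow> B v w"
proof -
  have "(\<lambda>n. sqrt (B (\<lambda>x. u n x - v x) (\<lambda>x. u n x - v x)) * sqrt (B w w)) \<longlonglongrightarrow> sqrt 0 * sqrt (B w w)"
    by (intro tendsto_intros lim)
  then have "(\<lambda>n. sqrt (B (\<lambda>x. u n x - v x) (\<lambda>x. u n x - v x)) * sqrt (B w w)) \<longlonglongrightarrow> 0"
    by simp
  then have "(\<lambda>n. B (u n) w - B v w) \<longlonglongrightarrow> 0"
    by (rule Lim_null_comparison[rotated])
       (use Cauchy_Schwarz_abs[OF V_diff[OF u v] w] in \<open>simp add: B_diff[OF u v w]\<close>)
  then show ?thesis by (simp add: LIM_zero_iff)
qed

lemma tendsto_quadratic:
  assumes u: "\<And>n. u n \<in> V" and v: "v \<in> V"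
    and lim: "(\<lambda>n. B (\<lambda>x. u n x - v x) (\<lambda>x. u n x - v x)) \<longlonglongrightarrow> 0"
  shows "(\<lambda>n. B (u n) (u n)) \<longlonglongrightarrow> B v v"
proof -
  have "(\<lambda>n. B (\<lambda>x. u n x - v x) (\<lambda>x. u n x - v x) + 2 * B (u n) v - B v v) \<longlonglongrightarrow> 0 + 2 * B v v - B v v"
    by (intro tendsto_intros lim tendsto_form[OF u v v])
  moreover have "B (\<lambda>x. u n x - v x) (\<lambda>x. u n x - v x) + 2 * B (u n) v - B v v = B (u n) (u n)" for n
    using B_diff_quadratic[OF u v] by simp
  ultimately show ?thesis by simp
qed

end

section \<open>Square integrable functions\<close>

lemma L2_measurable [measurable_dest]: "u \<in> L2 M \<Longrightarrow> u \<in> borel_measurable M"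
  by (simp add: L2_def)

lemma L2_integrable_square: "u \<in> L2 M \<Longrightarrow> integrable M (\<lambda>x. (u x)\<^sup>2)"
  by (simp add: L2_def)

lemma L2_integrable_mult:
  assumes "u \<in> L2 M" "v \<in> L2 M"
  shows "integrable M (\<lambda>x. u x * v x)"
proof (rule Bochner_Integration.integrable_bound)
  show "integrable M (\<lambda>x. (u x)\<^sup>2 + (v x)\<^sup>2)"
    using assms by (intro Bochner_Integration.integrable_add L2_integrable_square)
  show "(\<lambda>x. u x * v x) \<in> borel_measurable M"
    using assms by measurable
  show "AE x in M. norm (u x * v x) \<le> norm ((u x)\<^sup>2 + (v x)\<^sup>2)"
  proof (rule AE_I2)
    fix x
    have "2 * (\<bar>u x\<bar> * \<bar>v x\<bar>) \<le> (u x)\<^sup>2 + (v x)\<^sup>2"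
      using zero_le_power2[of "\<bar>u x\<bar> - \<bar>v x\<bar>"] by (simp add: power2_diff algebra_simps)
    moreover have "0 \<le> \<bar>u x\<bar> * \<bar>v x\<bar>" by simp
    ultimately show "norm (u x * v x) \<le> norm ((u x)\<^sup>2 + (v x)\<^sup>2)"
      unfolding real_norm_def abs_mult by linarith
  qed
qed

lemma L2_lincomb:
  assumes "u \<in> L2 M" "v \<in> L2 M"
  shows "(\<lambda>x. a * u x + b * v x) \<in> L2 M"
proof -
  have "integrable M (\<lambda>x. a\<^sup>2 * (u x)\<^sup>2 + 2 * a * b * (u x * v x) + b\<^sup>2 * (v x)\<^sup>2)"
    using assms by (intro Bochner_Integration.integrable_add integrable_mult_right
        L2_integrable_square L2_integrable_mult)
  moreover have "a\<^sup>2 * (u x)\<^sup>2 + 2 * a * b * (u x * v x) + b\<^sup>2 * (v x)\<^sup>2 = (a * u x + b * v x)\<^sup>2" for x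
    by (simp add: power2_eq_square algebra_simps)
  moreover have "(\<lambda>x. a * u x + b * v x) \<in> borel_measurable M"
    using assms by measurable
  ultimately show ?thesis by (simp add: L2_def)
qed

definition inner_L2 :: "'a measure \<Rightarrow> ('a \<Rightarrow> real) \<Rightarrow> ('a \<Rightarrow> real) \<Rightarrow> real" where
  "inner_L2 M u v = (\<integral>x. u x * v x \<partial>M)"

interpretation L2: pos_form "L2 M" "inner_L2 M" for M
proof
  fix u v w and a b :: real
  assume uvw: "u \<in> L2 M" "v \<in> L2 M" "w \<in> L2 M"
  have "inner_L2 M (\<lambda>x. a * u x + b * v x) w = (\<integral>x. a * (u x * w x) + b * (v x * w x) \<partial>M)"
    by (simp add: inner_L2_def algebra_simps)
  also have "\<dots> = a * inner_L2 M u w + b * inner_L2 M v w"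
    using uvw by (subst Bochner_Integration.integral_add) (auto intro!: L2_integrable_mult simp: inner_L2_def)
  finally show "inner_L2 M (\<lambda>x. a * u x + b * v x) w = a * inner_L2 M u w + b * inner_L2 M v w" .
qed (auto simp: inner_L2_def mult.commute intro!: L2_lincomb)

lemma inner_L2_AE_cong:
  assumes "u \<in> borel_measurable M" "u' \<in> borel_measurable M" "v \<in> borel_measurable M" "v' \<in> borel_measurable M"
    and "AE x in M. u x = u' x" "AE x in M. v x = v' x"
  shows "inner_L2 M u v = inner_L2 M u' v'"
  unfolding inner_L2_def using assms by (intro integral_cong_AE) auto

lemma inner_L2_self_eq_0:
  assumes "u \<in> L2 M" "inner_L2 M u u = 0"
  shows "AE x in M. u x = 0"
  using assms integral_nonneg_eq_0_iff_AE[OF L2_integrable_mult[of u M u]] by (simp add: inner_L2_def)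

lemma E1_eq: "E1 M E u = E u u + inner_L2 M u u"
  by (simp add: E1_def inner_L2_def power2_eq_square)

section \<open>The resolvent of a closed form\<close>

sublocale dirichlet_form \<subseteq> form: pos_form F E
  by unfold_locales (fact F_lincomb E_lincomb E_sym E_nonneg)+

context dirichlet_form
begin

abbreviation ip :: "('a \<Rightarrow> real) \<Rightarrow> ('a \<Rightarrow> real) \<Rightarrow> real" where
  "ip \<equiv> inner_L2 M"

lemma F_L2: "u \<in> F \<Longrightarrow> u \<in> L2 M"
  using F_subset_L2 by auto

lemma pos_form_E_inner:
  assumes "0 \<le> \<alpha>"
  shows "pos_form F (\<lambda>u v. E u v + \<alpha> * ip u v)"
proof
  fix u v w and a b :: real
  assume "u \<in> F" "v \<in> F" "w \<in> F"
  then show "E (\<lambda>x. a * u x + b * v x) w + \<alpha> * ip (\<lambda>x. a * u x + b * v x) w =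
    a * (E u w + \<alpha> * ip u w) + b * (E v w + \<alpha> * ip v w)"
    by (simp add: E_lincomb L2.B_lincomb F_L2 algebra_simps)
qed (use assms in \<open>auto simp: F_lincomb E_sym L2.B_sym F_L2 E_nonneg L2.B_nonneg\<close>)

text \<open>In operator terms u = \<alpha> (\<alpha> - L)^(-1) g with L the generator; the factor
  \<alpha> normalises so that u tends to g as \<alpha> grows.\<close>

definition is_resolvent :: "real \<Rightarrow> ('a \<Rightarrow> real) \<Rightarrow> ('a \<Rightarrow> real) \<Rightarrow> bool" where
  "is_resolvent \<alpha> g u \<longleftrightarrow> u \<in> F \<and> (\<forall>v\<in>F. E u v = \<alpha> * ip (\<lambda>x. g x - u x) v)"

text \<open>Dirichlet principle: u is the minimiser of \<open>Q\<close> over \<open>F\<close>.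
  Strict convexity makes a minimising sequence Cauchy, and \<open>E_closed\<close> supplies its
  limit.\<close>

lemma resolvent_exists:
  assumes \<alpha>: "0 < \<alpha>" and g: "g \<in> L2 M"
  shows "\<exists>u. is_resolvent \<alpha> g u"
proof -
  define B where "B = (\<lambda>u v. E u v + \<alpha> * ip u v)"
  interpret B: pos_form F B
    unfolding B_def by (rule pos_form_E_inner) (use \<alpha> in simp)
  define Q where "Q v = B v v - 2 * \<alpha> * ip g v" for v
  have Q_lower: "- \<alpha> * ip g g \<le> Q v" if "v \<in> F" for v
  proof -
    have "Q v = E v v + \<alpha> * ip (\<lambda>x. v x - g x) (\<lambda>x. v x - g x) - \<alpha> * ip g g"
      using that g by (simp add: Q_def B_def L2.B_diff_quadratic F_L2 L2.B_sym[OF g F_L2[OF that]] algebra_simps)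
    then show ?thesis
      using E_nonneg[OF that] L2.B_nonneg[OF L2.V_diff[OF F_L2[OF that] g]] \<alpha> by simp
  qed
  define m where "m = Inf (Q ` F)"
  have bdd: "bdd_below (Q ` F)"
    using Q_lower by (auto simp: bdd_below_def)
  have m_le: "m \<le> Q v" if "v \<in> F" for v
    unfolding m_def using that by (intro cInf_lower bdd) auto
  have "\<exists>v\<in>F. Q v < m + 1 / real (Suc n)" for n
    using cInf_lessD[of "Q ` F" "m + 1 / real (Suc n)"] F_zero by (auto simp: m_def)
  then obtain v where vF: "\<And>n. v n \<in> F" and Qv: "\<And>n. Q (v n) < m + 1 / real (Suc n)"
    by metis
  \<comment> \<open>Parallelogram law: \<open>Q\<close> at the midpoint \<open>?w\<close> is not
    below m, which bounds the distance of two near-minimisers.\<close>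
  have B_le: "B (\<lambda>x. v i x - v j x) (\<lambda>x. v i x - v j x) \<le> 2 / real (Suc i) + 2 / real (Suc j)" for i j
  proof -
    let ?w = "\<lambda>x. 1/2 * v i x + 1/2 * v j x"
    have w: "?w \<in> F" using F_lincomb vF by blast
    have "B (\<lambda>x. v i x - v j x) (\<lambda>x. v i x - v j x) = 2 * Q (v i) + 2 * Q (v j) - 4 * Q ?w"
      unfolding Q_def B.B_quadratic[OF vF vF] B.B_diff_quadratic[OF vF vF]
        L2.B_lincomb_right[OF F_L2 F_L2 g, OF vF vF] by (simp add: field_simps power2_eq_square)
    also have "\<dots> \<le> 2 * (m + 1 / real (Suc i)) + 2 * (m + 1 / real (Suc j)) - 4 * m"
      using Qv[of i] Qv[of j] m_le[OF w] by (intro diff_mono add_mono) auto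
    finally show ?thesis by simp
  qed
  \<comment> \<open>\<open>E_closed\<close> speaks of \<open>E1\<close>, the estimates of
    \<open>B\<close>; for \<alpha> > 0 the two quadratic forms are equivalent.\<close>
  have E1_le: "E1 M E u \<le> (1 + 1 / \<alpha>) * B u u" if "u \<in> F" for u
  proof -
    have "0 \<le> E u u / \<alpha>" "0 \<le> \<alpha> * ip u u"
      using \<alpha> E_nonneg[OF that] L2.B_nonneg[OF F_L2[OF that]] by auto
    moreover have "(1 + 1 / \<alpha>) * B u u = E u u + ip u u + E u u / \<alpha> + \<alpha> * ip u u"
      using \<alpha> by (simp add: B_def field_simps)
    ultimately show ?thesis by (simp add: E1_eq)
  qed
  have "\<exists>N. \<forall>i\<ge>N. \<forall>j\<ge>N. E1 M E (\<lambda>x. v i x - v j x) < \<epsilon>" if \<epsilon>: "0 < \<epsilon>" for \<epsilon>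
  proof -
    define c where "c = (1 + 1 / \<alpha>)"
    have c: "c > 0" using \<alpha> by (simp add: c_def add_pos_pos)
    obtain N where N: "4 * c / \<epsilon> < real N"
      using reals_Archimedean2 by blast
    have "E1 M E (\<lambda>x. v i x - v j x) < \<epsilon>" if ij: "N \<le> i" "N \<le> j" for i j
    proof -
      have "4 * c / \<epsilon> < real (Suc k)" if "N \<le> k" for k
        using N that by linarith
      then have *: "c * (2 / real (Suc k)) < \<epsilon> / 2" if "N \<le> k" for k
        using \<epsilon> that by (simp add: field_simps)
      have "E1 M E (\<lambda>x. v i x - v j x) \<le> c * (2 / real (Suc i) + 2 / real (Suc j))"
        using order_trans[OF E1_le[OF form.V_diff[OF vF vF]] mult_left_mono[OF B_le]] c
        by (simp add: c_def)
      also have "\<dots> < \<epsilon>" using *[OF ij(1)] *[OF ij(2)] by (simp add: distrib_left)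
      finally show ?thesis .
    qed
    then show ?thesis by blast
  qed
  from E_closed[OF vF this] obtain u
    where u: "u \<in> F" and lim: "(\<lambda>n. E1 M E (\<lambda>x. v n x - u x)) \<longlonglongrightarrow> 0" by blast
  have B_le': "B w w \<le> (1 + \<alpha>) * E1 M E w" if "w \<in> F" for w
    using E_nonneg[OF that] L2.B_nonneg[OF F_L2[OF that]] \<alpha>
    by (simp add: B_def E1_eq algebra_simps)
  have limB: "(\<lambda>n. B (\<lambda>x. v n x - u x) (\<lambda>x. v n x - u x)) \<longlonglongrightarrow> 0"
  proof (rule Lim_null_comparison)
    show "(\<lambda>n. (1 + \<alpha>) * E1 M E (\<lambda>x. v n x - u x)) \<longlonglongrightarrow> 0"
      using tendsto_mult_left[OF lim, of "1 + \<alpha>"] by simp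
  qed (use B_le'[OF form.V_diff[OF vF u]] B.B_nonneg[OF form.V_diff[OF vF u]] in simp)
  have "B u w = \<alpha> * ip g w" if w: "w \<in> F" for w
  proof -
    \<comment> \<open>First-order condition at the minimum. The constant term is 0, so the
      discriminant bound makes the linear coefficient vanish.\<close>
    have "0 \<le> 0 + 2 * s * (B u w - \<alpha> * ip g w) + s\<^sup>2 * B w w" for s
    proof (rule LIMSEQ_le)
      show "(\<lambda>n. - (1 / real (Suc n))) \<longlonglongrightarrow> 0"
        using LIMSEQ_inverse_real_of_nat_add_minus[of 0] by (simp add: inverse_eq_divide)
      show "(\<lambda>n. 0 + 2 * s * (B (v n) w - \<alpha> * ip g w) + s\<^sup>2 * B w w) \<longlonglongrightarrow>
         0 + 2 * s * (B u w - \<alpha> * ip g w) + s\<^sup>2 * B w w"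
        by (intro tendsto_intros B.tendsto_form vF u w limB)
      have "- (1 / real (Suc n)) \<le> 2 * s * (B (v n) w - \<alpha> * ip g w) + s\<^sup>2 * B w w" for n
      proof -
        have "m \<le> Q (\<lambda>x. 1 * v n x + s * w x)"
          by (intro m_le F_lincomb vF w)
        also have "\<dots> = Q (v n) + 2 * s * (B (v n) w - \<alpha> * ip g w) + s\<^sup>2 * B w w"
          unfolding Q_def B.B_quadratic[OF vF w] L2.B_lincomb_right[OF F_L2 F_L2 g, OF vF w]
          by (simp add: algebra_simps)
        finally show ?thesis using Qv[of n] by simp
      qed
      then show "\<exists>N. \<forall>n\<ge>N. - (1 / real (Suc n)) \<le> 0 + 2 * s * (B (v n) w - \<alpha> * ip g w) + s\<^sup>2 * B w w"
        by simp
    qed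
    from discriminant_bound[OF this B.B_nonneg[OF w]] show ?thesis by simp
  qed
  then have "is_resolvent \<alpha> g u"
    using u g by (auto simp: is_resolvent_def B_def L2.B_diff F_L2 algebra_simps)
  then show ?thesis by blast
qed

text \<open>Completing the square around u. It exhibits q as the minimum over \<open>F\<close> of
  the penalised energy E(v,v) + \<alpha> ||v - g||^2, attained at u.\<close>

lemma resolvent_energy:
  assumes u: "is_resolvent \<alpha> g u" and g: "g \<in> L2 M"
  defines "q \<equiv> \<alpha> * ip (\<lambda>x. g x - u x) g"
  shows "v \<in> F \<Longrightarrow> E v v + \<alpha> * ip (\<lambda>x. v x - g x) (\<lambda>x. v x - g x) =
      q + E (\<lambda>x. v x - u x) (\<lambda>x. v x - u x) + \<alpha> * ip (\<lambda>x. v x - u x) (\<lambda>x. v x - u x)"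
    and "E u u + \<alpha> * ip (\<lambda>x. u x - g x) (\<lambda>x. u x - g x) = q"
proof -
  have uF: "u \<in> F" and Eu: "\<And>w. w \<in> F \<Longrightarrow> E u w = \<alpha> * (ip g w - ip u w)"
    using u g by (auto simp: is_resolvent_def L2.B_diff F_L2)
  show *: "E v v + \<alpha> * ip (\<lambda>x. v x - g x) (\<lambda>x. v x - g x) =
      q + E (\<lambda>x. v x - u x) (\<lambda>x. v x - u x) + \<alpha> * ip (\<lambda>x. v x - u x) (\<lambda>x. v x - u x)"
    if v: "v \<in> F" for v
    unfolding q_def form.B_diff_quadratic[OF v uF] L2.B_diff_quadratic[OF F_L2[OF v] g]
      L2.B_diff_quadratic[OF F_L2[OF v] F_L2[OF uF]] L2.B_diff[OF g F_L2[OF uF] g] E_sym[OF v uF] Eu[OF v] Eu[OF uF]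
      L2.B_sym[OF F_L2[OF uF] F_L2[OF v]] L2.B_sym[OF F_L2[OF uF] g] L2.B_sym[OF F_L2[OF v] g]
    by (simp add: algebra_simps)
  show "E u u + \<alpha> * ip (\<lambda>x. u x - g x) (\<lambda>x. u x - g x) = q"
    using *[OF uF] E_lincomb[OF F_zero F_zero F_zero, of 0 0] by (simp add: inner_L2_def)
qed

lemma E1_tendsto:
  assumes "\<And>n. u n \<in> F" "v \<in> F" and lim: "(\<lambda>n. E1 M E (\<lambda>x. u n x - v x)) \<longlonglongrightarrow> 0"
  shows "(\<lambda>n. E (\<lambda>x. u n x - v x) (\<lambda>x. u n x - v x)) \<longlonglongrightarrow> 0"
    and "(\<lambda>n. ip (\<lambda>x. u n x - v x) (\<lambda>x. u n x - v x)) \<longlonglongrightarrow> 0"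
proof -
  have F: "(\<lambda>x. u n x - v x) \<in> F" for n using assms by (intro form.V_diff)
  show "(\<lambda>n. E (\<lambda>x. u n x - v x) (\<lambda>x. u n x - v x)) \<longlonglongrightarrow> 0"
    "(\<lambda>n. ip (\<lambda>x. u n x - v x) (\<lambda>x. u n x - v x)) \<longlonglongrightarrow> 0"
    by (rule Lim_null_comparison[OF _ lim], use E_nonneg[OF F] L2.B_nonneg[OF F_L2[OF F]] in \<open>simp add: E1_eq\<close>)+
qed

text \<open>The minima \<open>q n\<close> grow with the weight of the penalty, and their increments
  dominate the squared \<open>E1\<close> distances of the minimisers. Bounded minima therefore make
  the minimisers Cauchy; the penalty also forces ||u n - g||^2 <= S / (n + 1), so the form limit is
  g.\<close>

lemma resolvents_converge:
  assumes g: "g \<in> L2 M" and u: "\<And>n. is_resolvent (real (Suc n)) g (u n)"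
    and bound: "\<And>n. real (Suc n) * ip (\<lambda>x. g x - u n x) g \<le> S"
  shows "g \<in> F" and "(\<lambda>n. E1 M E (\<lambda>x. u n x - g x)) \<longlonglongrightarrow> 0"
proof -
  define q where "q n = real (Suc n) * ip (\<lambda>x. g x - u n x) g" for n
  have uF: "u n \<in> F" for n using u by (simp add: is_resolvent_def)
  have E1_le: "E1 M E (\<lambda>x. u j x - u i x) \<le> q j - q i" if "i \<le> j" for i j
  proof -
    have w: "(\<lambda>x. u j x - g x) \<in> L2 M" "(\<lambda>x. u j x - u i x) \<in> L2 M"
      using L2.V_diff[OF F_L2[OF uF] g] L2.V_diff[OF F_L2[OF uF] F_L2[OF uF]] by auto
    have "q i + E (\<lambda>x. u j x - u i x) (\<lambda>x. u j x - u i x) + real (Suc i) * ip (\<lambda>x. u j x - u i x) (\<lambda>x. u j x - u i x)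
       = E (u j) (u j) + real (Suc i) * ip (\<lambda>x. u j x - g x) (\<lambda>x. u j x - g x)"
      using resolvent_energy(1)[OF u g uF] by (simp add: q_def)
    also have "\<dots> \<le> E (u j) (u j) + real (Suc j) * ip (\<lambda>x. u j x - g x) (\<lambda>x. u j x - g x)"
      using that L2.B_nonneg[OF w(1)] by (intro add_left_mono mult_right_mono) auto
    also have "\<dots> = q j"
      using resolvent_energy(2)[OF u g] by (simp add: q_def)
    finally have "q i + E (\<lambda>x. u j x - u i x) (\<lambda>x. u j x - u i x) +
      real (Suc i) * ip (\<lambda>x. u j x - u i x) (\<lambda>x. u j x - u i x) \<le> q j" .
    moreover have "ip (\<lambda>x. u j x - u i x) (\<lambda>x. u j x - u i x) \<le>
       real (Suc i) * ip (\<lambda>x. u j x - u i x) (\<lambda>x. u j x - u i x)"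
      using L2.B_nonneg[OF w(2)] by (simp add: mult_le_cancel_right1)
    ultimately show ?thesis by (simp add: E1_eq)
  qed
  have E1_nonneg: "0 \<le> E1 M E w" if "w \<in> F" for w
    using E_nonneg[OF that] L2.B_nonneg[OF F_L2[OF that]] by (simp add: E1_eq)
  have "q n \<le> q (Suc n)" for n
    using E1_le[of n "Suc n"] E1_nonneg[OF form.V_diff[OF uF uF], of "Suc n" n] by simp
  then have "incseq q" by (rule incseq_SucI)
  moreover have "\<forall>i. q i \<le> S" using bound by (simp add: q_def)
  ultimately obtain l where "q \<longlonglongrightarrow> l"
    using incseq_convergent by blast
  then have "Cauchy q"
    by (rule LIMSEQ_imp_Cauchy)
  have E1_sym: "E1 M E (\<lambda>x. u i x - u j x) = E1 M E (\<lambda>x. u j x - u i x)" for i j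
    using form.B_diff_quadratic[OF uF uF] L2.B_diff_quadratic[OF F_L2 F_L2, OF uF uF]
      E_sym[OF uF uF] L2.B_sym[OF F_L2 F_L2, OF uF uF] by (simp add: E1_eq)
  have "\<exists>N. \<forall>m\<ge>N. \<forall>n\<ge>N. E1 M E (\<lambda>x. u m x - u n x) < \<epsilon>" if \<epsilon>: "\<epsilon> > 0" for \<epsilon>
  proof -
    obtain N where N: "\<forall>m\<ge>N. \<forall>n\<ge>N. norm (q m - q n) < \<epsilon>"
      using CauchyD[OF \<open>Cauchy q\<close> \<epsilon>] by blast
    have "E1 M E (\<lambda>x. u m x - u n x) < \<epsilon>" if "N \<le> m" "N \<le> n" for m n
    proof (cases "n \<le> m")
      case True
      then show ?thesis using E1_le[of n m] N that by (smt (verit) real_norm_def)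
    next
      case False
      then show ?thesis using E1_le[of m n] E1_sym[of m n] N that by (smt (verit) real_norm_def nle_le)
    qed
    then show ?thesis by blast
  qed
  from E_closed[OF uF this] obtain v
    where v: "v \<in> F" and lim: "(\<lambda>n. E1 M E (\<lambda>x. u n x - v x)) \<longlonglongrightarrow> 0" by blast
  note lim_v = E1_tendsto(2)[OF uF v lim]
  have lim_g: "(\<lambda>n. ip (\<lambda>x. u n x - g x) (\<lambda>x. u n x - g x)) \<longlonglongrightarrow> 0"
  proof (rule Lim_null_comparison)
    show "(\<lambda>n. S * inverse (real (Suc n))) \<longlonglongrightarrow> 0"
      using tendsto_mult_left[OF LIMSEQ_inverse_real_of_nat, of S] by simp
    have "norm (ip (\<lambda>x. u n x - g x) (\<lambda>x. u n x - g x)) \<le> S * inverse (real (Suc n))" for n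
    proof -
      have "real (Suc n) * ip (\<lambda>x. u n x - g x) (\<lambda>x. u n x - g x) \<le> S"
        using resolvent_energy(2)[OF u g, of n] E_nonneg[OF uF, of n] bound[of n] by linarith
      then show ?thesis
        using L2.B_nonneg[OF L2.V_diff[OF F_L2[OF uF] g]] by (simp add: field_simps)
    qed
    then show "\<forall>\<^sub>F n in sequentially. norm (ip (\<lambda>x. u n x - g x) (\<lambda>x. u n x - g x)) \<le> S * inverse (real (Suc n))"
      by simp
  qed
  \<comment> \<open>The form limit v and the L2 limit g are compared by testing with their
    difference.\<close>
  let ?w = "\<lambda>x. g x - v x"
  have w: "?w \<in> L2 M" by (intro L2.V_diff g F_L2 v)
  have "(\<lambda>n. ip (u n) ?w) \<longlonglongrightarrow> ip v ?w"
    by (intro L2.tendsto_form F_L2 uF v w lim_v)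
  moreover have "(\<lambda>n. ip (u n) ?w) \<longlonglongrightarrow> ip g ?w"
    by (intro L2.tendsto_form F_L2 uF g w lim_g)
  ultimately have "ip v ?w = ip g ?w"
    by (rule LIMSEQ_unique)
  then have "ip ?w ?w = 0"
    using L2.B_diff[OF g F_L2[OF v] w] by simp
  with w have "AE x in M. g x - v x = 0"
    by (rule inner_L2_self_eq_0)
  then have AE: "AE x in M. v x = g x"
    by eventually_elim simp
  show gF: "g \<in> F"
    using F_AE_cong[OF v _ AE] g by (auto simp: L2_def)
  \<comment> \<open>The limit v is only a.e. equal to g; insensitivity of the form to null sets
    carries the convergence over.\<close>
  have "E1 M E (\<lambda>x. u n x - g x) = E1 M E (\<lambda>x. u n x - v x)" for n
  proof -
    let ?a = "\<lambda>x. u n x - g x" and ?b = "\<lambda>x. u n x - v x"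
    have ab: "?a \<in> F" "?b \<in> F" using form.V_diff uF gF v by auto
    have AEab: "AE x in M. ?a x = ?b x" using AE by eventually_elim simp
    have "E ?a ?a = E ?b ?b"
      using E_AE_cong[OF ab ab(1) AEab] E_AE_cong[OF ab ab(2) AEab] E_sym[OF ab] by simp
    moreover have "ip ?a ?a = ip ?b ?b"
      by (intro inner_L2_AE_cong AEab) (use F_L2[OF ab(1)] F_L2[OF ab(2)] in \<open>auto simp: L2_def\<close>)
    ultimately show ?thesis by (simp add: E1_eq)
  qed
  then show "(\<lambda>n. E1 M E (\<lambda>x. u n x - g x)) \<longlonglongrightarrow> 0"
    using lim by simp
qed

end

section \<open>Approximating a form by its semigroup\<close>

locale heat_form = dirichlet_form M F E
  for M :: "'a measure" and F :: "('a \<Rightarrow> real) set" and E :: "('a \<Rightarrow> real) \<Rightarrow> ('a \<Rightarrow> real) \<Rightarrow> real" +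
  fixes P :: "real \<Rightarrow> ('a \<Rightarrow> real) \<Rightarrow> 'a \<Rightarrow> real"
  assumes heat: "heat_semigroup M F E P"
begin

lemma P_L2: "0 < t \<Longrightarrow> g \<in> L2 M \<Longrightarrow> P t g \<in> L2 M"
  using heat[unfolded heat_semigroup_def, THEN conjunct1] by blast

lemma P_lincomb:
  "0 < t \<Longrightarrow> g \<in> L2 M \<Longrightarrow> h \<in> L2 M \<Longrightarrow>
    AE x in M. P t (\<lambda>y. a * g y + b * h y) x = a * P t g x + b * P t h x"
  using heat[unfolded heat_semigroup_def, THEN conjunct2, THEN conjunct1] by blast

lemma P_contraction: "0 < t \<Longrightarrow> g \<in> L2 M \<Longrightarrow> ip (P t g) (P t g) \<le> ip g g"
  using heat[unfolded heat_semigroup_def, THEN conjunct2, THEN conjunct2, THEN conjunct1]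
  unfolding inner_L2_def power2_eq_square by blast

lemma P_sym:
  "0 < t \<Longrightarrow> g \<in> L2 M \<Longrightarrow> h \<in> L2 M \<Longrightarrow> ip (P t g) h = ip g (P t h)"
  using heat[unfolded heat_semigroup_def, THEN conjunct2, THEN conjunct2, THEN conjunct2, THEN conjunct1]
  unfolding inner_L2_def by blast

lemma P_semigroup:
  "0 < s \<Longrightarrow> 0 < t \<Longrightarrow> g \<in> L2 M \<Longrightarrow> AE x in M. P (s + t) g x = P s (P t g) x"
  using heat[unfolded heat_semigroup_def, THEN conjunct2, THEN conjunct2, THEN conjunct2, THEN conjunct2,
      THEN conjunct1] by blast

lemma P_generator:
  assumes "u \<in> F" "w \<in> L2 M" "\<And>v. v \<in> F \<Longrightarrow> E u v = - ip w v"
  shows "((\<lambda>t. \<integral>x. ((P t u x - u x) / t - w x)\<^sup>2 \<partial>M) \<longlongrightarrow> 0) (at_right 0)"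
  using heat[unfolded heat_semigroup_def, THEN conjunct2, THEN conjunct2, THEN conjunct2, THEN conjunct2,
      THEN conjunct2, THEN conjunct2, rule_format, OF F_L2[OF assms(1)] assms(2)] assms
  unfolding inner_L2_def by blast

definition approx_form :: "real \<Rightarrow> ('a \<Rightarrow> real) \<Rightarrow> ('a \<Rightarrow> real) \<Rightarrow> real" where
  "approx_form t u v = ip (\<lambda>x. u x - P t u x) v / t"

lemma approx_form_eq:
  assumes "0 < t" "u \<in> L2 M" "v \<in> L2 M"
  shows "approx_form t u v = (ip u v - ip (P t u) v) / t"
  using assms by (simp add: approx_form_def L2.B_diff P_L2)

text \<open>Positivity is <P_t u, u> <= ||P_t u|| ||u|| <= ||u||^2, by contraction.\<close>

lemma pos_form_approx:
  assumes t: "0 < t"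
  shows "pos_form (L2 M) (approx_form t)"
proof
  fix u v w and a b :: real
  assume u: "u \<in> L2 M" and v: "v \<in> L2 M" and w: "w \<in> L2 M"
  have "ip (P t (\<lambda>x. a * u x + b * v x)) w = ip (\<lambda>x. a * P t u x + b * P t v x) w"
    by (intro inner_L2_AE_cong P_lincomb t u v L2_measurable L2.V_lincomb P_L2 w) auto
  then show "approx_form t (\<lambda>x. a * u x + b * v x) w = a * approx_form t u w + b * approx_form t v w"
    using t by (simp add: approx_form_eq u v w L2.V_lincomb L2.B_lincomb P_L2 field_simps)
next
  fix u v assume u: "u \<in> L2 M" and v: "v \<in> L2 M"
  show "approx_form t u v = approx_form t v u"
    using t by (simp add: approx_form_eq u v P_sym[OF t u v] L2.B_sym[OF u v] L2.B_sym[OF u P_L2[OF t v]])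
next
  fix u assume u: "u \<in> L2 M"
  have "(ip (P t u) u)\<^sup>2 \<le> ip (P t u) (P t u) * ip u u"
    by (intro L2.Cauchy_Schwarz P_L2 t u)
  also have "\<dots> \<le> (ip u u)\<^sup>2"
    unfolding power2_eq_square by (intro mult_right_mono P_contraction t u L2.B_nonneg)
  finally have "ip (P t u) u \<le> ip u u"
    by (rule power2_le_imp_le) (rule L2.B_nonneg[OF u])
  then show "0 \<le> approx_form t u u"
    using t by (simp add: approx_form_eq u)
qed (rule L2.V_lincomb)

text \<open><P_t u, u> = ||P_{t/2} u||^2 is nonnegative. The bound makes the approximating form
  continuous in the L2 norm for fixed t.\<close>

lemma approx_form_le:
  assumes t: "0 < t" and u: "u \<in> L2 M"
  shows "approx_form t u u \<le> ip u u / t"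
proof -
  have h: "0 < t / 2" using t by simp
  have "ip (P t u) u = ip (P (t / 2) (P (t / 2) u)) u"
    using P_semigroup[OF h h u] by (intro inner_L2_AE_cong L2_measurable P_L2 h t u) auto
  also have "\<dots> = ip (P (t / 2) u) (P (t / 2) u)"
    by (intro P_sym h P_L2 u)
  also have "\<dots> \<ge> 0" by (intro L2.B_nonneg P_L2 h u)
  finally show ?thesis using t by (simp add: approx_form_eq u divide_right_mono)
qed

text \<open>Since \<open>I - P\<^sub>2\<^sub>t = (I - P\<^sub>t) (I + P\<^sub>t)\<close>, the difference of the two sides is
  \<open>\<parallel>u - P\<^sub>t u\<parallel>\<^sup>2 / 2t\<close>.\<close>

lemma approx_form_double:
  assumes t: "0 < t" and u: "u \<in> L2 M"
  shows "approx_form (2 * t) u u \<le> approx_form t u u"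
proof -
  have "ip (P (2 * t) u) u = ip (P t (P t u)) u"
    using P_semigroup[OF t t u] t unfolding mult_2
    by (intro inner_L2_AE_cong L2_measurable P_L2 t u add_pos_pos) auto
  also have "\<dots> = ip (P t u) (P t u)"
    by (intro P_sym t P_L2 u)
  finally have *: "ip (P (2 * t) u) u = ip (P t u) (P t u)" .
  have "0 \<le> ip (\<lambda>x. u x - P t u x) (\<lambda>x. u x - P t u x)"
    by (intro L2.B_nonneg L2.V_diff P_L2 t u)
  also have "\<dots> = ip u u - 2 * ip (P t u) u + ip (P t u) (P t u)"
    by (simp add: L2.B_diff_quadratic P_L2 t u L2.B_sym[OF P_L2[OF t u] u])
  also have "\<dots> = 2 * t * (approx_form t u u - approx_form (2 * t) u u)"
    unfolding approx_form_eq[OF t u u] approx_form_eq[OF mult_pos_pos[OF zero_less_numeral t] u u] *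
    using t by (simp add: field_simps)
  finally show ?thesis using t by (simp add: zero_le_mult_iff)
qed

lemma approx_form_dyadic:
  assumes t: "0 < t" and u: "u \<in> L2 M"
  shows "approx_form (2 ^ n * t) u u \<le> approx_form t u u"
proof (induction n)
  case (Suc n)
  then show ?case
    using approx_form_double[of "2 ^ n * t" u] t u by (simp add: mult.assoc)
qed simp

text \<open>u lies in the domain of the generator, with image \<alpha> (u - g), so (u - P_t u) / t
  converges strongly in L2.\<close>

lemma approx_form_resolvent_tendsto:
  assumes u: "is_resolvent \<alpha> g u" and g: "g \<in> L2 M" and v: "v \<in> L2 M"
  shows "((\<lambda>t. approx_form t u v) \<longlongrightarrow> \<alpha> * ip (\<lambda>x. g x - u x) v) (at_right 0)"
proof -
  let ?w = "\<lambda>x. \<alpha> * (u x - g x)"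
  have uF: "u \<in> F" using u by (simp add: is_resolvent_def)
  note uL = F_L2[OF uF]
  have w: "?w \<in> L2 M" by (intro L2.V_scale L2.V_diff uL g)
  have inner_w: "ip ?w h = - (\<alpha> * ip (\<lambda>x. g x - u x) h)" if "h \<in> L2 M" for h
    using L2.B_lincomb[OF uL g that, of \<alpha> "- \<alpha>"] L2.B_diff[OF g uL that]
    by (simp add: right_diff_distrib)
  have "E u h = - ip ?w h" if "h \<in> F" for h
    using u inner_w[OF F_L2[OF that]] that by (simp add: is_resolvent_def)
  then have "((\<lambda>t. \<integral>x. ((P t u x - u x) / t - ?w x)\<^sup>2 \<partial>M) \<longlongrightarrow> 0) (at_right 0)"
    by (rule P_generator[OF uF w])
  then have lim: "((\<lambda>t. sqrt (\<integral>x. ((P t u x - u x) / t - ?w x)\<^sup>2 \<partial>M) * sqrt (ip v v)) \<longlongrightarrow>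
      sqrt 0 * sqrt (ip v v)) (at_right 0)"
    by (intro tendsto_intros)
  have "((\<lambda>t. approx_form t u v - \<alpha> * ip (\<lambda>x. g x - u x) v) \<longlongrightarrow> 0) (at_right 0)"
  proof (rule Lim_null_comparison)
    show "((\<lambda>t. sqrt (\<integral>x. ((P t u x - u x) / t - ?w x)\<^sup>2 \<partial>M) * sqrt (ip v v)) \<longlongrightarrow> 0) (at_right 0)"
      using lim by simp
    have "norm (approx_form t u v - \<alpha> * ip (\<lambda>x. g x - u x) v) \<le>
        sqrt (\<integral>x. ((P t u x - u x) / t - ?w x)\<^sup>2 \<partial>M) * sqrt (ip v v)" if t: "0 < t" for t
    proof -
      let ?d = "\<lambda>x. (1 / t) * P t u x + (- 1 / t) * u x"
      let ?z = "\<lambda>x. ?d x - ?w x"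
      have d: "?d \<in> L2 M" by (intro L2.V_lincomb P_L2 t uL)
      have "ip ?z v = - (approx_form t u v - \<alpha> * ip (\<lambda>x. g x - u x) v)"
        unfolding L2.B_diff[OF d w v] L2.B_lincomb[OF P_L2[OF t uL] uL v] inner_w[OF v] approx_form_eq[OF t uL v]
        using t by (simp add: field_simps)
      then have "norm (approx_form t u v - \<alpha> * ip (\<lambda>x. g x - u x) v) = \<bar>ip ?z v\<bar>"
        by simp
      also have "\<dots> \<le> sqrt (ip ?z ?z) * sqrt (ip v v)"
        by (intro L2.Cauchy_Schwarz_abs L2.V_diff d w v)
      also have "ip ?z ?z = (\<integral>x. ((P t u x - u x) / t - ?w x)\<^sup>2 \<partial>M)"
        using t by (simp add: inner_L2_def power2_eq_square field_simps)
      finally show ?thesis .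
    qed
    then show "\<forall>\<^sub>F t in at_right 0. norm (approx_form t u v - \<alpha> * ip (\<lambda>x. g x - u x) v) \<le>
        sqrt (\<integral>x. ((P t u x - u x) / t - ?w x)\<^sup>2 \<partial>M) * sqrt (ip v v)"
      by (auto simp: eventually_at_filter)
  qed
  then show ?thesis by (simp add: LIM_zero_iff)
qed

text \<open>Along t / 2^n the approximating values increase to E(u,u), so the one at t lies
  below.\<close>

lemma approx_form_le_resolvent:
  assumes u: "is_resolvent \<alpha> g u" and g: "g \<in> L2 M" and t: "0 < t"
  shows "approx_form t u u \<le> E u u"
proof -
  have uF: "u \<in> F" using u by (simp add: is_resolvent_def)
  have "((\<lambda>t. approx_form t u u) \<longlongrightarrow> E u u) (at_right 0)"
    using approx_form_resolvent_tendsto[OF u g F_L2[OF uF]] u uF by (simp add: is_resolvent_def)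
  moreover have "filterlim (\<lambda>n. t * (1/2) ^ n) (at_right 0) sequentially"
  proof (rule tendsto_imp_filterlim_at_right)
    show "(\<lambda>n. t * (1/2) ^ n) \<longlonglongrightarrow> 0"
      using tendsto_mult_left[OF LIMSEQ_power_zero[of "1/2 :: real"], of t] by simp
  qed (use t in auto)
  ultimately have lim: "(\<lambda>n. approx_form (t * (1/2) ^ n) u u) \<longlonglongrightarrow> E u u"
    by (rule filterlim_compose)
  have "approx_form t u u \<le> approx_form (t * (1/2) ^ n) u u" for n
    using approx_form_dyadic[of "t * (1/2) ^ n" u n] t F_L2[OF uF]
    by (simp add: power_one_over)
  then show ?thesis
    using LIMSEQ_le_const[OF lim] by blast
qed

section \<open>Domain and limit of the approximating forms\<close>

lemma resolvent_seq:
  assumes "g \<in> L2 M"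
  obtains u where "\<And>n. is_resolvent (real (Suc n)) g (u n)"
proof -
  have "\<forall>n. \<exists>u. is_resolvent (real (Suc n)) g u"
    using resolvent_exists[OF _ assms] by simp
  then show ?thesis using that by metis
qed

text \<open>The bound passes from the approximating forms to the minima: \<open>q n\<close> is the
  limit of the approximating forms at (u n, g), so Cauchy-Schwarz gives q n <= sqrt (q n) sqrt S,
  hence q n <= S.\<close>

theorem mem_form_domain:
  assumes g: "g \<in> L2 M" and bound: "\<forall>\<^sub>F t in at_right 0. approx_form t g g \<le> S"
  shows "g \<in> F" and "E g g \<le> S"
proof -
  obtain u where u: "\<And>n. is_resolvent (real (Suc n)) g (u n)"
    using resolvent_seq[OF g] by blast
  have uF: "u n \<in> F" for n using u by (simp add: is_resolvent_def)
  define q where "q n = real (Suc n) * ip (\<lambda>x. g x - u n x) g" for n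
  have E_le: "E (u n) (u n) \<le> q n" for n
  proof -
    have "0 \<le> real (Suc n) * ip (\<lambda>x. u n x - g x) (\<lambda>x. u n x - g x)"
      by (intro mult_nonneg_nonneg L2.B_nonneg L2.V_diff F_L2 uF g) simp
    then show ?thesis
      using resolvent_energy(2)[OF u[of n] g] unfolding q_def by linarith
  qed
  have q_nonneg: "0 \<le> q n" for n using E_le[of n] E_nonneg[OF uF] by (rule order_trans[rotated])
  obtain t where "0 < t" "approx_form t g g \<le> S"
    using eventually_happens'[OF trivial_limit_at_right_real eventually_conj[OF bound eventually_at_right_less[of 0]]]
    by auto
  then have S: "0 \<le> S"
    using pos_form.B_nonneg[OF pos_form_approx g] by (meson order_trans)
  have q_le: "q n \<le> S" for n
  proof -
    have "q n \<le> sqrt (E (u n) (u n)) * sqrt S"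
    proof (rule tendsto_upperbound)
      show "((\<lambda>t. approx_form t (u n) g) \<longlongrightarrow> q n) (at_right 0)"
        unfolding q_def by (rule approx_form_resolvent_tendsto[OF u g g])
      have "\<forall>\<^sub>F t in at_right 0. (0::real) < t" by (simp add: eventually_at_filter)
      with bound show "\<forall>\<^sub>F t in at_right 0. approx_form t (u n) g \<le> sqrt (E (u n) (u n)) * sqrt S"
      proof eventually_elim
        case (elim t)
        interpret A: pos_form "L2 M" "approx_form t" using elim by (intro pos_form_approx)
        have "approx_form t (u n) g \<le> sqrt (approx_form t (u n) (u n)) * sqrt (approx_form t g g)"
          using A.Cauchy_Schwarz_abs[OF F_L2[OF uF] g, of n] by simp
        also have "\<dots> \<le> sqrt (E (u n) (u n)) * sqrt S"
          using elim approx_form_le_resolvent[OF u g, of t n] A.B_nonneg[OF F_L2[OF uF]] A.B_nonneg[OF g] E_nonneg[OF uF] S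
          by (intro mult_mono real_sqrt_le_mono) auto
        finally show ?case .
      qed
    qed simp
    also have "\<dots> \<le> sqrt (q n) * sqrt S"
      using E_le E_nonneg[OF uF] q_nonneg S by (intro mult_mono real_sqrt_le_mono) (auto simp: real_sqrt_ge_0_iff)
    finally have "sqrt (q n) * sqrt (q n) \<le> sqrt (q n) * sqrt S"
      using q_nonneg by simp
    then have "q n \<le> S"
      using q_nonneg[of n] S by (cases "q n = 0") (simp_all del: real_sqrt_mult_self)
    then show ?thesis by simp
  qed
  note conv = resolvents_converge[OF g u q_le[unfolded q_def]]
  show gF: "g \<in> F" by (rule conv)
  have lim: "(\<lambda>n. E (u n) (u n)) \<longlonglongrightarrow> E g g"
    by (intro form.tendsto_quadratic uF gF E1_tendsto(1)[OF uF gF conv(2)])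
  show "E g g \<le> S"
    by (rule LIMSEQ_le_const2[OF lim]) (use E_le q_le order_trans in blast)
qed

text \<open>For g in the domain, E(g,g) itself bounds the minima: test the penalised energy with v =
  g, where the penalty vanishes.\<close>

lemma resolvent_approximation:
  assumes g: "g \<in> F"
  obtains u where "\<And>n. is_resolvent (real (Suc n)) g (u n)" "\<And>n. u n \<in> F"
    "(\<lambda>n. E (\<lambda>x. u n x - g x) (\<lambda>x. u n x - g x)) \<longlonglongrightarrow> 0"
    "(\<lambda>n. ip (\<lambda>x. u n x - g x) (\<lambda>x. u n x - g x)) \<longlonglongrightarrow> 0"
proof -
  note gL = F_L2[OF g]
  obtain u where u: "\<And>n. is_resolvent (real (Suc n)) g (u n)"
    using resolvent_seq[OF gL] by blast
  have uF: "u n \<in> F" for n using u by (simp add: is_resolvent_def)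
  have "real (Suc n) * ip (\<lambda>x. g x - u n x) g \<le> E g g" for n
  proof -
    have "E g g + real (Suc n) * ip (\<lambda>x. 0) (\<lambda>x. 0) = real (Suc n) * ip (\<lambda>x. g x - u n x) g
        + E (\<lambda>x. g x - u n x) (\<lambda>x. g x - u n x)
        + real (Suc n) * ip (\<lambda>x. g x - u n x) (\<lambda>x. g x - u n x)"
      using resolvent_energy(1)[OF u gL g, of n] by simp
    moreover have "0 \<le> E (\<lambda>x. g x - u n x) (\<lambda>x. g x - u n x)"
      "0 \<le> real (Suc n) * ip (\<lambda>x. g x - u n x) (\<lambda>x. g x - u n x)"
      using form.B_nonneg[OF form.V_diff[OF g uF]] L2.B_nonneg[OF F_L2[OF form.V_diff[OF g uF]]] by auto
    ultimately show ?thesis by (simp add: inner_L2_def)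
  qed
  from that[OF u uF E1_tendsto[OF uF g resolvents_converge(2)[OF gL u this]]] show ?thesis .
qed

text \<open>Known for resolvents; both sides pass to the limit, the left by L2 continuity at fixed
  t, the right by convergence in the form.\<close>

lemma approx_form_le_form:
  assumes g: "g \<in> F" and t: "0 < t"
  shows "approx_form t g g \<le> E g g"
proof -
  interpret A: pos_form "L2 M" "approx_form t" using t by (intro pos_form_approx)
  note gL = F_L2[OF g]
  obtain u where u: "\<And>n. is_resolvent (real (Suc n)) g (u n)" and uF: "\<And>n. u n \<in> F"
    and lim: "(\<lambda>n. E (\<lambda>x. u n x - g x) (\<lambda>x. u n x - g x)) \<longlonglongrightarrow> 0"
    and lim2: "(\<lambda>n. ip (\<lambda>x. u n x - g x) (\<lambda>x. u n x - g x)) \<longlonglongrightarrow> 0"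
    by (rule resolvent_approximation[OF g]) (rule that; assumption)
  have dF: "(\<lambda>x. u n x - g x) \<in> F" for n using form.V_diff[OF uF g] .
  have lim_E: "(\<lambda>n. E (u n) (u n)) \<longlonglongrightarrow> E g g"
    by (intro form.tendsto_quadratic uF g lim)
  have "(\<lambda>n. approx_form t (\<lambda>x. u n x - g x) (\<lambda>x. u n x - g x)) \<longlonglongrightarrow> 0"
  proof (rule Lim_null_comparison)
    show "(\<lambda>n. ip (\<lambda>x. u n x - g x) (\<lambda>x. u n x - g x) / t) \<longlonglongrightarrow> 0"
      using tendsto_divide[OF lim2 tendsto_const, of t] t by simp
    show "\<forall>\<^sub>F n in sequentially. norm (approx_form t (\<lambda>x. u n x - g x) (\<lambda>x. u n x - g x)) \<le>
        ip (\<lambda>x. u n x - g x) (\<lambda>x. u n x - g x) / t"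
      using approx_form_le[OF t F_L2[OF dF]] A.B_nonneg[OF F_L2[OF dF]] by simp
  qed
  then have lim_A: "(\<lambda>n. approx_form t (u n) (u n)) \<longlonglongrightarrow> approx_form t g g"
    by (intro A.tendsto_quadratic F_L2 uF g)
  show ?thesis
    by (rule LIMSEQ_le[OF lim_A lim_E]) (use approx_form_le_resolvent[OF u gL t] in blast)
qed

text \<open>The limit is known when g is a resolvent. Since \<open>E\<close> dominates the
  approximating forms, replacing g by u n costs an error that is uniform in t.\<close>

theorem approx_form_tendsto:
  assumes g: "g \<in> F" and v: "v \<in> F"
  shows "((\<lambda>t. approx_form t g v) \<longlongrightarrow> E g v) (at_right 0)"
proof (rule tendstoI)
  fix \<epsilon> :: real assume \<epsilon>: "0 < \<epsilon>"
  obtain u where u: "\<And>n. is_resolvent (real (Suc n)) g (u n)" and uF: "\<And>n. u n \<in> F"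
    and lim: "(\<lambda>n. E (\<lambda>x. u n x - g x) (\<lambda>x. u n x - g x)) \<longlonglongrightarrow> 0"
    and lim2: "(\<lambda>n. ip (\<lambda>x. u n x - g x) (\<lambda>x. u n x - g x)) \<longlonglongrightarrow> 0"
    by (rule resolvent_approximation[OF g]) (rule that; assumption)
  have dF: "(\<lambda>x. u n x - g x) \<in> F" for n using form.V_diff[OF uF g] .
  have "(\<lambda>n. sqrt (E (\<lambda>x. u n x - g x) (\<lambda>x. u n x - g x)) * sqrt (E v v)) \<longlonglongrightarrow> sqrt 0 * sqrt (E v v)"
    by (intro tendsto_intros lim)
  then have "\<forall>\<^sub>F n in sequentially. sqrt (E (\<lambda>x. u n x - g x) (\<lambda>x. u n x - g x)) * sqrt (E v v) < \<epsilon> / 3"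
    using \<epsilon> by (intro order_tendstoD(2)[where y = "sqrt 0 * sqrt (E v v)"]) auto
  then obtain n where n: "sqrt (E (\<lambda>x. u n x - g x) (\<lambda>x. u n x - g x)) * sqrt (E v v) < \<epsilon> / 3"
    using eventually_happens'[OF trivial_limit_sequentially] by blast
  have "((\<lambda>t. approx_form t (u n) v) \<longlongrightarrow> E (u n) v) (at_right 0)"
    using approx_form_resolvent_tendsto[OF u[of n] F_L2[OF g] F_L2[OF v]] u[of n] v by (simp add: is_resolvent_def)
  then have "\<forall>\<^sub>F t in at_right 0. dist (approx_form t (u n) v) (E (u n) v) < \<epsilon> / 3"
    using \<epsilon> by (intro tendstoD) auto
  with eventually_at_right_less[of 0]
  show "\<forall>\<^sub>F t in at_right 0. dist (approx_form t g v) (E g v) < \<epsilon>"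
  proof eventually_elim
    case (elim t)
    interpret A: pos_form "L2 M" "approx_form t" using elim by (intro pos_form_approx)
    let ?d = "\<lambda>x. u n x - g x"
    have "\<bar>approx_form t ?d v\<bar> \<le> sqrt (approx_form t ?d ?d) * sqrt (approx_form t v v)"
      by (intro A.Cauchy_Schwarz_abs F_L2 dF v)
    also have "\<dots> \<le> sqrt (E ?d ?d) * sqrt (E v v)"
      using A.B_nonneg[OF F_L2[OF v]] E_nonneg[OF dF] elim
      by (intro mult_mono real_sqrt_le_mono approx_form_le_form dF v) auto
    finally have "\<bar>approx_form t ?d v\<bar> < \<epsilon> / 3" using n by simp
    moreover have "\<bar>E ?d v\<bar> < \<epsilon> / 3"
      using form.Cauchy_Schwarz_abs[OF dF v, of n] n by simp
    ultimately show ?case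
      using elim A.B_diff[OF F_L2[OF uF] F_L2[OF g] F_L2[OF v], of n] form.B_diff[OF uF g v, of n]
      unfolding dist_real_def by linarith
  qed
qed

end

section \<open>Heat kernel estimates\<close>

lemma powr_le_exp:
  fixes d \<epsilon> :: real
  assumes "0 \<le> d" "0 < \<epsilon>"
  shows "\<exists>C>0. \<forall>z\<ge>0. z powr d \<le> C * exp (\<epsilon> * z)"
\<comment> \<open>The constant is s^(-d) with s = \<epsilon> / (d + 1), from ln (s z) <= s z - 1.
  Dividing by d + 1 rather than d admits d = 0.\<close>
proof (intro exI[of _ "exp (d * - ln (\<epsilon> / (d + 1)))"] conjI allI impI)
  fix z :: real assume z: "0 \<le> z"
  show "z powr d \<le> exp (d * - ln (\<epsilon> / (d + 1))) * exp (\<epsilon> * z)"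
  proof (cases "z = 0")
    case False
    define s where "s = \<epsilon> / (d + 1)"
    have s: "0 < s" using assms by (simp add: s_def)
    have "ln s + ln z \<le> s * z"
      using ln_le_minus_one[of "s * z"] s z False by (simp add: ln_mult)
    then have "d * ln z \<le> d * (s * z - ln s)"
      using assms by (intro mult_left_mono) auto
    also have "\<dots> \<le> \<epsilon> * z + d * - ln s"
    proof -
      have "d * s \<le> \<epsilon>" using assms by (simp add: s_def field_simps)
      then have "d * s * z \<le> \<epsilon> * z" using z by (rule mult_right_mono)
      then show ?thesis by (simp add: algebra_simps)
    qed
    finally show ?thesis
      using z False by (simp add: powr_def s_def exp_add[symmetric] mult_exp_exp add.commute)
  qed simp
qed simp

context sub_gaussian_dirichlet_space
begin

section \<open>Volumes of balls and measurability of the kernel\<close>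

lemma sets_M [measurable_cong, simp]: "sets M = sets borel"
  using radon by (simp add: radon_measure_def)

lemma space_M [simp]: "space M = UNIV"
  using sets_eq_imp_space_eq[OF sets_M] by simp

lemma finite_ball: "emeasure M (ball x r) < \<infinity>"
proof (cases "0 \<le> r")
  case True
  obtain c1 c2 where "\<And>x r. 0 \<le> r \<Longrightarrow> emeasure M (ball x r) \<le> ennreal (c2 * r powr dH)"
    using ahlfors_regular by metis
  from this[OF True, of x] show ?thesis by (rule order_le_less_trans) simp
qed (simp add: ball_empty)

lemma emeasure_ball: "emeasure M (ball x r) = ennreal (measure M (ball x r))"
  using finite_ball[of x r] by (simp add: emeasure_eq_ennreal_measure less_top)

lemma ball_measure_lower: "\<exists>c>0. \<forall>x r. 0 \<le> r \<longrightarrow> c * r powr dH \<le> measure M (ball x r)"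
  using ahlfors_regular unfolding emeasure_ball by (metis ennreal_le_iff measure_nonneg)

lemma ball_measure_upper: "\<exists>c>0. \<forall>x r. 0 \<le> r \<longrightarrow> measure M (ball x r) \<le> c * r powr dH"
  using ahlfors_regular unfolding emeasure_ball
  by (metis ennreal_le_iff less_imp_le mult_nonneg_nonneg powr_ge_zero)

lemma ball_measure_pos:
  assumes "0 < r"
  shows "0 < measure M (ball x r)"
proof -
  obtain c1 where c1: "0 < c1" and lb: "\<And>x r. 0 \<le> r \<Longrightarrow> c1 * r powr dH \<le> measure M (ball x r)"
    using ball_measure_lower by blast
  have "0 < c1 * r powr dH" using c1 assms by simp
  also have "\<dots> \<le> measure M (ball x r)" using assms by (intro lb) simp
  finally show ?thesis .
qed

lemma sigma_finite_M: "sigma_finite_measure M"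
proof
  define z :: 'a where "z = undefined"
  have "(\<Union>n. ball z (real n)) = UNIV"
    by (auto simp: reals_Archimedean2)
  then show "\<exists>A. countable A \<and> A \<subseteq> sets M \<and> \<Union> A = space M \<and> (\<forall>a\<in>A. emeasure M a \<noteq> \<infinity>)"
    using finite_ball by (intro exI[of _ "range (\<lambda>n. ball z (real n))"]) (auto simp: less_top[symmetric])
qed

sublocale M: sigma_finite_measure M
  by (rule sigma_finite_M)

sublocale MM: pair_sigma_finite M M ..

sublocale heat_form M F E "heat_op M p"
  by unfold_locales (rule kernel_semigroup)

abbreviation P :: "real \<Rightarrow> ('a \<Rightarrow> real) \<Rightarrow> 'a \<Rightarrow> real" where
  "P \<equiv> heat_op M p"

lemma kernel_measurable [measurable]:
  assumes "0 < t"
  shows "(\<lambda>(x, y). p t x y) \<in> borel_measurable (M \<Otimes>\<^sub>M M)"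
proof -
  have "(\<lambda>(x, y). p t x y) \<in> borel_measurable (borel \<Otimes>\<^sub>M borel)"
    using borel_measurable_continuous_onI[OF kernel_continuous[OF assms]] by (simp add: borel_prod)
  then show ?thesis
    by (simp cong: measurable_cong_sets sets_pair_measure_cong)
qed

lemma kernel_measurable2 [measurable]:
  assumes "0 < t"
  shows "p t x \<in> borel_measurable M"
  using measurable_compose[OF measurable_Pair1' kernel_measurable[OF assms], of x] by simp

text \<open>Fubini turns the product null set into iterated ones. It depends on t, so what follows
  holds a.e. for fixed t, and at most countably many times are combined at once.\<close>

lemma kernel_bounds_AE:
  obtains c3 c4 c5 c6 where "0 < c3" "0 < c4" "0 < c5" "0 < c6"
    "\<And>t. 0 < t \<Longrightarrow> AE x in M. AE y in M. sub_gaussian dH dW c5 c6 t x y \<le> p t x y \<and>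
        p t x y \<le> sub_gaussian dH dW c3 c4 t x y"
proof -
  from kernel_bounds show ?thesis
  proof (elim exE conjE)
    fix c3 c4 c5 c6 :: real
    assume c: "0 < c3" "0 < c4" "0 < c5" "0 < c6"
      and b: "\<forall>t>0. AE (x, y) in M \<Otimes>\<^sub>M M. sub_gaussian dH dW c5 c6 t x y \<le> p t x y \<and>
        p t x y \<le> sub_gaussian dH dW c3 c4 t x y"
    show ?thesis
    proof (rule that[OF c])
      fix t :: real assume "0 < t"
      from MM.AE_pair[OF b[rule_format, OF this]]
      show "AE x in M. AE y in M. sub_gaussian dH dW c5 c6 t x y \<le> p t x y \<and>
        p t x y \<le> sub_gaussian dH dW c3 c4 t x y" by simp
    qed
  qed
qed

lemma kernel_nonneg: "0 < t \<Longrightarrow> AE x in M. AE y in M. 0 \<le> p t x y"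
proof -
  assume t: "0 < t"
  obtain c3 c4 c5 c6 where c: "0 < c3" "0 < c4" "0 < c5" "0 < c6"
    and b: "\<And>t. 0 < t \<Longrightarrow> AE x in M. AE y in M. sub_gaussian dH dW c5 c6 t x y \<le> p t x y \<and>
        p t x y \<le> sub_gaussian dH dW c3 c4 t x y"
    by (rule kernel_bounds_AE) (rule that; assumption)
  have nn: "0 \<le> sub_gaussian dH dW c5 c6 t x y" for x y :: 'a
    using c by (simp add: sub_gaussian_def)
  from b[OF t] show ?thesis
  proof eventually_elim
    case (elim x)
    then show ?case
      by eventually_elim (use nn order_trans in blast)
  qed
qed

section \<open>Moments and total mass of the kernel\<close>

lemma scale_exponent:
  fixes d t :: real
  assumes "0 < t" "0 \<le> d"
  shows "(d powr dW / t) powr (1 / (dW - 1)) = (d / t powr (1 / dW)) powr (dW / (dW - 1))"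
proof -
  have "d powr dW / t = (d / t powr (1 / dW)) powr dW"
    using assms dW_gt_2 by (simp add: powr_divide powr_powr)
  then show ?thesis using dW_gt_2 by (simp add: powr_powr)
qed

text \<open>The exponent dW / (dW - 1) exceeds 1, so the decay is at least simply exponential, at
  the price of a factor exp c'.\<close>

lemma sub_gaussian_le:
  assumes "0 < t" "0 < c" "0 < c'"
  shows "sub_gaussian dH dW c c' t x y \<le>
    c * exp c' * t powr (- dH / dW) * exp (- c' * (dist x y / t powr (1 / dW)))"
proof -
  define z where "z = dist x y / t powr (1 / dW)"
  have z: "0 \<le> z" by (simp add: z_def)
  have "z \<le> 1 + z powr (dW / (dW - 1))"
  proof (cases "z \<le> 1")
    case False
    then have "z powr 1 \<le> z powr (dW / (dW - 1))"
      using dW_gt_2 by (intro powr_mono) (auto simp: field_simps)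
    then show ?thesis using False by simp
  qed (use powr_ge_zero[of z "dW / (dW - 1)"] in linarith)
  then have "c' * z \<le> c' * (1 + z powr (dW / (dW - 1)))"
    using assms by (intro mult_left_mono) auto
  then have "exp (- c' * z powr (dW / (dW - 1))) \<le> exp c' * exp (- c' * z)"
    unfolding mult_exp_exp by (simp add: algebra_simps)
  then have "c * t powr (- dH / dW) * exp (- c' * z powr (dW / (dW - 1))) \<le>
     c * t powr (- dH / dW) * (exp c' * exp (- c' * z))"
    using assms by (intro mult_left_mono) auto
  then show ?thesis
    unfolding sub_gaussian_def scale_exponent[OF assms(1) zero_le_dist] z_def[symmetric]
    by (simp add: mult_ac)
qed

text \<open>Decomposition into shells k <= d(x,y) / R < k + 1. Half of the exponential absorbs the
  volume growth (k + 1)^dH, the other half leaves a geometric series with ratio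
  \<open>q\<close>.\<close>

lemma integral_exp_dist:
  assumes a: "0 < a"
  shows "\<exists>C>0. \<forall>x. \<forall>R>0. (\<integral>\<^sup>+y. ennreal (exp (- a * (dist x y / R))) \<partial>M) \<le> ennreal (C * R powr dH)"
proof -
  obtain c2 where c2: "0 < c2" and ub: "\<And>x r. 0 \<le> r \<Longrightarrow> measure M (ball x r) \<le> c2 * r powr dH"
    using ball_measure_upper by blast
  obtain C0 where C0: "C0 > 0" and pe: "\<And>z. z \<ge> 0 \<Longrightarrow> z powr dH \<le> C0 * exp (a / 2 * z)"
    using powr_le_exp[of dH "a / 2"] dH_pos a by (metis half_gt_zero less_imp_le)
  define q where "q = exp (- a / 2)"
  have q: "0 < q" "q < 1" using a by (auto simp: q_def)
  define K where "K = c2 * C0 * exp (a / 2)"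
  have K: "0 < K" using c2 C0 by (simp add: K_def)
  have "(\<integral>\<^sup>+y. ennreal (exp (- a * (dist x y / R))) \<partial>M) \<le> ennreal (K * (1 / (1 - q)) * R powr dH)"
    if R: "0 < R" for x R
  proof -
    let ?B = "\<lambda>k. ball x (real (Suc k) * R)"
    have pt: "ennreal (exp (- a * (dist x y / R))) \<le> (\<Sum>k. ennreal (exp (- a * real k)) * indicator (?B k) y)" for y
    proof -
      define k where "k = nat \<lfloor>dist x y / R\<rfloor>"
      have "real k = of_int \<lfloor>dist x y / R\<rfloor>"
        using R by (simp add: k_def)
      then have k: "real k \<le> dist x y / R" "dist x y / R < real (Suc k)"
        unfolding of_nat_Suc by linarith+
      have "y \<in> ?B k" using k(2) R by (simp add: field_simps)
      have "a * real k \<le> a * (dist x y / R)" using a k(1) by (intro mult_left_mono) auto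
      then have "ennreal (exp (- a * (dist x y / R))) \<le> ennreal (exp (- a * real k)) * indicator (?B k) y"
        using \<open>y \<in> ?B k\<close> by (simp add: ennreal_le_iff)
      moreover define f where "f i = ennreal (exp (- a * real i)) * indicator (?B i) y" for i
      moreover have "f k \<le> suminf f"
        using sum_le_suminf[of f "{k}"] by simp
      ultimately show ?thesis by (simp add: f_def[abs_def])
    qed
    have term_le: "ennreal (exp (- a * real k)) * emeasure M (?B k) \<le> ennreal (K * R powr dH * q ^ k)" for k
    proof -
      have "emeasure M (?B k) = ennreal (measure M (?B k))"
        using finite_ball by (simp add: emeasure_eq_ennreal_measure less_top)
      then have "ennreal (exp (- a * real k)) * emeasure M (?B k) = ennreal (exp (- a * real k) * measure M (?B k))"
        by (simp add: ennreal_mult)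
      also have "exp (- a * real k) * measure M (?B k) \<le>
          exp (- a * real k) * (c2 * ((C0 * exp (a / 2 * real (Suc k))) * R powr dH))"
      proof -
        have "measure M (?B k) \<le> c2 * (real (Suc k) * R) powr dH"
          using R by (intro ub) simp
        also have "\<dots> = c2 * (real (Suc k) powr dH * R powr dH)"
          using R by (simp add: powr_mult)
        also have "\<dots> \<le> c2 * ((C0 * exp (a / 2 * real (Suc k))) * R powr dH)"
          using c2 pe[of "real (Suc k)"] by (intro mult_left_mono mult_right_mono) auto
        finally show ?thesis by (intro mult_left_mono) auto
      qed
      also have "\<dots> = K * R powr dH * (exp (- a * real k) * exp (a / 2 * real k))"
      proof -
        have "a / 2 * real (Suc k) = a / 2 + a / 2 * real k" by (simp add: distrib_left)
        then have "exp (a / 2 * real (Suc k)) = exp (a / 2) * exp (a / 2 * real k)"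
          by (simp only: exp_add)
        then show ?thesis by (simp only: K_def mult_ac)
      qed
      also have "exp (- a * real k) * exp (a / 2 * real k) = q ^ k"
        unfolding mult_exp_exp q_def exp_of_nat_mult[symmetric] by (simp add: field_simps)
      finally show ?thesis by (simp add: ennreal_leI)
    qed
    have "(\<integral>\<^sup>+y. ennreal (exp (- a * (dist x y / R))) \<partial>M) \<le>
      (\<integral>\<^sup>+y. (\<Sum>k. ennreal (exp (- a * real k)) * indicator (?B k) y) \<partial>M)"
      by (intro nn_integral_mono pt)
    also have "\<dots> = (\<Sum>k. ennreal (exp (- a * real k)) * emeasure M (?B k))"
    proof (subst nn_integral_suminf)
      show "(\<lambda>y. ennreal (exp (- a * real k)) * indicator (?B k) y) \<in> borel_measurable M" for k
        by (intro borel_measurable_times_ennreal borel_measurable_indicator) auto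
      show "(\<Sum>k. \<integral>\<^sup>+y. ennreal (exp (- a * real k)) * indicator (?B k) y \<partial>M) =
          (\<Sum>k. ennreal (exp (- a * real k)) * emeasure M (?B k))"
        by (intro suminf_cong nn_integral_cmult_indicator) auto
    qed
    also have "\<dots> \<le> (\<Sum>k. ennreal (K * R powr dH * q ^ k))"
      by (intro suminf_le term_le) auto
    also have "\<dots> = ennreal (\<Sum>k. K * R powr dH * q ^ k)"
      using q K by (intro suminf_ennreal2) (auto intro!: summable_mult summable_geometric)
    also have "(\<Sum>k. K * R powr dH * q ^ k) = K * (1 / (1 - q)) * R powr dH"
      using q by (subst suminf_mult) (auto simp: suminf_geometric intro!: summable_geometric)
    finally show ?thesis .
  qed
  moreover have "0 < K * (1 / (1 - q))" using K q by simp
  ultimately show ?thesis by blast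
qed

text \<open>With z = d(x,y) / t^(1/dW), one half of exp (- c4 z) absorbs z^k and the other is
  integrated; the prefactor t^(- dH / dW) cancels the volume that the integral produces.\<close>

lemma kernel_moment:
  assumes k: "0 \<le> k"
  shows "\<exists>C>0. \<forall>t>0. AE x in M. integrable M (\<lambda>y. p t x y * dist x y powr k) \<and>
           (\<integral>y. p t x y * dist x y powr k \<partial>M) \<le> C * t powr (k / dW)"
proof -
  obtain c3 c4 c5 c6 where c: "0 < c3" "0 < c4" "0 < c5" "0 < c6"
    and b: "\<And>t. 0 < t \<Longrightarrow> AE x in M. AE y in M. sub_gaussian dH dW c5 c6 t x y \<le> p t x y \<and>
        p t x y \<le> sub_gaussian dH dW c3 c4 t x y"
    by (rule kernel_bounds_AE) (rule that; assumption)
  obtain C1 where C1: "C1 > 0" and C1_bound: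
    "\<And>x R. R > 0 \<Longrightarrow> (\<integral>\<^sup>+y. ennreal (exp (- (c4 / 2) * (dist x y / R))) \<partial>M) \<le> ennreal (C1 * R powr dH)"
    using integral_exp_dist[of "c4 / 2"] c by (metis half_gt_zero)
  obtain C0 where C0: "C0 > 0" and pe: "\<And>z. z \<ge> 0 \<Longrightarrow> z powr k \<le> C0 * exp (c4 / 2 * z)"
    using powr_le_exp[of k "c4 / 2"] k c by (metis half_gt_zero)
  define K where "K = c3 * exp c4 * C0"
  have K: "0 < K" using c C0 by (simp add: K_def)
  have "AE x in M. integrable M (\<lambda>y. p t x y * dist x y powr k) \<and>
           (\<integral>y. p t x y * dist x y powr k \<partial>M) \<le> K * C1 * t powr (k / dW)" if t: "0 < t" for t
    using b[OF t] kernel_nonneg[OF t]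
  proof eventually_elim
    case (elim x)
    define R where "R = t powr (1 / dW)"
    have R: "0 < R" using t by (simp add: R_def)
    have Rk: "R powr k = t powr (k / dW)" and RdH: "t powr (- dH / dW) * R powr dH = 1"
      using t by (simp_all add: R_def powr_powr powr_minus field_simps powr_divide)
    have pt: "AE y in M. 0 \<le> p t x y * dist x y powr k \<and>
      p t x y * dist x y powr k \<le> K * t powr (- dH / dW) * R powr k * exp (- (c4 / 2) * (dist x y / R))"
      using elim
    proof eventually_elim
      case (elim y)
      let ?z = "dist x y / R"
      have "dist x y powr k = R powr k * ?z powr k"
        using R by (simp add: powr_divide)
      also have "\<dots> \<le> R powr k * (C0 * exp (c4 / 2 * ?z))"
        using R by (intro mult_left_mono pe) auto
      finally have "p t x y * dist x y powr k \<le> (c3 * exp c4 * t powr (- dH / dW) * exp (- c4 * ?z)) *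
         (R powr k * (C0 * exp (c4 / 2 * ?z)))"
        using elim sub_gaussian_le[OF t c(1,2), of x y] c
        by (intro mult_mono) (auto simp: R_def)
      also have "\<dots> = K * t powr (- dH / dW) * R powr k * (exp (- c4 * ?z) * exp (c4 / 2 * ?z))"
        by (simp add: K_def mult_ac)
      also have "exp (- c4 * ?z) * exp (c4 / 2 * ?z) = exp (- (c4 / 2) * ?z)"
        unfolding mult_exp_exp by (simp add: field_simps)
      finally show ?case using elim by simp
    qed
    have "(\<integral>\<^sup>+y. ennreal (p t x y * dist x y powr k) \<partial>M) \<le>
       (\<integral>\<^sup>+y. ennreal (K * t powr (- dH / dW) * R powr k) * ennreal (exp (- (c4 / 2) * (dist x y / R))) \<partial>M)"
      using pt K by (intro nn_integral_mono_AE) (auto simp: ennreal_mult[symmetric] intro!: ennreal_leI elim!: eventually_mono)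
    also have "\<dots> = ennreal (K * t powr (- dH / dW) * R powr k) * (\<integral>\<^sup>+y. ennreal (exp (- (c4 / 2) * (dist x y / R))) \<partial>M)"
      by (intro nn_integral_cmult) measurable
    also have "\<dots> \<le> ennreal (K * t powr (- dH / dW) * R powr k) * ennreal (C1 * R powr dH)"
      by (intro mult_left_mono C1_bound R) auto
    also have "\<dots> = ennreal ((K * t powr (- dH / dW) * R powr k) * (C1 * R powr dH))"
      using K C1 by (simp add: ennreal_mult)
    also have "(K * t powr (- dH / dW) * R powr k) * (C1 * R powr dH) = K * C1 * R powr k * (t powr (- dH / dW) * R powr dH)"
      by (simp add: mult_ac)
    also have "\<dots> = K * C1 * t powr (k / dW)" using RdH Rk by simp
    finally have nn: "(\<integral>\<^sup>+y. ennreal (p t x y * dist x y powr k) \<partial>M) \<le> ennreal (K * C1 * t powr (k / dW))" .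
    have int: "integrable M (\<lambda>y. p t x y * dist x y powr k)"
    proof (rule integrableI_nonneg)
      show "(\<lambda>y. p t x y * dist x y powr k) \<in> borel_measurable M"
        using t by measurable
      show "AE y in M. 0 \<le> p t x y * dist x y powr k" using pt by eventually_elim simp
      show "(\<integral>\<^sup>+y. ennreal (p t x y * dist x y powr k) \<partial>M) < \<infinity>"
        using nn by (rule order_le_less_trans) simp
    qed
    moreover have "ennreal (\<integral>y. p t x y * dist x y powr k \<partial>M) \<le> ennreal (K * C1 * t powr (k / dW))"
      using nn nn_integral_eq_integral[OF int] pt by (auto elim!: eventually_mono)
    ultimately show ?case using K C1 by (simp add: ennreal_le_iff)
  qed
  with K C1 show ?thesis by (intro exI[of _ "K * C1"]) auto
qed

text \<open>Points are null because small balls have measure of order r^dH.\<close>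

lemma AE_neq: "AE y in M. y \<noteq> (x::'a)"
proof -
  obtain c2 where c2: "0 < c2" and ub: "\<And>x r. 0 \<le> r \<Longrightarrow> measure M (ball x r) \<le> c2 * r powr dH"
    using ball_measure_upper by blast
  have "measure M {x} \<le> c2 * r powr dH" if "0 < r" for r
    using that by (intro order_trans[OF measure_mono_fmeasurable[of _ "ball x r"] ub])
      (auto simp: fmeasurable_def finite_ball[simplified])
  moreover have "((\<lambda>r. c2 * r powr dH) \<longlongrightarrow> c2 * 0 powr dH) (at_right 0)"
    using dH_pos by (intro tendsto_intros tendsto_powr2) (auto simp: eventually_at_filter)
  ultimately have "measure M {x} \<le> c2 * 0 powr dH"
    by (intro tendsto_lowerbound) (auto simp: eventually_at_filter)
  moreover have "emeasure M {x} < \<infinity>"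
    using emeasure_mono[of "{x}" "ball x 1" M] finite_ball[of x 1] by (auto intro: order_le_less_trans)
  ultimately have "emeasure M {x} = 0"
    using dH_pos measure_nonneg[of M "{x}"] by (simp add: emeasure_eq_ennreal_measure less_top)
  then show ?thesis
    by (intro AE_I[of _ _ "{x}"]) auto
qed

lemma kernel_integrable_bound:
  "\<exists>C>0. \<forall>t>0. AE x in M. integrable M (p t x) \<and> (\<integral>y. p t x y \<partial>M) \<le> C"
proof -
  obtain C where C: "0 < C" and b: "\<And>t. 0 < t \<Longrightarrow> AE x in M. integrable M (\<lambda>y. p t x y * dist x y powr 0) \<and>
           (\<integral>y. p t x y * dist x y powr 0 \<partial>M) \<le> C * t powr (0 / dW)"
    using kernel_moment[of 0] by auto
  have "AE x in M. integrable M (p t x) \<and> (\<integral>y. p t x y \<partial>M) \<le> C" if t: "0 < t" for t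
    using b[OF t]
  proof eventually_elim
    case (elim x)
    \<comment> \<open>\<open>0 powr 0\<close> is 0, so the moment of order 0 loses the diagonal,
      which is a null set.\<close>
    have "AE y in M. p t x y * dist x y powr 0 = p t x y"
      using AE_neq[of x] by eventually_elim auto
    then have "integrable M (\<lambda>y. p t x y * dist x y powr 0) = integrable M (p t x)"
      "(\<integral>y. p t x y * dist x y powr 0 \<partial>M) = (\<integral>y. p t x y \<partial>M)"
      using t by (intro integrable_cong_AE integral_cong_AE; simp)+
    with elim t show ?case by simp
  qed
  with C show ?thesis by blast
qed

lemma kernel_integrable: "0 < t \<Longrightarrow> AE x in M. integrable M (p t x)"
  using kernel_integrable_bound by (auto elim!: eventually_mono)

text \<open>On the ball of radius t^(1/dW) the lower kernel bound is of order t^(- dH / dW), the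
  inverse of the volume. This keeps P_t 1 away from 0 uniformly in t.\<close>

lemma kernel_mass_lower:
  "\<exists>c>0. \<forall>t>0. AE x in M. c \<le> (\<integral>y. p t x y \<partial>M)"
proof -
  obtain c3 c4 c5 c6 where c: "0 < c3" "0 < c4" "0 < c5" "0 < c6"
    and b: "\<And>t. 0 < t \<Longrightarrow> AE x in M. AE y in M. sub_gaussian dH dW c5 c6 t x y \<le> p t x y \<and>
        p t x y \<le> sub_gaussian dH dW c3 c4 t x y"
    by (rule kernel_bounds_AE) (rule that; assumption)
  obtain c1 where c1: "0 < c1" and lb: "\<And>x r. 0 \<le> r \<Longrightarrow> c1 * r powr dH \<le> measure M (ball x r)"
    using ball_measure_lower by blast
  have "AE x in M. c5 * exp (- c6) * c1 \<le> (\<integral>y. p t x y \<partial>M)" if t: "0 < t" for t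
    using b[OF t] kernel_nonneg[OF t] kernel_integrable[OF t]
  proof eventually_elim
    case (elim x)
    define R where "R = t powr (1 / dW)"
    have R: "0 < R" using t by (simp add: R_def)
    have RdH: "t powr (- dH / dW) * R powr dH = 1"
      using t by (simp add: R_def powr_powr powr_minus field_simps powr_divide)
    let ?k = "c5 * t powr (- dH / dW) * exp (- c6)"
    have pt: "AE y in M. ?k * indicator (ball x R) y \<le> p t x y"
      using elim(1,2)
    proof eventually_elim
      case (elim y)
      show ?case
      proof (cases "y \<in> ball x R")
        case True
        then have "(dist x y / R) powr (dW / (dW - 1)) \<le> 1 powr (dW / (dW - 1))"
          using R dW_gt_2 by (intro powr_mono2) auto
        then have "?k \<le> sub_gaussian dH dW c5 c6 t x y"
          using c unfolding sub_gaussian_def scale_exponent[OF t zero_le_dist] R_def[symmetric]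
          by (intro mult_left_mono) auto
        with elim True show ?thesis by simp
      qed (use elim in simp)
    qed
    have "c5 * exp (- c6) * c1 = ?k * (c1 * R powr dH)"
      using RdH by (simp add: mult_ac)
    also have "\<dots> \<le> ?k * measure M (ball x R)"
      using c R by (intro mult_left_mono lb) auto
    also have "\<dots> = (\<integral>y. ?k * indicator (ball x R) y \<partial>M)" by simp
    also have "\<dots> \<le> (\<integral>y. p t x y \<partial>M)"
      using pt elim(3) finite_ball[of x R] by (intro integral_mono_AE) auto
    finally show ?case .
  qed
  moreover have "0 < c5 * exp (- c6) * c1" using c c1 by simp
  ultimately show ?thesis by blast
qed

section \<open>Action of the semigroup on the constant 1\<close>

lemma L2_indicator_ball: "(indicator (ball z r) :: 'a \<Rightarrow> real) \<in> L2 M"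
proof -
  have "(indicator (ball z r) x :: real)\<^sup>2 = indicator (ball z r) x" for x
    by (simp add: indicator_def)
  then show ?thesis
    using finite_ball[of z r] by (simp add: L2_def borel_measurable_indicator)
qed

lemma bounded_Linf:
  assumes "g \<in> borel_measurable M" "\<And>x. \<bar>g x\<bar> \<le> b"
  shows "g \<in> Linf M"
proof -
  have "esssup M (\<lambda>x. ereal \<bar>g x\<bar>) \<le> ereal b"
    using assms by (intro esssup_I) auto
  then show ?thesis
    using assms(1) by (auto simp: Linf_def intro: order_le_less_trans)
qed

lemma heat_op_measurable:
  assumes "0 < t" "g \<in> borel_measurable M"
  shows "P t g \<in> borel_measurable M"
proof -
  have "(\<lambda>x. \<integral>y. (\<lambda>(x, y). p t x y) (x, y) * g y \<partial>M) \<in> borel_measurable M"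
    using kernel_measurable[OF assms(1)] assms(2) by measurable
  then show ?thesis by (simp add: heat_op_def[abs_def])
qed

lemma heat_op_indicator_tendsto:
  assumes "integrable M (p t x)"
  shows "(\<lambda>n. P t (indicator (ball z (real n))) x) \<longlonglongrightarrow> P t (\<lambda>_. 1) x"
  unfolding heat_op_def
proof (rule integral_dominated_convergence[where w = "\<lambda>y. \<bar>p t x y\<bar>"])
  show "AE y in M. (\<lambda>n. p t x y * indicator (ball z (real n)) y) \<longlonglongrightarrow> p t x y * 1"
  proof (rule AE_I2, rule tendsto_mult_left)
    fix y
    obtain N where "dist z y < real N" using reals_Archimedean2 by blast
    then have "\<forall>\<^sub>F n in sequentially. indicator (ball z (real n)) y = (1::real)"
      by (intro eventually_sequentiallyI[of N]) (auto simp: indicator_def)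
    then show "(\<lambda>n. indicator (ball z (real n)) y) \<longlonglongrightarrow> (1::real)"
      by (rule tendsto_eventually)
  qed
qed (use assms in \<open>auto simp: indicator_def borel_measurable_integrable\<close>)

text \<open>Provides the dominating constant for exchanging a second application of the kernel, or
  an integral, with the exhaustion by balls.\<close>

lemma heat_op_indicator_bounded:
  "\<exists>C>0. \<forall>t>0. \<forall>z. AE y in M. \<forall>n. \<bar>P t (indicator (ball z (real n))) y\<bar> \<le> C \<and>
      (\<lambda>n. P t (indicator (ball z (real n))) y) \<longlonglongrightarrow> P t (\<lambda>_. 1) y"
proof -
  obtain C where C: "0 < C" and b: "\<And>t. 0 < t \<Longrightarrow> AE x in M. integrable M (p t x) \<and> (\<integral>y. p t x y \<partial>M) \<le> C"
    using kernel_integrable_bound by blast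
  have "AE y in M. \<forall>n. \<bar>P t (indicator (ball z (real n))) y\<bar> \<le> C \<and>
      (\<lambda>n. P t (indicator (ball z (real n))) y) \<longlonglongrightarrow> P t (\<lambda>_. 1) y"
    if t: "0 < t" for t z
    using b[OF t] kernel_nonneg[OF t]
  proof eventually_elim
    case (elim y)
    have "0 \<le> P t (indicator (ball z (real n))) y" for n
      unfolding heat_op_def using elim by (intro integral_nonneg_AE) (auto elim: eventually_mono)
    moreover have "P t (indicator (ball z (real n))) y \<le> (\<integral>x. p t y x \<partial>M)" for n
      unfolding heat_op_def
    proof (rule integral_mono_AE)
      show "integrable M (\<lambda>ya. p t y ya * indicator (ball z (real n)) ya)"
        using elim by (auto intro!: integrable_mult_indicator[where 'b = real, simplified, unfolded mult.commute[of "indicator _ _"]])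
      show "AE x in M. p t y x * indicator (ball z (real n)) x \<le> p t y x"
        using elim(2) by eventually_elim (auto simp: indicator_def)
    qed (use elim in simp)
    ultimately show ?case
      using elim heat_op_indicator_tendsto[of t y z] by (auto intro: order_trans)
  qed
  with C show ?thesis by blast
qed

text \<open>The constant 1 is not in L2, as balls grow without bound in measure. The semigroup law
  is therefore applied to indicators of balls and passed to the limit by dominated
  convergence.\<close>

lemma heat_op_one_semigroup:
  assumes s: "0 < s" and t: "0 < t"
  shows "AE x in M. P (s + t) (\<lambda>_. 1) x = P s (P t (\<lambda>_. 1)) x"
proof -
  obtain C where C: "0 < C" and b: "\<And>t z. 0 < t \<Longrightarrow> AE y in M. \<forall>n.
      \<bar>P t (indicator (ball z (real n))) y\<bar> \<le> C \<and>
      (\<lambda>n. P t (indicator (ball z (real n))) y) \<longlonglongrightarrow> P t (\<lambda>_. 1) y"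
    using heat_op_indicator_bounded by blast
  define z :: 'a where "z = undefined"
  define g :: "nat \<Rightarrow> 'a \<Rightarrow> real" where "g n = indicator (ball z (real n))" for n
  have gL: "g n \<in> L2 M" for n by (simp add: g_def L2_indicator_ball)
  have bt: "AE y in M. \<forall>n. \<bar>P t (g n) y\<bar> \<le> C \<and>
      (\<lambda>n. P t (g n) y) \<longlonglongrightarrow> P t (\<lambda>_. 1) y"
    unfolding g_def by (rule b[OF t])
  have "AE x in M. \<forall>n. P (s + t) (g n) x = P s (P t (g n)) x"
    using P_semigroup[OF s t gL] by (simp add: AE_all_countable)
  moreover have "AE x in M. integrable M (p (s + t) x)" "AE x in M. integrable M (p s x)"
    using s t by (auto intro: kernel_integrable)
  ultimately show ?thesis
    using kernel_nonneg[OF s]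
  proof eventually_elim
    case (elim x)
    have lim1: "(\<lambda>n. P (s + t) (g n) x) \<longlonglongrightarrow> P (s + t) (\<lambda>_. 1) x"
      unfolding g_def using elim(2) by (rule heat_op_indicator_tendsto)
    have "(\<lambda>n. P s (P t (g n)) x) \<longlonglongrightarrow> P s (P t (\<lambda>_. 1)) x"
      unfolding heat_op_def[of M p s]
    proof (rule integral_dominated_convergence[where w = "\<lambda>y. p s x y * C"])
      show "integrable M (\<lambda>y. p s x y * C)" using elim by simp
      show "AE y in M. (\<lambda>n. p s x y * P t (g n) y) \<longlonglongrightarrow> p s x y * P t (\<lambda>_. 1) y"
        using bt by eventually_elim (auto intro: tendsto_mult_left)
      show "AE y in M. norm (p s x y * P t (g n) y) \<le> p s x y * C" for n
        using bt elim(4) by eventually_elim (auto simp: abs_mult intro!: mult_left_mono)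
    qed (use s t gL in \<open>auto intro!: borel_measurable_times kernel_measurable2 heat_op_measurable simp: g_def\<close>)
    then show ?case
      by (rule LIMSEQ_unique[OF lim1[unfolded elim(1)[rule_format]]])
  qed
qed

end

section \<open>Conservativeness of the semigroup\<close>

locale wBE_space = sub_gaussian_dirichlet_space M F E p dH dW
  for M :: "'a::{metric_space, second_countable_topology} measure"
    and F :: "('a \<Rightarrow> real) set"
    and E :: "('a \<Rightarrow> real) \<Rightarrow> ('a \<Rightarrow> real) \<Rightarrow> real"
    and p :: "real \<Rightarrow> 'a \<Rightarrow> 'a \<Rightarrow> real"
    and dH dW :: real +
  fixes \<kappa> :: real
  assumes wBE: "wBE M p dW \<kappa>"
begin

lemma kappa: "0 < \<kappa>" "\<kappa> < dW"
  using wBE by (auto simp: wBE_def)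

text \<open>\<open>h\<^sub>t = P\<^sub>t 1\<close> satisfies \<open>h\<^sub>s\<^sub>+\<^sub>t = P\<^sub>s h\<^sub>t\<close> and, by the weak Bakry--Emery estimate, flattens as
  \<open>t \<longrightarrow> \<infinity>\<close>; so \<open>h\<^sub>s\<^sub>+\<^sub>t \<approx> h\<^sub>s h\<^sub>t\<close> for large \<open>t\<close>.\<close>

lemma heat_op_one_almost_multiplicative:
  "\<exists>C>0. \<forall>s>0. \<forall>t>0. AE x in M.
     \<bar>P (s + t) (\<lambda>_. 1) x - P t (\<lambda>_. 1) x * P s (\<lambda>_. 1) x\<bar>
       \<le> C * (s / t) powr (\<kappa> / dW)"
proof -
  let ?h = "\<lambda>t. P t (\<lambda>_. 1)"
  obtain Cw where Cw: "0 < Cw" and w: "\<And>t g x y. 0 < t \<Longrightarrow> g \<in> Linf M \<Longrightarrow>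
      \<bar>P t g x - P t g y\<bar> \<le> Cw * (dist x y powr \<kappa> / t powr (\<kappa> / dW)) * Linf_norm M g"
    using wBE by (auto simp: wBE_def)
  obtain C1 where C1: "0 < C1" and mom: "\<And>t. 0 < t \<Longrightarrow> AE x in M. integrable M (\<lambda>y. p t x y * dist x y powr \<kappa>) \<and>
           (\<integral>y. p t x y * dist x y powr \<kappa> \<partial>M) \<le> C1 * t powr (\<kappa> / dW)"
    using kernel_moment[of \<kappa>] kappa by auto
  obtain C2 where C2: "0 < C2" and b: "\<And>t. 0 < t \<Longrightarrow> AE x in M. integrable M (p t x) \<and> (\<integral>y. p t x y \<partial>M) \<le> C2"
    using kernel_integrable_bound by blast
  \<comment> \<open>The norm of 1 need not be computed: N + 1 bounds it and is positive.\<close>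
  define N where "N = \<bar>Linf_norm M (\<lambda>_::'a. 1)\<bar>"
  define K where "K = Cw * (N + 1)"
  have K: "0 < K" using Cw by (simp add: K_def N_def)
  have "(\<lambda>_. 1) \<in> Linf M"
    by (rule bounded_Linf[of _ 1]) auto
  note w1 = w[OF _ this]
  have h_diff: "\<bar>?h t x - ?h t y\<bar> \<le> K * (dist x y powr \<kappa> / t powr (\<kappa> / dW))" if "0 < t" for t x y
  proof -
    have "\<bar>?h t x - ?h t y\<bar> \<le> Cw * (dist x y powr \<kappa> / t powr (\<kappa> / dW)) * Linf_norm M (\<lambda>_. 1)"
      using w1[OF that] .
    also have "\<dots> \<le> Cw * (dist x y powr \<kappa> / t powr (\<kappa> / dW)) * (N + 1)"
      using Cw by (intro mult_left_mono) (auto simp: N_def)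
    finally show ?thesis by (simp add: K_def mult_ac)
  qed
  have "AE x in M. \<bar>?h (s + t) x - ?h t x * ?h s x\<bar> \<le> K * C1 * (s / t) powr (\<kappa> / dW)"
    if s: "0 < s" and t: "0 < t" for s t
    using heat_op_one_semigroup[OF s t] kernel_integrable[OF s] mom[OF s] kernel_nonneg[OF s]
  proof eventually_elim
    case (elim x)
    let ?c = "K / t powr (\<kappa> / dW)"
    have dom: "integrable M (\<lambda>y. ?c * (p s x y * dist x y powr \<kappa>))"
      using elim by simp
    have le: "AE y in M. \<bar>p s x y * (?h t y - ?h t x)\<bar> \<le> ?c * (p s x y * dist x y powr \<kappa>)"
      using elim(4)
    proof eventually_elim
      case (elim y)
      have "p s x y * \<bar>?h t y - ?h t x\<bar> \<le> p s x y * (K * (dist y x powr \<kappa> / t powr (\<kappa> / dW)))"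
        using elim by (intro mult_left_mono h_diff t)
      then show ?case using elim by (simp add: abs_mult dist_commute mult_ac)
    qed
    have int: "integrable M (\<lambda>y. p s x y * (?h t y - ?h t x))"
    proof (rule Bochner_Integration.integrable_bound[OF dom])
      show "AE y in M. norm (p s x y * (?h t y - ?h t x)) \<le> norm (?c * (p s x y * dist x y powr \<kappa>))"
        using le by eventually_elim (use abs_ge_self order_trans in \<open>auto simp only: real_norm_def\<close>)
    qed (use s t in \<open>auto intro!: borel_measurable_times kernel_measurable2 borel_measurable_diff heat_op_measurable\<close>)
    \<comment> \<open>Writing h_t(y) as its value at x plus the difference isolates the product. The
      rest is bounded by t^(- \<kappa> / dW) times a moment of p_s of order \<kappa>, which scales
      like s^(\<kappa> / dW).\<close>
    have "?h (s + t) x = (\<integral>y. p s x y * (?h t y - ?h t x) + ?h t x * p s x y \<partial>M)"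
      unfolding elim(1) by (simp add: heat_op_def[of M p s] algebra_simps)
    also have "\<dots> = (\<integral>y. p s x y * (?h t y - ?h t x) \<partial>M) + ?h t x * ?h s x"
      using int elim(2) by (subst Bochner_Integration.integral_add) (auto simp: heat_op_def[of M p s])
    finally have "\<bar>?h (s + t) x - ?h t x * ?h s x\<bar> = \<bar>\<integral>y. p s x y * (?h t y - ?h t x) \<partial>M\<bar>"
      by simp
    also have "\<dots> \<le> (\<integral>y. ?c * (p s x y * dist x y powr \<kappa>) \<partial>M)"
      using le by (intro integral_abs_bound[THEN order_trans] integral_mono_AE int[THEN integrable_abs] dom)
    also have "\<dots> \<le> ?c * (C1 * s powr (\<kappa> / dW))"
      using elim K by (simp add: divide_right_mono mult_left_mono)
    also have "\<dots> = K * C1 * (s / t) powr (\<kappa> / dW)"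
      using s t by (simp add: powr_divide)
    finally show ?case .
  qed
  then show ?thesis using K C1 by (intro exI[of _ "K * C1"]) auto
qed

text \<open>If P_s 1 (x) = 1 + \<eta> with \<eta> nonzero, the sequence a n = P_{(n+1)s} 1 (x) is
  multiplied by nearly 1 + \<eta> at every step. As a n >= c, it eventually moves by at least c
  |\<eta>| / 2 in the direction of \<eta> each time, against its bounds c and C2.\<close>

theorem heat_op_one:
  assumes s: "0 < s"
  shows "AE x in M. P s (\<lambda>_. 1) x = 1"
proof -
  let ?h = "\<lambda>t. P t (\<lambda>_. 1)"
  obtain C where C: "0 < C" and mult: "\<And>s t. 0 < s \<Longrightarrow> 0 < t \<Longrightarrow>
     AE x in M. \<bar>?h (s + t) x - ?h t x * ?h s x\<bar> \<le> C * (s / t) powr (\<kappa> / dW)"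
    using heat_op_one_almost_multiplicative by blast
  obtain C2 where ub: "\<And>t. 0 < t \<Longrightarrow> AE x in M. integrable M (p t x) \<and> (\<integral>y. p t x y \<partial>M) \<le> C2"
    using kernel_integrable_bound by blast
  obtain c where c: "0 < c" and lb: "\<And>t. 0 < t \<Longrightarrow> AE x in M. c \<le> (\<integral>y. p t x y \<partial>M)"
    using kernel_mass_lower by blast
  \<comment> \<open>Consecutive times differ by s, and one null set serves for all of them.\<close>
  let ?t = "\<lambda>n. real (Suc n) * s"
  have pos: "0 < ?t n" for n using s by simp
  have "AE x in M. \<forall>n. \<bar>?h (s + ?t n) x - ?h (?t n) x * ?h s x\<bar> \<le> C * (s / ?t n) powr (\<kappa> / dW)"
    unfolding AE_all_countable using mult[OF s pos] by blast
  moreover have "AE x in M. \<forall>n. c \<le> ?h (?t n) x \<and> ?h (?t n) x \<le> C2"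
    unfolding AE_all_countable
  proof
    fix n
    show "AE x in M. c \<le> ?h (?t n) x \<and> ?h (?t n) x \<le> C2"
      using ub[OF pos[of n]] lb[OF pos[of n]] by eventually_elim (simp add: heat_op_def)
  qed
  ultimately show ?thesis
  proof eventually_elim
    case (elim x)
    define a where "a n = ?h (?t n) x" for n
    define \<epsilon> where "\<epsilon> n = C * (1 / real (Suc n)) powr (\<kappa> / dW)" for n
    have step: "\<bar>a (Suc n) - a n * ?h s x\<bar> \<le> \<epsilon> n" for n
    proof -
      have "?t (Suc n) = s + ?t n" by (simp add: algebra_simps)
      moreover have "s / ?t n = 1 / real (Suc n)" using s by simp
      ultimately show ?thesis using elim(1) unfolding a_def \<epsilon>_def by metis
    qed
    have bounds: "c \<le> a n" "a n \<le> C2" for n using elim(2) by (auto simp: a_def)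
    have "((\<lambda>n. C * (1 / real (Suc n)) powr (\<kappa> / dW)) \<longlonglongrightarrow> C * 0 powr (\<kappa> / dW))"
      using kappa dW_gt_2 LIMSEQ_inverse_real_of_nat
      by (intro tendsto_intros tendsto_powr2) (auto simp: inverse_eq_divide)
    then have \<epsilon>_lim: "\<epsilon> \<longlonglongrightarrow> 0" using kappa dW_gt_2 by (simp add: \<epsilon>_def[abs_def])
    show "?h s x = 1"
    proof (rule ccontr)
      assume "?h s x \<noteq> 1"
      define \<eta> where "\<eta> = ?h s x - 1"
      have \<eta>: "\<eta> \<noteq> 0" using \<open>?h s x \<noteq> 1\<close> by (simp add: \<eta>_def)
      have "\<forall>\<^sub>F n in sequentially. \<epsilon> n < c * \<bar>\<eta>\<bar> / 2"
        using \<epsilon>_lim \<eta> c by (intro order_tendstoD(2)[OF \<epsilon>_lim]) auto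
      then obtain N where N: "\<And>n. N \<le> n \<Longrightarrow> \<epsilon> n < c * \<bar>\<eta>\<bar> / 2"
        unfolding eventually_sequentially by blast
      have drift: "c * \<bar>\<eta>\<bar> / 2 \<le> sgn \<eta> * (a (Suc n) - a n)" if "N \<le> n" for n
      proof -
        have "c * \<bar>\<eta>\<bar> \<le> a n * \<bar>\<eta>\<bar>" using bounds by (intro mult_right_mono) auto
        also have "\<dots> = sgn \<eta> * (a n * ?h s x - a n)"
          by (simp add: \<eta>_def abs_sgn algebra_simps)
        finally have "c * \<bar>\<eta>\<bar> \<le> sgn \<eta> * (a n * ?h s x - a n)" .
        moreover have "\<bar>sgn \<eta> * (a (Suc n) - a n * ?h s x)\<bar> \<le> c * \<bar>\<eta>\<bar> / 2"
          using step[of n] N[OF that] \<eta> by (simp add: abs_mult abs_sgn_eq)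
        ultimately show ?thesis unfolding right_diff_distrib by linarith
      qed
      have growth: "real k * (c * \<bar>\<eta>\<bar> / 2) \<le> sgn \<eta> * (a (N + k) - a N)" for k
      proof (induction k)
        case (Suc k)
        then show ?case using drift[of "N + k"]
          unfolding of_nat_Suc distrib_right right_diff_distrib add_Suc_right by linarith
      qed simp
      obtain k where "C2 < real k * (c * \<bar>\<eta>\<bar> / 2)"
        using reals_Archimedean3[of "c * \<bar>\<eta>\<bar> / 2"] c \<eta> by auto
      then have "C2 < \<bar>sgn \<eta> * (a (N + k) - a N)\<bar>"
        using growth[of k] by linarith
      also have "\<dots> = \<bar>a (N + k) - a N\<bar>" using \<eta> by (simp add: abs_mult abs_sgn_eq)
      also have "\<dots> \<le> C2" using bounds[of "N + k"] bounds[of N] c by linarith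
      finally show False by simp
    qed
  qed
qed

section \<open>The carre du champ of the approximating forms\<close>

text \<open>Bounded at every point, not just a.e.: products stay in L2, and multiplying an
  integrable \<open>p t x\<close> by such a function keeps it integrable.\<close>

definition L2b :: "('a \<Rightarrow> real) set" where
  "L2b = {u \<in> L2 M. \<exists>b. \<forall>x. \<bar>u x\<bar> \<le> b}"

lemma L2b_L2: "u \<in> L2b \<Longrightarrow> u \<in> L2 M"
  by (simp add: L2b_def)

lemma L2b_bounded:
  assumes "u \<in> L2b"
  obtains b where "0 < b" "\<And>x. \<bar>u x\<bar> \<le> b"
proof -
  obtain b where "\<And>x. \<bar>u x\<bar> \<le> b" using assms by (auto simp: L2b_def)
  then have "0 < \<bar>b\<bar> + 1" "\<And>x. \<bar>u x\<bar> \<le> \<bar>b\<bar> + 1"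
    by (auto intro: order_trans[of _ b])
  then show ?thesis by (rule that)
qed

lemma L2b_measurable [measurable_dest]: "u \<in> L2b \<Longrightarrow> u \<in> borel_measurable M"
  by (intro L2_measurable L2b_L2)

lemma L2b_dominated:
  assumes u: "u \<in> borel_measurable M" and v: "v \<in> L2b" and le: "\<And>x. \<bar>u x\<bar> \<le> c * \<bar>v x\<bar>"
  shows "u \<in> L2b"
proof -
  obtain b where b: "0 < b" "\<And>x. \<bar>v x\<bar> \<le> b" by (rule L2b_bounded[OF v]) (rule that; assumption)
  have "integrable M (\<lambda>x. c\<^sup>2 * (v x)\<^sup>2)"
    using L2_integrable_square[OF L2b_L2[OF v]] by simp
  then have "integrable M (\<lambda>x. (u x)\<^sup>2)"
  proof (rule Bochner_Integration.integrable_bound)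
    show "AE x in M. norm ((u x)\<^sup>2) \<le> norm (c\<^sup>2 * (v x)\<^sup>2)"
    proof (rule AE_I2)
      fix x
      have "(u x)\<^sup>2 \<le> (c * \<bar>v x\<bar>)\<^sup>2"
        using power_mono[OF le[of x], of 2] by simp
      then show "norm ((u x)\<^sup>2) \<le> norm (c\<^sup>2 * (v x)\<^sup>2)"
        by (simp add: power_mult_distrib)
    qed
  qed (use u in measurable)
  moreover have "\<bar>u x\<bar> \<le> \<bar>c\<bar> * b" for x
  proof -
    have "\<bar>u x\<bar> \<le> c * \<bar>v x\<bar>" by (rule le)
    also have "\<dots> \<le> \<bar>c\<bar> * \<bar>v x\<bar>" by (intro mult_right_mono) auto
    also have "\<dots> \<le> \<bar>c\<bar> * b" by (intro mult_left_mono b) auto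
    finally show ?thesis .
  qed
  ultimately show ?thesis using u by (auto simp: L2b_def L2_def)
qed

lemma L2b_mult:
  assumes u: "u \<in> L2b" and v: "v \<in> L2b"
  shows "(\<lambda>x. u x * v x) \<in> L2b"
proof -
  obtain b where b: "0 < b" "\<And>x. \<bar>u x\<bar> \<le> b" by (rule L2b_bounded[OF u]) (rule that; assumption)
  show ?thesis
    by (rule L2b_dominated[OF _ v, of _ b])
       (use u v b in \<open>auto simp: abs_mult intro!: mult_right_mono borel_measurable_times L2b_measurable\<close>)
qed

lemma L2b_square: "u \<in> L2b \<Longrightarrow> (\<lambda>x. (u x)\<^sup>2) \<in> L2b"
  using L2b_mult[of u u] by (simp add: power2_eq_square)

lemma kernel_mult_integrable:
  assumes "integrable M (p t x)" "u \<in> borel_measurable M" "\<And>y. \<bar>u y\<bar> \<le> b"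
  shows "integrable M (\<lambda>y. p t x y * u y)"
proof (rule Bochner_Integration.integrable_bound)
  show "integrable M (\<lambda>y. b * p t x y)" using assms by simp
  show "AE y in M. norm (p t x y * u y) \<le> norm (b * p t x y)"
  proof (rule AE_I2)
    fix y
    have "\<bar>u y\<bar> \<le> \<bar>b\<bar>" using assms(3)[of y] by simp
    then show "norm (p t x y * u y) \<le> norm (b * p t x y)"
      using mult_left_mono[of "\<bar>u y\<bar>" "\<bar>b\<bar>" "\<bar>p t x y\<bar>"] by (simp add: abs_mult mult.commute)
  qed
qed (use assms in measurable)

text \<open>By symmetry P_t moves from w to the indicator of a ball, and along an exhaustion this
  becomes P_t 1 = 1. Dominated convergence gives the limit after the move, monotone convergence the
  one before it, and with it integrability.\<close>

lemma heat_op_integral: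
  assumes t: "0 < t" and w: "w \<in> L2b" and nonneg: "\<And>x. 0 \<le> w x" and int: "integrable M w"
  shows "integrable M (P t w)" and "(\<integral>x. P t w x \<partial>M) = (\<integral>x. w x \<partial>M)"
proof -
  define z :: 'a where "z = undefined"
  define g :: "nat \<Rightarrow> 'a \<Rightarrow> real" where "g n = indicator (ball z (real n))" for n
  have gL: "g n \<in> L2 M" for n by (simp add: g_def L2_indicator_ball)
  obtain C where C: "0 < C" and b: "AE y in M. \<forall>n.
      \<bar>P t (g n) y\<bar> \<le> C \<and> (\<lambda>n. P t (g n) y) \<longlonglongrightarrow> P t (\<lambda>_. 1) y"
    using heat_op_indicator_bounded t unfolding g_def by blast
  note wL = L2b_L2[OF w]
  have meas: "w \<in> borel_measurable M" using w by (rule L2b_measurable)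
  have g_meas: "P t (g n) \<in> borel_measurable M" for n
    using P_L2[OF t gL] by (rule L2_measurable)
  have "(\<lambda>n. \<integral>x. w x * P t (g n) x \<partial>M) \<longlonglongrightarrow> (\<integral>x. w x \<partial>M)"
  proof (rule integral_dominated_convergence[where w = "\<lambda>x. C * w x"])
    show "AE x in M. (\<lambda>n. w x * P t (g n) x) \<longlonglongrightarrow> w x"
      using b heat_op_one[OF t]
    proof eventually_elim
      case (elim x)
      have "(\<lambda>n. P t (g n) x) \<longlonglongrightarrow> 1" using elim by simp
      from tendsto_mult_left[OF this, of "w x"] show ?case by simp
    qed
    show "AE x in M. norm (w x * P t (g n) x) \<le> C * w x" for n
      using b by eventually_elim (use nonneg in \<open>auto simp: abs_mult mult.commute[of C] intro!: mult_left_mono\<close>)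
  qed (use int meas g_meas in auto)
  moreover have "(\<integral>x. w x * P t (g n) x \<partial>M) = (\<integral>x. P t w x * g n x \<partial>M)" for n
    using P_sym[OF t wL gL] by (simp add: inner_L2_def)
  ultimately have lim: "(\<lambda>n. \<integral>x. P t w x * g n x \<partial>M) \<longlonglongrightarrow> (\<integral>x. w x \<partial>M)"
    by simp
  have int_n: "integrable M (\<lambda>x. P t w x * g n x)" for n
    by (intro L2_integrable_mult P_L2 t wL gL)
  have mono: "AE x in M. mono (\<lambda>n. P t w x * g n x)"
    using kernel_nonneg[OF t]
  proof eventually_elim
    case (elim x)
    have "0 \<le> P t w x"
      unfolding heat_op_def using elim nonneg by (intro integral_nonneg_AE) (auto elim: eventually_mono)
    then show ?case
      by (auto simp: mono_def g_def indicator_def intro!: mult_left_mono)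
  qed
  have pw: "AE x in M. (\<lambda>n. P t w x * g n x) \<longlonglongrightarrow> P t w x"
  proof (rule AE_I2)
    fix x
    obtain N where "dist z x < real N" using reals_Archimedean2 by blast
    then have "\<forall>\<^sub>F n in sequentially. P t w x * g n x = P t w x"
      by (intro eventually_sequentiallyI[of N]) (auto simp: g_def indicator_def)
    then show "(\<lambda>n. P t w x * g n x) \<longlonglongrightarrow> P t w x"
      by (rule tendsto_eventually)
  qed
  have m: "P t w \<in> borel_measurable M" using P_L2[OF t wL] by (rule L2_measurable)
  show "integrable M (P t w)" "(\<integral>x. P t w x \<partial>M) = (\<integral>x. w x \<partial>M)"
    using integrable_monotone_convergence[OF int_n mono pw lim m] integral_monotone_convergence[OF int_n mono pw lim m]
    by auto
qed

text \<open>The expanded square of (1/2t) \<integral> p_t(x,y) (u(x) - u(y))^2 dM(y), with the mass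
  of p_t already replaced by 1. In this form it consists of values of P_t, whose symmetry can be
  applied when integrating.\<close>

definition energy_density :: "real \<Rightarrow> ('a \<Rightarrow> real) \<Rightarrow> 'a \<Rightarrow> real" where
  "energy_density t u x =
     ((u x)\<^sup>2 - 2 * u x * P t u x + P t (\<lambda>y. (u y)\<^sup>2) x) / (2 * t)"

lemma energy_density_eq:
  assumes t: "0 < t" and u: "u \<in> L2b"
  shows "AE x in M. integrable M (\<lambda>y. p t x y * (u x - u y)\<^sup>2) \<and>
    energy_density t u x = (\<integral>y. p t x y * (u x - u y)\<^sup>2 \<partial>M) / (2 * t)"
  using kernel_integrable[OF t] heat_op_one[OF t]
proof eventually_elim
  case (elim x)
  obtain b where b: "0 < b" "\<And>x. \<bar>u x\<bar> \<le> b" by (rule L2b_bounded[OF u]) (rule that; assumption)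
  have b2: "\<bar>(u y)\<^sup>2\<bar> \<le> b\<^sup>2" for y
    using power_mono[OF b(2)[of y], of 2] by simp
  have int1: "integrable M (\<lambda>y. p t x y * u y)"
    by (rule kernel_mult_integrable[OF elim(1) L2b_measurable[OF u] b(2)])
  have int2: "integrable M (\<lambda>y. p t x y * (u y)\<^sup>2)"
    by (rule kernel_mult_integrable[OF elim(1) L2b_measurable[OF L2b_square[OF u]] b2])
  have eq: "p t x y * (u x - u y)\<^sup>2 = (u x)\<^sup>2 * p t x y - 2 * u x * (p t x y * u y) + p t x y * (u y)\<^sup>2" for y
    by (simp add: power2_diff algebra_simps)
  have "(\<integral>y. p t x y * (u x - u y)\<^sup>2 \<partial>M) =
      (u x)\<^sup>2 * (\<integral>y. p t x y \<partial>M) - 2 * u x * P t u x + P t (\<lambda>y. (u y)\<^sup>2) x"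
    unfolding eq heat_op_def using int1 int2 elim(1)
    by (subst Bochner_Integration.integral_add | subst Bochner_Integration.integral_diff | simp)+
  moreover have "(\<integral>y. p t x y \<partial>M) = 1" using elim(2) by (simp add: heat_op_def)
  moreover have "integrable M (\<lambda>y. p t x y * (u x - u y)\<^sup>2)"
    unfolding eq using int1 int2 elim(1) by simp
  ultimately show ?case by (simp add: energy_density_def)
qed

lemma energy_density_nonneg:
  assumes t: "0 < t" and u: "u \<in> L2b"
  shows "AE x in M. 0 \<le> energy_density t u x"
  using energy_density_eq[OF t u] kernel_nonneg[OF t]
proof eventually_elim
  case (elim x)
  have "0 \<le> (\<integral>y. p t x y * (u x - u y)\<^sup>2 \<partial>M)"
    using elim(2) by (intro integral_nonneg_AE) (auto elim: eventually_mono)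
  then show ?case using elim(1) t by simp
qed

text \<open>Symmetry of P_t moves it onto u v and v. The right-hand side is the formula that defines
  the energy measure, with the approximating form in place of \<open>E\<close>.\<close>

lemma energy_density_integral_mult:
  assumes t: "0 < t" and u: "u \<in> L2b" and v: "v \<in> L2b"
  shows "integrable M (\<lambda>x. v x * energy_density t u x)"
    and "(\<integral>x. v x * energy_density t u x \<partial>M) =
      approx_form t (\<lambda>x. u x * v x) u - 1 / 2 * approx_form t v (\<lambda>x. (u x)\<^sup>2)"
proof -
  note L = L2b_L2[OF u] L2b_L2[OF v] L2b_L2[OF L2b_square[OF u]] L2b_L2[OF L2b_mult[OF u v]]
  note PL = P_L2[OF t L(1)] P_L2[OF t L(3)]
  have eq: "v x * energy_density t u x = 1 / (2 * t) * (v x * (u x)\<^sup>2) - 1 / t * ((u x * v x) * P t u x)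
      + 1 / (2 * t) * (v x * P t (\<lambda>y. (u y)\<^sup>2) x)" for x
    using t by (simp add: energy_density_def field_simps)
  have int: "integrable M (\<lambda>x. v x * (u x)\<^sup>2)" "integrable M (\<lambda>x. (u x * v x) * P t u x)"
    "integrable M (\<lambda>x. v x * P t (\<lambda>y. (u y)\<^sup>2) x)"
    by (intro L2_integrable_mult L PL)+
  show "integrable M (\<lambda>x. v x * energy_density t u x)"
    unfolding eq using int by simp
  have "(\<integral>x. v x * energy_density t u x \<partial>M) = 1 / (2 * t) * ip v (\<lambda>x. (u x)\<^sup>2)
      - 1 / t * ip (\<lambda>x. u x * v x) (P t u) + 1 / (2 * t) * ip v (P t (\<lambda>y. (u y)\<^sup>2))"
    unfolding eq inner_L2_def using int
    by (subst Bochner_Integration.integral_add | subst Bochner_Integration.integral_diff | simp)+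
  also have "ip (\<lambda>x. u x * v x) (P t u) = ip (P t (\<lambda>x. u x * v x)) u"
    by (rule P_sym[symmetric]; fact t L)
  also have "ip v (P t (\<lambda>y. (u y)\<^sup>2)) = ip (P t v) (\<lambda>y. (u y)\<^sup>2)"
    by (rule P_sym[symmetric]; fact t L)
  finally have "(\<integral>x. v x * energy_density t u x \<partial>M) = 1 / (2 * t) * ip v (\<lambda>x. (u x)\<^sup>2)
      - 1 / t * ip (P t (\<lambda>x. u x * v x)) u + 1 / (2 * t) * ip (P t v) (\<lambda>y. (u y)\<^sup>2)" .
  moreover have "ip (\<lambda>x. u x * v x) u = ip v (\<lambda>x. (u x)\<^sup>2)"
    by (simp add: inner_L2_def power2_eq_square mult_ac)
  ultimately show "(\<integral>x. v x * energy_density t u x \<partial>M) =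
      approx_form t (\<lambda>x. u x * v x) u - 1 / 2 * approx_form t v (\<lambda>x. (u x)\<^sup>2)"
    unfolding approx_form_eq[OF t L(4) L(1)] approx_form_eq[OF t L(2) L(3)]
    using t by (simp add: diff_divide_distrib add_divide_distrib)
qed

text \<open>Formally the weight v = 1 in the preceding identity. As 1 is not in L2, mass
  preservation of P_t takes the place of symmetry for the term with u^2.\<close>

lemma energy_density_integral:
  assumes t: "0 < t" and u: "u \<in> L2b"
  shows "integrable M (energy_density t u)" and "(\<integral>x. energy_density t u x \<partial>M) = approx_form t u u"
proof -
  note L = L2b_L2[OF u] L2b_L2[OF L2b_square[OF u]]
  note hi = heat_op_integral[OF t L2b_square[OF u] zero_le_power2 L2_integrable_square[OF L(1)]]
  have eq: "energy_density t u x = 1 / (2 * t) * (u x)\<^sup>2 - 1 / t * (u x * P t u x)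
      + 1 / (2 * t) * P t (\<lambda>y. (u y)\<^sup>2) x" for x
    using t by (simp add: energy_density_def field_simps)
  have int: "integrable M (\<lambda>x. (u x)\<^sup>2)" "integrable M (\<lambda>x. u x * P t u x)"
    by (intro L2_integrable_square L2_integrable_mult L P_L2[OF t])+
  show "integrable M (energy_density t u)"
    unfolding eq[abs_def] using int hi(1) by simp
  have "(\<integral>x. energy_density t u x \<partial>M) = 1 / (2 * t) * (\<integral>x. (u x)\<^sup>2 \<partial>M)
      - 1 / t * (\<integral>x. u x * P t u x \<partial>M) + 1 / (2 * t) * (\<integral>x. P t (\<lambda>y. (u y)\<^sup>2) x \<partial>M)"
    unfolding eq using int hi(1)
    by (subst Bochner_Integration.integral_add | subst Bochner_Integration.integral_diff | simp)+
  then show "(\<integral>x. energy_density t u x \<partial>M) = approx_form t u u"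
    unfolding hi(2) approx_form_eq[OF t L(1) L(1)] inner_L2_def using t
    by (simp add: field_simps power2_eq_square)
qed

section \<open>Operations that preserve the form domain\<close>

lemma energy_density_dominated:
  assumes t: "0 < t" and u: "u \<in> L2b" and f: "f \<in> L2b" and g: "g \<in> L2b"
    and le: "\<And>x y. (u x - u y)\<^sup>2 \<le> A * (f x - f y)\<^sup>2 + B * (g x - g y)\<^sup>2"
  shows "AE x in M. energy_density t u x \<le> A * energy_density t f x + B * energy_density t g x"
  using energy_density_eq[OF t u] energy_density_eq[OF t f] energy_density_eq[OF t g] kernel_nonneg[OF t]
proof eventually_elim
  case (elim x)
  have "(\<integral>y. p t x y * (u x - u y)\<^sup>2 \<partial>M) \<le>
    (\<integral>y. A * (p t x y * (f x - f y)\<^sup>2) + B * (p t x y * (g x - g y)\<^sup>2) \<partial>M)"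
  proof (rule integral_mono_AE)
    show "AE y in M. p t x y * (u x - u y)\<^sup>2 \<le> A * (p t x y * (f x - f y)\<^sup>2) + B * (p t x y * (g x - g y)\<^sup>2)"
      using elim(4)
    proof eventually_elim
      case (elim y)
      from mult_left_mono[OF le this, of x y] show ?case by (simp add: algebra_simps)
    qed
  qed (use elim in auto)
  also have "\<dots> = A * (\<integral>y. p t x y * (f x - f y)\<^sup>2 \<partial>M) + B * (\<integral>y. p t x y * (g x - g y)\<^sup>2 \<partial>M)"
    using elim by simp
  finally have "(\<integral>y. p t x y * (u x - u y)\<^sup>2 \<partial>M) / (2 * t) \<le>
      (A * (\<integral>y. p t x y * (f x - f y)\<^sup>2 \<partial>M) + B * (\<integral>y. p t x y * (g x - g y)\<^sup>2 \<partial>M)) / (2 * t)"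
    using t by (intro divide_right_mono) auto
  then show ?case
    using elim by (simp add: add_divide_distrib)
qed

text \<open>The Markov axiom only speaks of the clamp to [0,1]. The double-integral form of the
  approximations transfers every pointwise bound on squared increments, which covers products and
  clips at any level.\<close>

theorem form_domain_dominated:
  assumes u: "u \<in> L2b" and f: "f \<in> L2b" "f \<in> F" and g: "g \<in> L2b" "g \<in> F"
    and AB: "0 \<le> A" "0 \<le> B"
    and le: "\<And>x y. (u x - u y)\<^sup>2 \<le> A * (f x - f y)\<^sup>2 + B * (g x - g y)\<^sup>2"
  shows "u \<in> F"
proof (rule mem_form_domain(1)[OF L2b_L2[OF u]])
  show "\<forall>\<^sub>F t in at_right 0. approx_form t u u \<le> A * E f f + B * E g g"
    using eventually_at_right_less[of 0]
  proof eventually_elim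
    case (elim t)
    have "approx_form t u u \<le> (\<integral>x. A * energy_density t f x + B * energy_density t g x \<partial>M)"
      unfolding energy_density_integral(2)[OF elim u, symmetric]
      by (intro integral_mono_AE energy_density_dominated[OF elim u f(1) g(1) le] Bochner_Integration.integrable_add
          integrable_mult_right energy_density_integral(1)[OF elim] u f g)
    also have "\<dots> = A * approx_form t f f + B * approx_form t g g"
      using energy_density_integral[OF elim f(1)] energy_density_integral[OF elim g(1)] by simp
    also have "\<dots> \<le> A * E f f + B * E g g"
      by (intro add_mono mult_left_mono approx_form_le_form elim f g AB)
    finally show ?case .
  qed
qed

lemma form_domain_mult:
  assumes f: "f \<in> L2b" "f \<in> F" and g: "g \<in> L2b" "g \<in> F"
  shows "(\<lambda>x. f x * g x) \<in> F"
proof -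
  obtain a where a: "0 < a" "\<And>x. \<bar>f x\<bar> \<le> a" by (rule L2b_bounded[OF f(1)]) (rule that; assumption)
  obtain b where b: "0 < b" "\<And>x. \<bar>g x\<bar> \<le> b" by (rule L2b_bounded[OF g(1)]) (rule that; assumption)
  show ?thesis
  proof (rule form_domain_dominated[OF L2b_mult[OF f(1) g(1)] f g, of "2 * b\<^sup>2" "2 * a\<^sup>2"])
    fix x y
    have "(f x * g x - f y * g y)\<^sup>2 = ((f x - f y) * g x + f y * (g x - g y))\<^sup>2"
      by (simp add: algebra_simps)
    also have "\<dots> \<le> 2 * ((f x - f y) * g x)\<^sup>2 + 2 * (f y * (g x - g y))\<^sup>2"
      using zero_le_power2[of "(f x - f y) * g x - f y * (g x - g y)"]
      unfolding power2_sum power2_diff by simp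
    also have "\<dots> = 2 * (\<bar>g x\<bar>\<^sup>2 * (f x - f y)\<^sup>2) + 2 * (\<bar>f y\<bar>\<^sup>2 * (g x - g y)\<^sup>2)"
      by (simp add: power_mult_distrib mult.commute)
    also have "\<dots> \<le> 2 * (b\<^sup>2 * (f x - f y)\<^sup>2) + 2 * (a\<^sup>2 * (g x - g y)\<^sup>2)"
      by (intro add_mono mult_left_mono mult_right_mono power_mono a b) auto
    finally show "(f x * g x - f y * g y)\<^sup>2 \<le> 2 * b\<^sup>2 * (f x - f y)\<^sup>2 + 2 * a\<^sup>2 * (g x - g y)\<^sup>2" by simp
  qed auto
qed

lemma form_domain_square: "f \<in> L2b \<Longrightarrow> f \<in> F \<Longrightarrow> (\<lambda>x. (f x)\<^sup>2) \<in> F"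
  using form_domain_mult[of f f] by (simp add: power2_eq_square)

theorem energy_density_tendsto:
  assumes f: "f \<in> L2b" "f \<in> F" and \<phi>: "\<phi> \<in> L2b" "\<phi> \<in> F"
  shows "((\<lambda>t. \<integral>x. \<phi> x * energy_density t f x \<partial>M) \<longlongrightarrow>
    E (\<lambda>x. f x * \<phi> x) f - 1 / 2 * E \<phi> (\<lambda>x. (f x)\<^sup>2)) (at_right 0)"
proof (rule Lim_transform_eventually)
  show "((\<lambda>t. approx_form t (\<lambda>x. f x * \<phi> x) f - 1 / 2 * approx_form t \<phi> (\<lambda>x. (f x)\<^sup>2)) \<longlongrightarrow>
    E (\<lambda>x. f x * \<phi> x) f - 1 / 2 * E \<phi> (\<lambda>x. (f x)\<^sup>2)) (at_right 0)"
    by (intro tendsto_intros approx_form_tendsto form_domain_mult form_domain_square f \<phi>)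
  show "\<forall>\<^sub>F t in at_right 0. approx_form t (\<lambda>x. f x * \<phi> x) f - 1 / 2 * approx_form t \<phi> (\<lambda>x. (f x)\<^sup>2) =
      (\<integral>x. \<phi> x * energy_density t f x \<partial>M)"
    using eventually_at_right_less[of 0]
    by eventually_elim (simp add: energy_density_integral_mult(2)[OF _ f(1) \<phi>(1)])
qed

section \<open>Comparison with the oscillation at a single scale\<close>

text \<open>Far from the diagonal the Gaussian factor makes \<open>p\<^sub>t\<close> a small multiple of \<open>p\<^sub>C\<^sub>t\<close>. Dyadic \<open>C\<close> are
  enough, and for these the approximating forms are monotone.\<close>

lemma kernel_scale_split:
  "\<exists>A>0. \<exists>K>0. \<exists>m. \<forall>t>0. AE x in M. AE y in M.
     p t x y \<le> K * t powr (- dH / dW) * indicator (ball x (A * t powr (1 / dW))) y + p (2 ^ m * t) x y / (2 * 2 ^ m)"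
proof -
  obtain c3 c4 c5 c6 where c: "0 < c3" "0 < c4" "0 < c5" "0 < c6"
    and b: "\<And>t. 0 < t \<Longrightarrow> AE x in M. AE y in M. sub_gaussian dH dW c5 c6 t x y \<le> p t x y \<and>
        p t x y \<le> sub_gaussian dH dW c3 c4 t x y"
    by (rule kernel_bounds_AE) (rule that; assumption)
  define e where "e = 1 / (dW - 1)"
  have e: "0 < e" using dW_gt_2 by (simp add: e_def)
  \<comment> \<open>C = 2^m is so large that the lower bound at time C t decays at no more than half
    the rate of the upper bound at time t.\<close>
  obtain m :: nat where m: "(2 * c6 / c4) powr (1 / e) < 2 ^ m"
    using real_arch_pow[of 2] by auto
  define C :: real where "C = 2 ^ m"
  have C: "0 < C" by (simp add: C_def)
  have "((2 * c6 / c4) powr (1 / e)) powr e \<le> C powr e"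
    using m e by (intro powr_mono2) (auto simp: C_def)
  then have Ce: "c6 / C powr e \<le> c4 / 2"
    using c e C by (simp add: powr_powr field_simps)
  \<comment> \<open>The smallness that the prefactors require: c3 \<delta> = c5 C^(- dH / dW) / (2
    C).\<close>
  define \<delta> where "\<delta> = c5 * C powr (- dH / dW) / (2 * C * c3)"
  have \<delta>: "0 < \<delta>" using c C by (simp add: \<delta>_def)
  \<comment> \<open>Outside radius A t^(1/dW) the variable s is at least A, whence exp (- (c4/2) s)
    <= \<delta>; A >= 1 gives A <= A^(dW / (dW - 1)).\<close>
  define A where "A = max 1 (2 * - ln \<delta> / c4)"
  have A: "1 \<le> A" "2 * - ln \<delta> / c4 \<le> A" by (auto simp: A_def)
  have "AE x in M. AE y in M. p t x y \<le> c3 * t powr (- dH / dW) * indicator (ball x (A * t powr (1 / dW))) y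
     + p (C * t) x y / (2 * C)" if t: "0 < t" for t
  proof -
    have Ct: "0 < C * t" using C t by simp
    show ?thesis
      using b[OF t] b[OF Ct] kernel_nonneg[OF Ct]
    proof eventually_elim
      case (elim x)
      from this show ?case
      proof eventually_elim
        case (elim y)
        define s where "s = (dist x y powr dW / t) powr e"
        have s: "0 \<le> s" by (simp add: s_def)
        have up: "p t x y \<le> c3 * t powr (- dH / dW) * exp (- c4 * s)"
          using elim(1) by (simp add: sub_gaussian_def s_def e_def)
        show ?case
        proof (cases "y \<in> ball x (A * t powr (1 / dW))")
          case True
          have "c3 * t powr (- dH / dW) * exp (- c4 * s) \<le> c3 * t powr (- dH / dW) * 1"
            using c s by (intro mult_left_mono) auto
          moreover have "0 \<le> p (C * t) x y / (2 * C)" using elim(3) C by simp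
          ultimately show ?thesis using True up by simp
        next
          case False
          then have "A \<le> dist x y / t powr (1 / dW)"
            using t by (simp add: field_simps)
          moreover have "s = (dist x y / t powr (1 / dW)) powr (dW / (dW - 1))"
            unfolding s_def e_def by (rule scale_exponent[OF t]) simp
          ultimately have "A powr (dW / (dW - 1)) \<le> s"
            using A dW_gt_2 by (simp add: powr_mono2)
          moreover have "A powr 1 \<le> A powr (dW / (dW - 1))"
            using A dW_gt_2 by (intro powr_mono) (auto simp: field_simps)
          ultimately have "A \<le> s" using A by simp
          then have "2 * - ln \<delta> / c4 \<le> s" using A(2) by simp
          then have "- ln \<delta> \<le> c4 / 2 * s"
            using c by (simp add: field_simps)
          then have "exp (- (c4 / 2) * s) \<le> exp (ln \<delta>)" by simp
          then have "exp (- (c4 / 2) * s) \<le> \<delta>" using \<delta> by simp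
          then have far: "exp (- (c4 / 2) * s) * exp (- (c4 / 2) * s) \<le> \<delta> * exp (- (c4 / 2) * s)"
            by (intro mult_right_mono) auto
          have sC: "(dist x y powr dW / (C * t)) powr e = s / C powr e"
            using C t by (simp add: s_def powr_divide powr_mult)
          have "c6 / C powr e * s \<le> c4 / 2 * s" using Ce s by (rule mult_right_mono)
          then have "exp (- (c4 / 2) * s) \<le> exp (- c6 * (s / C powr e))" by simp
          then have "c5 * (C * t) powr (- dH / dW) * exp (- (c4 / 2) * s) \<le> p (C * t) x y"
            using elim(2) c unfolding sub_gaussian_def e_def[symmetric] sC
            by (smt (verit) mult_left_mono mult_nonneg_nonneg powr_ge_zero)
          then have low: "\<delta> * (2 * C * c3) * t powr (- dH / dW) * exp (- (c4 / 2) * s) \<le> p (C * t) x y"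
            using c C t by (simp add: \<delta>_def powr_mult)
          \<comment> \<open>Two halves of the decay: one supplies \<delta>, the other is compared
            with the kernel at time C t.\<close>
          have "p t x y \<le> c3 * t powr (- dH / dW) * (exp (- (c4 / 2) * s) * exp (- (c4 / 2) * s))"
            using up unfolding mult_exp_exp by simp
          also have "\<dots> \<le> c3 * t powr (- dH / dW) * (\<delta> * exp (- (c4 / 2) * s))"
            using c by (intro mult_left_mono far) auto
          also have "\<dots> = \<delta> * (2 * C * c3) * t powr (- dH / dW) * exp (- (c4 / 2) * s) / (2 * C)"
            using C by (simp add: field_simps)
          also have "\<dots> \<le> p (C * t) x y / (2 * C)"
            using low C by (intro divide_right_mono) auto
          finally show ?thesis using False by simp
        qed
      qed
    qed
  qed
  then show ?thesis
    using c A by (intro exI[of _ A] exI[of _ c3] exI[of _ m] conjI) (auto simp: C_def)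
qed

abbreviation osc :: "real \<Rightarrow> ('a \<Rightarrow> real) \<Rightarrow> 'a \<Rightarrow> real" where
  "osc \<equiv> M_op M dW \<kappa>"

lemma M_op_nonneg: "0 \<le> osc r f x"
  unfolding M_op_def set_lebesgue_integral_def by (intro mult_nonneg_nonneg integral_nonneg_AE) auto

lemma set_integrable_oscillation:
  assumes "f \<in> L2b"
  shows "set_integrable M (ball x r) (\<lambda>y. \<bar>f y - f x\<bar>)"
proof -
  obtain b where b: "0 < b" "\<And>x. \<bar>f x\<bar> \<le> b"
    by (rule L2b_bounded[OF assms]) (rule that; assumption)
  have f: "f \<in> borel_measurable M" and B: "ball x r \<in> sets M"
    using assms by (auto intro: L2b_measurable)
  have "integrable M (\<lambda>y. 2 * b * indicator (ball x r) y)"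
    using finite_ball[of x r] by simp
  then show ?thesis
    unfolding set_integrable_def
  proof (rule Bochner_Integration.integrable_bound)
    show "(\<lambda>y. indicator (ball x r) y *\<^sub>R \<bar>f y - f x\<bar>) \<in> borel_measurable M"
      using f B by measurable
    show "AE y in M. norm (indicator (ball x r) y *\<^sub>R \<bar>f y - f x\<bar>) \<le> norm (2 * b * indicator (ball x r) y)"
    proof (rule AE_I2)
      fix y show "norm (indicator (ball x r) y *\<^sub>R \<bar>f y - f x\<bar>) \<le> norm (2 * b * indicator (ball x r) y)"
        using b(1) b(2)[of x] b(2)[of y] by (auto simp: indicator_def)
    qed
  qed
qed

text \<open>Power counting: r^\<kappa> from the Hoelder bound, r^(dW - \<kappa>) from the
  normalisation of \<open>osc\<close> and r^dH from the volume multiply to r^(dW + dH), which is of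
  order t^(1 + dH / dW). This cancels the kernel prefactor and the factor 1/t, so no power of t is
  left.\<close>

theorem energy_density_split:
  "\<exists>A>0. \<exists>K>0. \<exists>m. \<forall>f L t. f \<in> L2b \<longrightarrow> 0 \<le> L \<longrightarrow> (\<forall>x y. \<bar>f x - f y\<bar> \<le> L * dist x y powr \<kappa>) \<longrightarrow> 0 < t \<longrightarrow>
     (AE x in M. energy_density t f x \<le>
        K * L * osc (A * t powr (1 / dW)) f x + energy_density (2 ^ m * t) f x / 2)"
proof -
  obtain A K m where A: "0 < A" and K: "0 < K" and split: "\<And>t. 0 < t \<Longrightarrow> AE x in M. AE y in M.
     p t x y \<le> K * t powr (- dH / dW) * indicator (ball x (A * t powr (1 / dW))) y + p (2 ^ m * t) x y / (2 * 2 ^ m)"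
    using kernel_scale_split by (elim exE conjE) (rule that; blast)
  obtain c2 where c2: "0 < c2" and ub: "\<And>x r. 0 \<le> r \<Longrightarrow> measure M (ball x r) \<le> c2 * r powr dH"
    using ball_measure_upper by blast
  define K' where "K' = K * c2 * A powr (dW + dH)"
  have K': "0 < K'" using K c2 A by (simp add: K'_def)
  have "AE x in M. energy_density t f x \<le>
        K' * L * osc (A * t powr (1 / dW)) f x + energy_density (2 ^ m * t) f x / 2"
    if f: "f \<in> L2b" and L: "0 \<le> L" and hl: "\<forall>x y. \<bar>f x - f y\<bar> \<le> L * dist x y powr \<kappa>" and t: "0 < t"
    for f L t
  proof -
    define r where "r = A * t powr (1 / dW)"
    have r: "0 < r" using A t by (simp add: r_def)
    have Ct: "0 < 2 ^ m * t" using t by simp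
    show ?thesis
      using split[OF t] energy_density_eq[OF t f] energy_density_eq[OF Ct f]
    proof eventually_elim
      case (elim x)
      let ?I = "\<integral>y. indicator (ball x r) y *\<^sub>R \<bar>f y - f x\<bar> \<partial>M"
      let ?J = "\<integral>y. p (2 ^ m * t) x y * (f x - f y)\<^sup>2 \<partial>M"
      define k where "k = K * t powr (- dH / dW)"
      have k: "0 \<le> k" using K by (simp add: k_def)
      have int_osc: "integrable M (\<lambda>y. indicator (ball x r) y *\<^sub>R \<bar>f y - f x\<bar>)"
        using set_integrable_oscillation[OF f] by (simp add: set_integrable_def)
      have osc_sq: "indicator (ball x r) y * (f x - f y)\<^sup>2 \<le> L * r powr \<kappa> * (indicator (ball x r) y *\<^sub>R \<bar>f y - f x\<bar>)" for y
      proof (cases "y \<in> ball x r")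
        case True
        have "\<bar>f x - f y\<bar> \<le> L * dist x y powr \<kappa>" using hl by blast
        also have "\<dots> \<le> L * r powr \<kappa>"
          using True kappa L by (intro mult_left_mono powr_mono2) auto
        finally have "\<bar>f x - f y\<bar> * \<bar>f x - f y\<bar> \<le> L * r powr \<kappa> * \<bar>f x - f y\<bar>"
          by (intro mult_right_mono) auto
        then show ?thesis using True by (simp add: power2_eq_square abs_minus_commute)
      qed simp
      have "(\<integral>y. p t x y * (f x - f y)\<^sup>2 \<partial>M) \<le> (\<integral>y. k * (L * r powr \<kappa>) * (indicator (ball x r) y *\<^sub>R \<bar>f y - f x\<bar>)
          + 1 / (2 * 2 ^ m) * (p (2 ^ m * t) x y * (f x - f y)\<^sup>2) \<partial>M)"
      proof (rule integral_mono_AE)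
        show "AE y in M. p t x y * (f x - f y)\<^sup>2 \<le> k * (L * r powr \<kappa>) * (indicator (ball x r) y *\<^sub>R \<bar>f y - f x\<bar>)
          + 1 / (2 * 2 ^ m) * (p (2 ^ m * t) x y * (f x - f y)\<^sup>2)"
          using elim(1)
        proof eventually_elim
          case (elim y)
          have "p t x y * (f x - f y)\<^sup>2 \<le> (k * indicator (ball x r) y + p (2 ^ m * t) x y / (2 * 2 ^ m)) * (f x - f y)\<^sup>2"
            using elim by (intro mult_right_mono) (auto simp: k_def r_def)
          also have "\<dots> = k * (indicator (ball x r) y * (f x - f y)\<^sup>2) + 1 / (2 * 2 ^ m) * (p (2 ^ m * t) x y * (f x - f y)\<^sup>2)"
            by (simp add: algebra_simps)
          also have "k * (indicator (ball x r) y * (f x - f y)\<^sup>2) \<le>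
              k * (L * r powr \<kappa> * (indicator (ball x r) y *\<^sub>R \<bar>f y - f x\<bar>))"
            by (intro mult_left_mono osc_sq k)
          finally show ?case by (simp add: mult.assoc)
        qed
      qed (use elim int_osc in auto)
      also have "\<dots> = k * (L * r powr \<kappa>) * ?I + 1 / (2 * 2 ^ m) * ?J"
        using elim int_osc by simp
      finally have main: "(\<integral>y. p t x y * (f x - f y)\<^sup>2 \<partial>M) \<le> k * (L * r powr \<kappa>) * ?I + 1 / (2 * 2 ^ m) * ?J" .
      have Mop: "?I = osc r f x * (r powr (dW - \<kappa>) * measure M (ball x r))"
        using r ball_measure_pos[OF r, of x] by (simp add: M_op_def set_lebesgue_integral_def)
      have "k * (L * r powr \<kappa>) * ?I = k * L * osc r f x * (r powr \<kappa> * r powr (dW - \<kappa>) * measure M (ball x r))"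
        unfolding Mop by (simp add: mult_ac)
      also have "\<dots> \<le> k * L * osc r f x * (r powr \<kappa> * r powr (dW - \<kappa>) * (c2 * r powr dH))"
        using r k L M_op_nonneg[of r f x] by (intro mult_left_mono ub mult_nonneg_nonneg) auto
      also have "\<dots> = k * c2 * r powr (dW + dH) * L * osc r f x"
        using r by (simp add: powr_add[symmetric] mult_ac add.commute[of dH])
      also have "k * c2 * r powr (dW + dH) = K' * t"
      proof -
        have "r powr (dW + dH) = A powr (dW + dH) * t powr (1 + dH / dW)"
          using A t dW_gt_2 by (simp add: r_def powr_mult powr_powr add_divide_distrib)
        moreover have "t powr (- dH / dW) * t powr (1 + dH / dW) = t"
          using t by (simp add: powr_add[symmetric])
        ultimately show ?thesis by (simp add: k_def K'_def mult_ac)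
      qed
      finally have "(\<integral>y. p t x y * (f x - f y)\<^sup>2 \<partial>M) / (2 * t) \<le>
          (K' * t * L * osc r f x + 1 / (2 * 2 ^ m) * ?J) / (2 * t)"
        using main t by (intro divide_right_mono) auto
      also have "\<dots> = K' * L * osc r f x / 2 + ?J / (2 * (2 ^ m * t)) / 2"
        using t by (simp add: field_simps)
      also have "K' * L * osc r f x / 2 \<le> K' * L * osc r f x"
        using K' L M_op_nonneg[of r f x] by simp
      finally show ?case using elim by (simp add: r_def)
    qed
  qed
  then show ?thesis using A K' by blast
qed

end

section \<open>A Riesz representation theorem\<close>

definition supp :: "('a::topological_space \<Rightarrow> real) \<Rightarrow> 'a set" where
  "supp u = closure {x. u x \<noteq> 0}"

lemma closed_supp [simp]: "closed (supp u)"
  by (simp add: supp_def)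

lemma not_in_supp: "x \<notin> supp u \<Longrightarrow> u x = 0"
  using closure_subset[of "{x. u x \<noteq> 0}"] by (auto simp: supp_def)

lemma supp_subset:
  assumes "closed S" "\<And>x. u x \<noteq> 0 \<Longrightarrow> x \<in> S"
  shows "supp u \<subseteq> S"
  unfolding supp_def using assms by (intro closure_minimal) auto

lemma Cc_continuous: "u \<in> Cc \<Longrightarrow> continuous_on UNIV u"
  by (simp add: Cc_def)

lemma Cc_compact: "u \<in> Cc \<Longrightarrow> compact (supp u)"
  by (simp add: Cc_def supp_def)

lemma Cc_bounded:
  assumes u: "u \<in> Cc"
  obtains b where "0 < b" "\<And>x. \<bar>u x\<bar> \<le> b"
proof -
  have "compact (u ` supp u)"
    using Cc_continuous[OF u] Cc_compact[OF u] by (intro compact_continuous_image) (auto intro: continuous_on_subset)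
  then obtain b where b: "\<And>x. x \<in> supp u \<Longrightarrow> \<bar>u x\<bar> \<le> b"
    using compact_imp_bounded[of "u ` supp u"] unfolding bounded_iff by auto
  have "\<bar>u x\<bar> \<le> \<bar>b\<bar> + 1" for x
    using b[of x] not_in_supp[of x u] by (cases "x \<in> supp u") auto
  then show ?thesis by (intro that[of "\<bar>b\<bar> + 1"]) auto
qed

lemma radon_sets: "radon_measure \<nu> \<Longrightarrow> sets \<nu> = sets borel"
  by (simp add: radon_measure_def)

lemma radon_compact: "radon_measure \<nu> \<Longrightarrow> compact K \<Longrightarrow> emeasure \<nu> K < \<infinity>"
  unfolding radon_measure_def by (elim conjE) metis

lemma radon_outer: "radon_measure \<nu> \<Longrightarrow> S \<in> sets borel \<Longrightarrow>
    emeasure \<nu> S = (INF U\<in>{U. open U \<and> S \<subseteq> U}. emeasure \<nu> U)"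
  unfolding radon_measure_def by (elim conjE) (erule (1) bspec)

lemma radon_inner: "radon_measure \<nu> \<Longrightarrow> open U \<Longrightarrow>
    emeasure \<nu> U = (SUP K\<in>{K. compact K \<and> K \<subseteq> U}. emeasure \<nu> K)"
  unfolding radon_measure_def by (elim conjE allE[of _ U]) (erule (1) mp)

lemma Cc_integrable:
  assumes \<nu>: "radon_measure \<nu>" and u: "u \<in> Cc"
  shows "integrable \<nu> u"
proof -
  have sets: "sets \<nu> = sets borel" and fin: "emeasure \<nu> (supp u) < \<infinity>"
    by (rule radon_sets[OF \<nu>], rule radon_compact[OF \<nu> Cc_compact[OF u]])
  obtain b where b: "0 < b" "\<And>x. \<bar>u x\<bar> \<le> b"
    by (rule Cc_bounded[OF u]) (rule that; assumption)
  have "integrable \<nu> (\<lambda>x. b * indicator (supp u) x)"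
    using fin by (simp add: sets)
  then show ?thesis
  proof (rule Bochner_Integration.integrable_bound)
    show "u \<in> borel_measurable \<nu>"
      using borel_measurable_continuous_onI[OF Cc_continuous[OF u]] sets by (simp cong: measurable_cong_sets)
    show "AE x in \<nu>. norm (u x) \<le> norm (b * indicator (supp u) x)"
    proof (rule AE_I2)
      fix x show "norm (u x) \<le> norm (b * indicator (supp u) x)"
        using b not_in_supp[of x u] by (cases "x \<in> supp u") (auto simp: abs_mult)
    qed
  qed
qed

text \<open>A stand-in for Cc in the Riesz theorem. Linear combinations, products, clips and Urysohn
  cutoffs suffice for the construction, and \<open>F \<inter> Cc\<close> has them all.\<close>

locale cutoff_algebra =
  fixes A :: "('a::{metric_space, second_countable_topology} \<Rightarrow> real) set"
  assumes A_Cc: "A \<subseteq> Cc"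
    and A_lincomb: "\<And>a b u v. u \<in> A \<Longrightarrow> v \<in> A \<Longrightarrow> (\<lambda>x. a * u x + b * v x) \<in> A"
    and A_mult: "\<And>u v. u \<in> A \<Longrightarrow> v \<in> A \<Longrightarrow> (\<lambda>x. u x * v x) \<in> A"
    and A_clip: "\<And>u b c. u \<in> A \<Longrightarrow> 0 \<le> b \<Longrightarrow> 0 \<le> c \<Longrightarrow> (\<lambda>x. min c (max 0 (u x - b))) \<in> A"
    and A_cutoff: "\<And>K U. compact K \<Longrightarrow> open U \<Longrightarrow> K \<subseteq> U \<Longrightarrow>
      \<exists>u\<in>A. (\<forall>x. 0 \<le> u x \<and> u x \<le> 1) \<and> (\<forall>x\<in>K. u x = 1) \<and> supp u \<subseteq> U"
begin

lemma A_diff: "u \<in> A \<Longrightarrow> v \<in> A \<Longrightarrow> (\<lambda>x. u x - v x) \<in> A"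
  using A_lincomb[of u v 1 "-1"] by simp

lemma A_add: "u \<in> A \<Longrightarrow> v \<in> A \<Longrightarrow> (\<lambda>x. u x + v x) \<in> A"
  using A_lincomb[of u v 1 1] by simp

lemma A_scale: "u \<in> A \<Longrightarrow> (\<lambda>x. a * u x) \<in> A"
  using A_lincomb[of u u a 0] by simp

lemma A_zero: "(\<lambda>x. 0) \<in> A"
proof -
  obtain u where "u \<in> A" using A_cutoff[of "{}" UNIV] by auto
  then show ?thesis using A_scale[of u 0] by simp
qed

text \<open>The functions subordinate to U in the usual Riesz construction.\<close>

definition adm :: "'a set \<Rightarrow> ('a \<Rightarrow> real) set" where
  "adm U = {u \<in> A. (\<forall>x. 0 \<le> u x \<and> u x \<le> 1) \<and> supp u \<subseteq> U}"

lemma admD: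
  assumes "u \<in> adm U"
  shows "u \<in> A" "0 \<le> u x" "u x \<le> 1" "supp u \<subseteq> U"
  using assms by (auto simp: adm_def)

lemma adm_zero: "(\<lambda>x. 0) \<in> adm U"
  by (simp add: adm_def A_zero supp_def)

lemma adm_mono: "U \<subseteq> V \<Longrightarrow> adm U \<subseteq> adm V"
  by (auto simp: adm_def)

lemma cutoff:
  assumes "compact K" "open U" "K \<subseteq> U"
  obtains u W where "u \<in> adm U" "open W" "K \<subseteq> W" "\<And>x. x \<in> W \<Longrightarrow> u x = 1"
proof -
  obtain v where v: "v \<in> A" "\<And>x. 0 \<le> v x" "\<And>x. v x \<le> 1" "\<And>x. x \<in> K \<Longrightarrow> v x = 1" "supp v \<subseteq> U"
    using A_cutoff[OF assms] by auto
  \<comment> \<open>Doubling before clipping turns the set v > 1/2 into part of the plateau, so u is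
    1 on an open set around K. The \<open>- 0\<close> matches \<open>A_clip\<close>.\<close>
  define u where "u = (\<lambda>x. min 1 (max 0 (2 * v x - 0)))"
  have "u \<in> A" unfolding u_def using v(1) by (intro A_clip A_scale) auto
  moreover have "supp u \<subseteq> supp v"
    by (intro supp_subset) (use not_in_supp[of _ v] in \<open>force simp: u_def\<close>)+
  ultimately have "u \<in> adm U" using v(5) by (auto simp: adm_def u_def)
  moreover have "open {x. 1 / 2 < v x}"
    using v(1) A_Cc by (intro open_Collect_less continuous_on_const Cc_continuous) auto
  ultimately show ?thesis
    by (intro that[of u "{x. 1 / 2 < v x}"]) (auto simp: v u_def)
qed

text \<open>A two-set partition of unity: k is 1 near the part of supp u outside V, so u - k u lives
  in V.\<close>

lemma adm_split:
  assumes u: "u \<in> adm (U \<union> V)" and U: "open U" and V: "open V"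
  obtains v w where "v \<in> adm U" "w \<in> adm V" "\<And>x. u x = v x + w x"
proof -
  have uA: "u \<in> A" using u by (rule admD)
  have "compact (supp u - V)"
    using Cc_compact[of u] uA A_Cc V by (intro compact_diff) auto
  then obtain k W where k: "k \<in> adm U" "open W" "supp u - V \<subseteq> W" "\<And>x. x \<in> W \<Longrightarrow> k x = 1"
    using cutoff[of "supp u - V" U] U admD(4)[OF u] by blast
  define v where "v = (\<lambda>x. k x * u x)"
  define w where "w = (\<lambda>x. u x - k x * u x)"
  have A: "v \<in> A" "w \<in> A"
    unfolding v_def w_def using A_mult A_diff uA admD(1)[OF k(1)] by auto
  have "supp v \<subseteq> supp k"
    by (intro supp_subset) (use not_in_supp[of _ k] in \<open>force simp: v_def\<close>)+
  then have "v \<in> adm U"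
    using A(1) admD[OF k(1)] admD[OF u] by (auto simp: adm_def v_def intro: mult_le_one)
  moreover have "supp w \<subseteq> supp u - W"
  proof (intro supp_subset)
    show "closed (supp u - W)" using k(2) by (intro closed_Diff) auto
    fix x assume "w x \<noteq> 0"
    then show "x \<in> supp u - W" using k(4)[of x] not_in_supp[of x u] by (auto simp: w_def)
  qed
  then have "supp w \<subseteq> V" using k(3) by blast
  then have "w \<in> adm V"
    using A(2) admD[OF k(1)] admD[OF u] mult_left_le_one_le[of "u _" "k _"]
    by (auto simp: adm_def w_def) (smt (verit) mult_nonneg_nonneg)
  ultimately show ?thesis by (rule that) (simp add: v_def w_def)
qed

text \<open>Inner regularity reduces U to a compact K, and a cutoff fits between the two indicators.
  With outer regularity, Radon measures can then be identified and compared by testing on admissible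
  functions.\<close>

lemma radon_open_eq:
  assumes \<nu>: "radon_measure \<nu>" and U: "open U"
  shows "emeasure \<nu> U = (SUP u\<in>adm U. ennreal (\<integral>x. u x \<partial>\<nu>))"
proof (rule antisym)
  note sets = radon_sets[OF \<nu>]
  have int: "ennreal (\<integral>x. u x \<partial>\<nu>) = (\<integral>\<^sup>+x. ennreal (u x) \<partial>\<nu>)" if "u \<in> adm U" for u
    using Cc_integrable[OF \<nu>, of u] admD[OF that] A_Cc by (subst nn_integral_eq_integral) auto
  have "emeasure \<nu> U = (SUP K\<in>{K. compact K \<and> K \<subseteq> U}. emeasure \<nu> K)"
    by (rule radon_inner[OF \<nu> U])
  also have "\<dots> \<le> (SUP u\<in>adm U. ennreal (\<integral>x. u x \<partial>\<nu>))"
  proof (rule SUP_least)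
    fix K assume "K \<in> {K. compact K \<and> K \<subseteq> U}"
    then have K: "compact K" "K \<subseteq> U" by auto
    obtain u W where u: "u \<in> adm U" "open W" "K \<subseteq> W" "\<And>x. x \<in> W \<Longrightarrow> u x = 1"
      using cutoff[OF K(1) U K(2)] by blast
    have "emeasure \<nu> K = (\<integral>\<^sup>+x. indicator K x \<partial>\<nu>)"
      using K sets by (simp add: compact_imp_closed borel_closed)
    also have "\<dots> \<le> (\<integral>\<^sup>+x. ennreal (u x) \<partial>\<nu>)"
      using u by (intro nn_integral_mono) (auto simp: indicator_def)
    also have "\<dots> = ennreal (\<integral>x. u x \<partial>\<nu>)" using int u(1) by simp
    finally show "emeasure \<nu> K \<le> (SUP u\<in>adm U. ennreal (\<integral>x. u x \<partial>\<nu>))"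
      using u(1) by (meson SUP_upper order_trans)
  qed
  finally show "emeasure \<nu> U \<le> (SUP u\<in>adm U. ennreal (\<integral>x. u x \<partial>\<nu>))" .
  show "(SUP u\<in>adm U. ennreal (\<integral>x. u x \<partial>\<nu>)) \<le> emeasure \<nu> U"
  proof (rule SUP_least)
    fix u assume u: "u \<in> adm U"
    have "(\<integral>\<^sup>+x. ennreal (u x) \<partial>\<nu>) \<le> (\<integral>\<^sup>+x. indicator U x \<partial>\<nu>)"
    proof (intro nn_integral_mono)
      fix x show "ennreal (u x) \<le> indicator U x"
        using admD(2,3)[OF u, of x] admD(4)[OF u] not_in_supp[of x u] by (cases "x \<in> U") auto
    qed
    also have "\<dots> = emeasure \<nu> U" using U sets by simp
    finally show "ennreal (\<integral>x. u x \<partial>\<nu>) \<le> emeasure \<nu> U" using int[OF u] by simp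
  qed
qed

theorem radon_measure_eqI:
  assumes \<nu>: "radon_measure \<nu>" and \<nu>': "radon_measure \<nu>'"
    and eq: "\<And>u. u \<in> A \<Longrightarrow> (\<integral>x. u x \<partial>\<nu>) = (\<integral>x. u x \<partial>\<nu>')"
  shows "\<nu> = \<nu>'"
proof (rule measure_eqI)
  show "sets \<nu> = sets \<nu>'" using radon_sets[OF \<nu>] radon_sets[OF \<nu>'] by simp
  have open_eq: "emeasure \<nu> U = emeasure \<nu>' U" if "open U" for U
    unfolding radon_open_eq[OF \<nu> that] radon_open_eq[OF \<nu>' that]
    using eq admD(1) by (intro SUP_cong) auto
  fix S assume "S \<in> sets \<nu>"
  then have S: "S \<in> sets borel" using radon_sets[OF \<nu>] by simp
  have "emeasure \<nu> S = (INF U\<in>{U. open U \<and> S \<subseteq> U}. emeasure \<nu> U)"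
    "emeasure \<nu>' S = (INF U\<in>{U. open U \<and> S \<subseteq> U}. emeasure \<nu>' U)"
    by (rule radon_outer[OF \<nu> S], rule radon_outer[OF \<nu>' S])
  then show "emeasure \<nu> S = emeasure \<nu>' S" using open_eq by simp
qed

end

section \<open>Outer measure of a positive functional\<close>

locale positive_functional = cutoff_algebra A
  for A :: "('a::{metric_space, second_countable_topology} \<Rightarrow> real) set" +
  fixes \<Lambda> :: "('a \<Rightarrow> real) \<Rightarrow> real"
  assumes \<Lambda>_lincomb: "\<And>a b u v. u \<in> A \<Longrightarrow> v \<in> A \<Longrightarrow> \<Lambda> (\<lambda>x. a * u x + b * v x) = a * \<Lambda> u + b * \<Lambda> v"
    and \<Lambda>_nonneg: "\<And>u. u \<in> A \<Longrightarrow> (\<And>x. 0 \<le> u x) \<Longrightarrow> 0 \<le> \<Lambda> u"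
begin

lemma \<Lambda>_diff: "u \<in> A \<Longrightarrow> v \<in> A \<Longrightarrow> \<Lambda> (\<lambda>x. u x - v x) = \<Lambda> u - \<Lambda> v"
  using \<Lambda>_lincomb[of u v 1 "-1"] by simp

lemma \<Lambda>_add: "u \<in> A \<Longrightarrow> v \<in> A \<Longrightarrow> \<Lambda> (\<lambda>x. u x + v x) = \<Lambda> u + \<Lambda> v"
  using \<Lambda>_lincomb[of u v 1 1] by simp

lemma \<Lambda>_scale: "u \<in> A \<Longrightarrow> \<Lambda> (\<lambda>x. a * u x) = a * \<Lambda> u"
  using \<Lambda>_lincomb[of u u a 0] by simp

lemma \<Lambda>_zero: "\<Lambda> (\<lambda>x. 0) = 0"
  using \<Lambda>_scale[OF A_zero, of 0] by simp

lemma \<Lambda>_mono: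
  assumes "u \<in> A" "v \<in> A" "\<And>x. u x \<le> v x"
  shows "\<Lambda> u \<le> \<Lambda> v"
  using \<Lambda>_nonneg[OF A_diff[of v u]] assms by (simp add: \<Lambda>_diff)

lemma \<Lambda>_sum:
  assumes "\<And>k. u k \<in> A"
  shows "(\<lambda>x. \<Sum>k<(n::nat). u k x) \<in> A \<and> \<Lambda> (\<lambda>x. \<Sum>k<n. u k x) = (\<Sum>k<n. \<Lambda> (u k))"
proof (induction n)
  case 0
  then show ?case by (simp add: A_zero \<Lambda>_zero)
next
  case (Suc n)
  then show ?case using A_add[of "\<lambda>x. \<Sum>k<n. u k x" "u n"] \<Lambda>_add[of "\<lambda>x. \<Sum>k<n. u k x" "u n"] assms by simp
qed

definition open_content :: "'a set \<Rightarrow> ennreal" where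
  "open_content U = (SUP u\<in>adm U. ennreal (\<Lambda> u))"

definition outer :: "'a set \<Rightarrow> ennreal" where
  "outer S = (INF U\<in>{U. open U \<and> S \<subseteq> U}. open_content U)"

lemma content_upper: "u \<in> adm U \<Longrightarrow> ennreal (\<Lambda> u) \<le> open_content U"
  unfolding open_content_def by (rule SUP_upper)

lemma content_mono: "U \<subseteq> V \<Longrightarrow> open_content U \<le> open_content V"
  unfolding open_content_def using adm_mono by (intro SUP_subset_mono) auto

lemma outer_lower: "open U \<Longrightarrow> S \<subseteq> U \<Longrightarrow> outer S \<le> open_content U"
  unfolding outer_def by (intro INF_lower) auto

lemma outer_open: "open U \<Longrightarrow> outer U = open_content U"
  by (intro antisym outer_lower) (auto simp: outer_def intro!: INF_greatest content_mono)

lemma outer_mono: "S \<subseteq> T \<Longrightarrow> outer S \<le> outer T"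
  unfolding outer_def by (intro INF_superset_mono) auto

lemma outer_empty: "outer {} = 0"
proof -
  have "open_content {} = 0"
    unfolding open_content_def
  proof (rule antisym[OF SUP_least])
    fix u assume u: "u \<in> adm {}"
    then have "supp u = {}" using admD(4)[OF u] by auto
    then have "u = (\<lambda>x. 0)" using not_in_supp[of _ u] by auto
    then show "ennreal (\<Lambda> u) \<le> 0" using \<Lambda>_zero by simp
  qed simp
  then show ?thesis by (simp add: outer_open)
qed

text \<open>Repeated use of \<open>adm_split\<close> distributes u over the sets.\<close>

lemma \<Lambda>_le_finite_content:
  assumes "\<And>i. open (U i)" "u \<in> adm (\<Union>i<(n::nat). U i)"
  shows "ennreal (\<Lambda> u) \<le> (\<Sum>i<n. open_content (U i))"
  using assms(2)
proof (induction n arbitrary: u)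
  case 0
  then show ?case using content_upper[of u "{}"] outer_open[of "{}"] outer_empty by simp
next
  case (Suc n)
  have u: "u \<in> adm ((\<Union>i<n. U i) \<union> U n)"
    using Suc.prems by (simp add: lessThan_Suc Un_commute)
  have "open (\<Union>i<n. U i)" using assms(1) by (intro open_UN) auto
  from u this assms(1) obtain v w
    where vw: "v \<in> adm (\<Union>i<n. U i)" "w \<in> adm (U n)" "\<And>x. u x = v x + w x"
    by (rule adm_split) (rule that; assumption)
  have "u = (\<lambda>x. v x + w x)" using vw(3) by auto
  then have "\<Lambda> u = \<Lambda> v + \<Lambda> w" using \<Lambda>_add admD(1)[OF vw(1)] admD(1)[OF vw(2)] by simp
  then have "ennreal (\<Lambda> u) = ennreal (\<Lambda> v) + ennreal (\<Lambda> w)"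
    using \<Lambda>_nonneg admD[OF vw(1)] admD[OF vw(2)] by simp
  also have "\<dots> \<le> (\<Sum>i<n. open_content (U i)) + open_content (U n)"
    by (intro add_mono Suc.IH content_upper vw)
  finally show ?case by simp
qed

text \<open>Supports are compact, so finitely many of the sets already contain the support of a
  given u.\<close>

lemma content_countably_subadditive:
  assumes U: "\<And>i::nat. open (U i)"
  shows "open_content (\<Union>i. U i) \<le> (\<Sum>i. open_content (U i))"
  unfolding open_content_def[of "\<Union>i. U i"]
proof (rule SUP_least)
  fix u assume u: "u \<in> adm (\<Union>i. U i)"
  have "compact (supp u)" using admD(1)[OF u] A_Cc by (auto intro: Cc_compact)
  then obtain I :: "nat set" where I: "finite I" "supp u \<subseteq> (\<Union>i\<in>I. U i)"
    using compactE_image[of "supp u" UNIV U] admD(4)[OF u] U by metis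
  obtain n where "I \<subseteq> {..<n}" using I(1) finite_nat_iff_bounded by blast
  then have "supp u \<subseteq> (\<Union>i<n. U i)" using I(2) by blast
  then have "u \<in> adm (\<Union>i<n. U i)" using u by (simp add: adm_def)
  then have "ennreal (\<Lambda> u) \<le> (\<Sum>i<n. open_content (U i))" by (rule \<Lambda>_le_finite_content[OF U])
  also have "\<dots> \<le> (\<Sum>i. open_content (U i))" by (intro sum_le_suminf) auto
  finally show "ennreal (\<Lambda> u) \<le> (\<Sum>i. open_content (U i))" .
qed

lemma outer_approx:
  assumes "0 < \<epsilon>"
  shows "\<exists>U. open U \<and> S \<subseteq> U \<and> open_content U \<le> outer S + ennreal \<epsilon>"
proof (cases "outer S = \<top>")
  case True
  then show ?thesis by (intro exI[of _ UNIV]) auto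
next
  case False
  then have "outer S < outer S + ennreal \<epsilon>"
    using assms by (simp add: ennreal_add_left_cancel_less[of _ 0, simplified] less_top)
  then show ?thesis unfolding outer_def[of S] INF_less_iff by (auto intro: less_imp_le)
qed

lemma outer_countably_subadditive:
  "outer (\<Union>i::nat. S i) \<le> (\<Sum>i. outer (S i))"
proof (rule ennreal_le_epsilon)
  fix \<epsilon> :: real assume \<epsilon>: "0 < \<epsilon>"
  have "\<forall>i. \<exists>U. open U \<and> S i \<subseteq> U \<and> open_content U \<le> outer (S i) + ennreal (\<epsilon> * (1/2) ^ Suc i)"
    using \<epsilon> by (intro allI outer_approx) simp
  then obtain U where U: "\<And>i. open (U i)" "\<And>i. S i \<subseteq> U i"
      "\<And>i. open_content (U i) \<le> outer (S i) + ennreal (\<epsilon> * (1/2) ^ Suc i)" by metis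
  have "outer (\<Union>i. S i) \<le> open_content (\<Union>i. U i)"
    using U by (intro outer_lower) blast+
  also have "\<dots> \<le> (\<Sum>i. open_content (U i))" by (rule content_countably_subadditive[OF U(1)])
  also have "\<dots> \<le> (\<Sum>i. outer (S i) + ennreal (\<epsilon> * (1/2) ^ Suc i))"
    by (intro suminf_le U) auto
  also have "\<dots> = (\<Sum>i. outer (S i)) + (\<Sum>i. ennreal (\<epsilon> * (1/2) ^ Suc i))"
    by (intro suminf_add[symmetric]) auto
  also have "(\<Sum>i. ennreal (\<epsilon> * (1/2) ^ Suc i)) = ennreal \<epsilon>"
    using \<epsilon> sums_mult[OF power_half_series, of \<epsilon>] by (intro suminf_ennreal_eq) auto
  finally show "outer (\<Union>i. S i) \<le> (\<Sum>i. outer (S i)) + ennreal \<epsilon>" .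
qed

text \<open>Caratheodory's condition, tested on open V. A function u admissible for U \<inter> V
  leaves the open set V - supp u, which contains V - U; a w living there has support disjoint from
  that of u, so u + w is still admissible for V.\<close>

lemma content_split:
  assumes U: "open U" and V: "open V"
  shows "outer (U \<inter> V) + outer (V - U) \<le> open_content V"
proof -
  have "ennreal (\<Lambda> u) + outer (V - U) \<le> open_content V" if u: "u \<in> adm (U \<inter> V)" for u
  proof -
    have "outer (V - U) \<le> open_content (V - supp u)"
      using V admD(4)[OF u] by (intro outer_lower open_Diff) auto
    then have "ennreal (\<Lambda> u) + outer (V - U) \<le> ennreal (\<Lambda> u) + open_content (V - supp u)"
      by (intro add_left_mono)
    also have "\<dots> = (SUP w\<in>adm (V - supp u). ennreal (\<Lambda> u) + ennreal (\<Lambda> w))"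
      unfolding open_content_def by (rule ennreal_SUP_add_right) (use adm_zero in auto)
    also have "\<dots> \<le> open_content V"
    proof (rule SUP_least)
      fix w assume w: "w \<in> adm (V - supp u)"
      have disj: "u x = 0 \<or> w x = 0" for x
        using not_in_supp[of x u] not_in_supp[of x w] admD(4)[OF w] by blast
      have "supp (\<lambda>x. u x + w x) \<subseteq> supp u \<union> supp w"
        by (intro supp_subset closed_Un) (use not_in_supp[of _ u] not_in_supp[of _ w] in force)+
      then have "supp (\<lambda>x. u x + w x) \<subseteq> V"
        using admD(4)[OF w] admD(4)[OF u] by blast
      moreover have "0 \<le> u x + w x \<and> u x + w x \<le> 1" for x
        using disj[of x] admD(2,3)[OF u, of x] admD(2,3)[OF w, of x] by auto
      ultimately have "(\<lambda>x. u x + w x) \<in> adm V"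
        using A_add admD(1)[OF u] admD(1)[OF w] by (simp add: adm_def)
      from content_upper[OF this] show "ennreal (\<Lambda> u) + ennreal (\<Lambda> w) \<le> open_content V"
        using \<Lambda>_nonneg admD[OF u] admD[OF w] by (simp add: \<Lambda>_add)
    qed
    finally show ?thesis .
  qed
  then have "(SUP u\<in>adm (U \<inter> V). ennreal (\<Lambda> u) + outer (V - U)) \<le> open_content V"
    by (intro SUP_least)
  moreover have "(SUP u\<in>adm (U \<inter> V). ennreal (\<Lambda> u) + outer (V - U)) = open_content (U \<inter> V) + outer (V - U)"
    unfolding open_content_def using adm_zero by (intro ennreal_SUP_add_left) auto
  ultimately show ?thesis using outer_open[of "U \<inter> V"] U V by (simp add: open_Int)
qed

lemma borel_caratheodory: "sets borel \<subseteq> lambda_system UNIV (Pow UNIV) outer"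
  and outer_measure_space: "measure_space UNIV (lambda_system UNIV (Pow UNIV) outer) outer"
proof -
  interpret S: sigma_algebra UNIV "Pow UNIV :: 'a set set" by (rule sigma_algebra_Pow)
  have "outer_measure_space (Pow UNIV) outer"
    unfolding outer_measure_space_def positive_def increasing_def countably_subadditive_def
    using outer_empty outer_mono outer_countably_subadditive by auto
  from S.caratheodory_lemma[OF this]
  show ms: "measure_space UNIV (lambda_system UNIV (Pow UNIV) outer) outer" by simp
  have "U \<in> lambda_system UNIV (Pow UNIV) outer" if U: "open U" for U
    unfolding lambda_system_def
  proof safe
    fix S
    show "outer (U \<inter> S) + outer ((UNIV - U) \<inter> S) = outer S"
    proof (rule antisym)
      show "outer (U \<inter> S) + outer ((UNIV - U) \<inter> S) \<le> outer S"
        unfolding outer_def[of S]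
      proof (rule INF_greatest)
        fix V assume "V \<in> {V. open V \<and> S \<subseteq> V}"
        then have V: "open V" "S \<subseteq> V" by auto
        have "outer (U \<inter> S) + outer ((UNIV - U) \<inter> S) \<le> outer (U \<inter> V) + outer (V - U)"
          using V by (intro add_mono outer_mono) auto
        also have "\<dots> \<le> open_content V" by (rule content_split[OF U V(1)])
        finally show "outer (U \<inter> S) + outer ((UNIV - U) \<inter> S) \<le> open_content V" .
      qed
      have "outer S \<le> (\<Sum>i. outer (binaryset (U \<inter> S) ((UNIV - U) \<inter> S) i))"
        using outer_countably_subadditive[of "binaryset (U \<inter> S) ((UNIV - U) \<inter> S)"]
        by (simp add: UN_binaryset_eq) (metis Int_commute Int_Un_distrib Un_Diff_cancel sup_top_right inf_top_right)
      also have "\<dots> = outer (U \<inter> S) + outer ((UNIV - U) \<inter> S)"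
        using suminf_binaryset_eq[of outer "U \<inter> S" "(UNIV - U) \<inter> S"] outer_empty by simp
      finally show "outer S \<le> outer (U \<inter> S) + outer ((UNIV - U) \<inter> S)" .
    qed
  qed auto
  moreover have "sigma_algebra UNIV (lambda_system UNIV (Pow UNIV) outer)"
    using ms by (simp add: measure_space_def)
  moreover have "sets borel = sigma_sets UNIV {U::'a set. open U}"
    by (simp add: borel_def)
  ultimately show "sets borel \<subseteq> lambda_system UNIV (Pow UNIV) outer"
    using sigma_algebra.sigma_sets_subset[of UNIV "lambda_system UNIV (Pow UNIV) outer" "Collect open"]
    by (simp only:) blast
qed

definition riesz_measure :: "'a measure" where
  "riesz_measure = measure_of UNIV (sets borel) outer"

lemma sets_riesz_measure [simp]: "sets riesz_measure = sets borel"
  unfolding riesz_measure_def using sets.sigma_sets_eq[of "borel :: 'a measure"] by (simp add: sets_measure_of)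

lemma emeasure_riesz_measure:
  assumes "S \<in> sets borel"
  shows "emeasure riesz_measure S = outer S"
  unfolding riesz_measure_def
proof (rule emeasure_measure_of_sigma[OF _ _ _ assms])
  show "sigma_algebra UNIV (sets borel :: 'a set set)"
    using sets.sigma_algebra_axioms[of "borel :: 'a measure"] by simp
  show "positive (sets borel) outer" using outer_empty by (simp add: positive_def)
  have "countably_additive (lambda_system UNIV (Pow UNIV) outer) outer"
    using outer_measure_space by (simp add: measure_space_def)
  then show "countably_additive (sets borel) outer"
    using borel_caratheodory unfolding countably_additive_def by (meson order_trans subsetD)
qed

section \<open>Regularity and the integral representation\<close>

lemma \<Lambda>_le_outer:
  assumes u: "u \<in> A" "\<And>x. 0 \<le> u x" "\<And>x. u x \<le> c" and c: "0 < c" and S: "supp u \<subseteq> S"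
  shows "ennreal (\<Lambda> u) \<le> ennreal c * outer S"
proof -
  define v where "v = (\<lambda>x. 1 / c * u x)"
  have v: "v \<in> A" unfolding v_def using u(1) by (rule A_scale)
  have "supp v \<subseteq> supp u"
    by (intro supp_subset) (use not_in_supp[of _ u] in \<open>force simp: v_def\<close>)+
  then have "v \<in> adm (supp u)"
    using v u c by (simp add: adm_def v_def)
  then have "ennreal (\<Lambda> v) \<le> open_content U" if "S \<subseteq> U" for U
    using that S adm_mono[of "supp u" U] by (intro content_upper) auto
  then have "ennreal (\<Lambda> v) \<le> outer S"
    unfolding outer_def by (intro INF_greatest) auto
  then have "ennreal c * ennreal (\<Lambda> v) \<le> ennreal c * outer S"
    by (intro mult_left_mono) auto
  moreover have "\<Lambda> u = c * \<Lambda> v" using \<Lambda>_scale[OF u(1), of "1 / c"] c by (simp add: v_def)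
  ultimately show ?thesis using c by (simp add: ennreal_mult')
qed

text \<open>A cutoff that is 1 on an open W around K dominates every function admissible for W, so
  its value bounds the content of W.\<close>

lemma outer_compact_finite:
  assumes K: "compact K"
  obtains V where "open V" "K \<subseteq> V" "open_content V < \<infinity>"
proof -
  obtain u W where u: "u \<in> adm UNIV" "open W" "K \<subseteq> W" "\<And>x. x \<in> W \<Longrightarrow> u x = 1"
    using cutoff[OF K open_UNIV] by blast
  have "ennreal (\<Lambda> v) \<le> ennreal (\<Lambda> u)" if v: "v \<in> adm W" for v
  proof (intro ennreal_leI \<Lambda>_mono admD(1)[OF u(1)] admD(1)[OF v])
    fix x show "v x \<le> u x"
    proof (cases "x \<in> W")
      case True
      then show ?thesis using admD(3)[OF v, of x] u(4)[of x] by simp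
    next
      case False
      then have "v x = 0" using admD(4)[OF v] by (intro not_in_supp) blast
      then show ?thesis using admD(2)[OF u(1), of x] by simp
    qed
  qed
  then have "open_content W \<le> ennreal (\<Lambda> u)" unfolding open_content_def by (intro SUP_least)
  then have "open_content W < \<infinity>" by (rule order_le_less_trans) simp
  with u show ?thesis by (intro that)
qed

theorem radon_riesz_measure: "radon_measure riesz_measure"
  unfolding radon_measure_def
proof (intro conjI allI impI ballI)
  fix K :: "'a set" assume K: "compact K"
  then obtain V where V: "open V" "K \<subseteq> V" "open_content V < \<infinity>" using outer_compact_finite by blast
  have "emeasure riesz_measure K = outer K"
    using K by (intro emeasure_riesz_measure borel_closed compact_imp_closed)
  also have "\<dots> \<le> open_content V" using V by (intro outer_lower)
  finally show "emeasure riesz_measure K < \<infinity>" using V(3) by (rule order_le_less_trans)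
next
  fix S :: "'a set" assume S: "S \<in> sets borel"
  show "emeasure riesz_measure S = (INF U\<in>{U. open U \<and> S \<subseteq> U}. emeasure riesz_measure U)"
    unfolding emeasure_riesz_measure[OF S] outer_def[of S]
    by (intro INF_cong) (auto simp: emeasure_riesz_measure outer_open)
next
  fix U :: "'a set" assume U: "open U"
  show "emeasure riesz_measure U = (SUP K\<in>{K. compact K \<and> K \<subseteq> U}. emeasure riesz_measure K)"
  proof (rule antisym)
    have "open_content U \<le> (SUP K\<in>{K. compact K \<and> K \<subseteq> U}. emeasure riesz_measure K)"
      unfolding open_content_def
    proof (rule SUP_mono)
      fix u assume u: "u \<in> adm U"
      \<comment> \<open>The support of u is itself the compact set sought inside U.\<close>
      have "ennreal (\<Lambda> u) \<le> ennreal 1 * outer (supp u)"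
        by (rule \<Lambda>_le_outer) (use admD[OF u] in auto)
      then have "ennreal (\<Lambda> u) \<le> emeasure riesz_measure (supp u)"
        by (simp add: emeasure_riesz_measure borel_closed)
      moreover have "compact (supp u)" using admD(1)[OF u] A_Cc by (auto intro: Cc_compact)
      ultimately show "\<exists>K\<in>{K. compact K \<and> K \<subseteq> U}. ennreal (\<Lambda> u) \<le> emeasure riesz_measure K"
        using admD(4)[OF u] by blast
    qed
    then show "emeasure riesz_measure U \<le> (SUP K\<in>{K. compact K \<and> K \<subseteq> U}. emeasure riesz_measure K)"
      using U by (simp add: emeasure_riesz_measure outer_open)
    show "(SUP K\<in>{K. compact K \<and> K \<subseteq> U}. emeasure riesz_measure K) \<le> emeasure riesz_measure U"
      using U by (intro SUP_least emeasure_mono) auto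
  qed
qed simp

text \<open>Slicing \<open>u\<close> into layers of height \<open>\<delta>\<close>, each layer is bounded by the measure of the set on
  which the previous layer is full.\<close>

lemma \<Lambda>_le_integral:
  assumes u: "u \<in> A" "\<And>x. 0 \<le> u x"
  shows "\<Lambda> u \<le> (\<integral>x. u x \<partial>riesz_measure)"
proof -
  let ?\<nu> = riesz_measure
  have Cc: "v \<in> Cc" if "v \<in> A" for v using that A_Cc by auto
  obtain b where b: "0 < b" "\<And>x. \<bar>u x\<bar> \<le> b"
    by (rule Cc_bounded[OF Cc[OF u(1)]]) (rule that; assumption)
  have cpt: "compact (supp u)" by (rule Cc_compact[OF Cc[OF u(1)]])
  define m where "m = measure ?\<nu> (supp u)"
  have layer: "\<Lambda> u \<le> \<delta> * m + (\<integral>x. u x \<partial>?\<nu>)" if \<delta>: "0 < \<delta>" for \<delta>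
  proof -
    define l where "l k = (\<lambda>x. min \<delta> (max 0 (u x - real k * \<delta>)))" for k
    have lA: "l k \<in> A" for k
      unfolding l_def using u(1) \<delta> by (intro A_clip) auto
    have l_bounds: "0 \<le> l k x" "l k x \<le> \<delta>" for k x using \<delta> by (auto simp: l_def)
    have sum_l: "(\<Sum>k<n. l k x) = min (real n * \<delta>) (u x)" for n x
    proof (induction n)
      case (Suc n)
      have "real (Suc n) * \<delta> = real n * \<delta> + \<delta>" by (simp add: algebra_simps)
      then show ?case using Suc \<delta> by (simp add: l_def min_def max_def)
    qed (use u(2) in simp)
    obtain n0 :: nat where "b / \<delta> < real n0" using reals_Archimedean2 by blast
    \<comment> \<open>One layer beyond the n0 that already reach u: after the index shift n0 layers
      remain, and these still sum to u.\<close>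
    define n where "n = Suc n0"
    have "b < real n0 * \<delta>" using \<open>b / \<delta> < real n0\<close> \<delta> by (simp add: field_simps)
    then have sum_u: "(\<Sum>k<n0. l k x) = u x" "(\<Sum>k<n. l k x) = u x" for x
      unfolding sum_l n_def using b(2)[of x] \<delta> by (auto simp: algebra_simps min_def)
    \<comment> \<open>The intersection with supp u keeps \<open>K 0\<close> compact, since at k = 0
      the level set is the whole space.\<close>
    define K where "K k = supp u \<inter> {x. real k * \<delta> \<le> u x}" for k
    have "closed {x. real k * \<delta> \<le> u x}" for k
      using Cc_continuous[OF Cc[OF u(1)]] by (intro closed_Collect_le continuous_on_const) auto
    then have cK: "compact (K k)" for k
      unfolding K_def using cpt by (intro compact_Int_closed)
    have finK: "emeasure ?\<nu> (K k) < \<infinity>" for k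
      using radon_compact[OF radon_riesz_measure cK] .
    have setsK: "K k \<in> sets ?\<nu>" for k using cK by (simp add: borel_closed compact_imp_closed)
    have upper: "\<Lambda> (l k) \<le> \<delta> * measure ?\<nu> (K k)" for k
    proof -
      have "supp (l k) \<subseteq> K k"
      proof (rule supp_subset)
        show "closed (K k)" using cK by (rule compact_imp_closed)
        fix x assume "l k x \<noteq> 0"
        then have "real k * \<delta> < u x" using \<delta> by (auto simp: l_def min_def max_def split: if_splits)
        moreover have "0 \<le> real k * \<delta>" using \<delta> by simp
        ultimately show "x \<in> K k" using not_in_supp[of x u] by (auto simp: K_def)
      qed
      then have "ennreal (\<Lambda> (l k)) \<le> ennreal \<delta> * outer (K k)"
        by (intro \<Lambda>_le_outer lA l_bounds \<delta>)
      also have "outer (K k) = ennreal (measure ?\<nu> (K k))"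
        using finK[of k] setsK[of k] by (simp add: emeasure_riesz_measure[symmetric] emeasure_eq_ennreal_measure less_top)
      finally show ?thesis using \<delta> by (simp add: ennreal_mult'[symmetric] ennreal_le_iff)
    qed
    have lower: "\<delta> * measure ?\<nu> (K (Suc k)) \<le> (\<integral>x. l k x \<partial>?\<nu>)" for k
    proof -
      have "\<delta> * measure ?\<nu> (K (Suc k)) = (\<integral>x. \<delta> * indicator (K (Suc k)) x \<partial>?\<nu>)"
        using setsK by simp
      also have "\<dots> \<le> (\<integral>x. l k x \<partial>?\<nu>)"
      proof (rule integral_mono)
        show "integrable ?\<nu> (\<lambda>x. \<delta> * indicator (K (Suc k)) x)" using finK[of "Suc k"] setsK[of "Suc k"] by simp
        show "integrable ?\<nu> (l k)" by (rule Cc_integrable[OF radon_riesz_measure Cc[OF lA]])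
        show "\<delta> * indicator (K (Suc k)) x \<le> l k x" for x
          using \<delta> by (auto simp: indicator_def K_def l_def algebra_simps)
      qed
      finally show ?thesis .
    qed
    have "\<Lambda> u = (\<Sum>k<n. \<Lambda> (l k))"
      using \<Lambda>_sum[of l n] lA unfolding sum_u by simp
    also have "\<dots> \<le> (\<Sum>k<n. \<delta> * measure ?\<nu> (K k))" by (intro sum_mono upper)
    also have "\<dots> = \<delta> * measure ?\<nu> (K 0) + (\<Sum>k<n0. \<delta> * measure ?\<nu> (K (Suc k)))"
      unfolding n_def by (rule sum.lessThan_Suc_shift)
    also have "\<dots> \<le> \<delta> * measure ?\<nu> (K 0) + (\<Sum>k<n0. \<integral>x. l k x \<partial>?\<nu>)"
      by (intro add_left_mono sum_mono lower)
    also have "(\<Sum>k<n0. \<integral>x. l k x \<partial>?\<nu>) = (\<integral>x. (\<Sum>k<n0. l k x) \<partial>?\<nu>)"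
      by (intro Bochner_Integration.integral_sum[symmetric] Cc_integrable[OF radon_riesz_measure Cc[OF lA]])
    also have "\<dots> = (\<integral>x. u x \<partial>?\<nu>)" unfolding sum_u ..
    also have "K 0 = supp u" using u(2) by (auto simp: K_def)
    finally show ?thesis by (simp add: m_def)
  qed
  show ?thesis
  proof (rule field_le_epsilon)
    fix \<epsilon> :: real assume \<epsilon>: "0 < \<epsilon>"
    have m: "0 \<le> m" by (simp add: m_def)
    have "\<epsilon> / (m + 1) * m \<le> \<epsilon>" using m \<epsilon> by (simp add: field_simps)
    then show "\<Lambda> u \<le> (\<integral>x. u x \<partial>?\<nu>) + \<epsilon>"
      using layer[of "\<epsilon> / (m + 1)"] m \<epsilon> by simp
  qed
qed

text \<open>The reverse inequality comes from applying the first to b k - u. Here k dominates u / b,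
  and \<Lambda> k is up to a small error at least the measure of V, which in turn is at least the
  integral of k.\<close>

lemma \<Lambda>_eq_integral_nonneg:
  assumes u: "u \<in> A" "\<And>x. 0 \<le> u x"
  shows "\<Lambda> u = (\<integral>x. u x \<partial>riesz_measure)"
proof (rule antisym[OF \<Lambda>_le_integral[OF u]])
  let ?\<nu> = riesz_measure
  have int: "integrable ?\<nu> v" if "v \<in> A" for v
    using Cc_integrable[OF radon_riesz_measure] that A_Cc by auto
  have uCc: "u \<in> Cc" using u A_Cc by auto
  obtain b where b: "0 < b" "\<And>x. \<bar>u x\<bar> \<le> b"
    by (rule Cc_bounded[OF uCc]) (rule that; assumption)
  obtain V where V: "open V" "supp u \<subseteq> V" "open_content V < \<infinity>"
    using outer_compact_finite[OF Cc_compact[OF uCc]] by blast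
  have VE: "emeasure ?\<nu> V = open_content V" using V by (simp add: emeasure_riesz_measure outer_open)
  obtain w W where w: "w \<in> adm V" "open W" "supp u \<subseteq> W" "\<And>x. x \<in> W \<Longrightarrow> w x = 1"
    using cutoff[OF Cc_compact[OF uCc] V(1,2)] by blast
  show "(\<integral>x. u x \<partial>?\<nu>) \<le> \<Lambda> u"
  proof (rule field_le_epsilon)
    fix \<epsilon>' :: real assume \<epsilon>': "0 < \<epsilon>'"
    \<comment> \<open>The error in \<Lambda> k is multiplied by b in the end.\<close>
    define \<epsilon> where "\<epsilon> = \<epsilon>' / b"
    have \<epsilon>: "0 < \<epsilon>" using \<epsilon>' b by (simp add: \<epsilon>_def)
    have "\<exists>v\<in>adm V. measure ?\<nu> V - \<epsilon> \<le> \<Lambda> v"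
    proof (rule ccontr)
      assume "\<not> ?thesis"
      then have *: "\<Lambda> v \<le> measure ?\<nu> V - \<epsilon>" if "v \<in> adm V" for v using that by force
      have "0 \<le> measure ?\<nu> V - \<epsilon>" using *[OF adm_zero] \<Lambda>_zero by simp
      moreover have "open_content V \<le> ennreal (measure ?\<nu> V - \<epsilon>)"
        unfolding open_content_def using * by (intro SUP_least ennreal_leI)
      moreover have "open_content V = ennreal (measure ?\<nu> V)"
        using V(3) unfolding VE[symmetric] by (simp add: emeasure_eq_ennreal_measure less_top)
      ultimately show False using \<epsilon> by (simp add: ennreal_le_iff)
    qed
    then obtain v where v: "v \<in> adm V" "measure ?\<nu> V - \<epsilon> \<le> \<Lambda> v" by blast
    \<comment> \<open>This is 1 - (1 - v) (1 - w): above v, at most 1, and equal to 1 on supp u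
      because w is.\<close>
    define k where "k = (\<lambda>x. (v x + w x) - v x * w x)"
    have kA: "k \<in> A" unfolding k_def by (intro A_diff A_add A_mult admD(1)[OF v(1)] admD(1)[OF w(1)])
    have vw: "0 \<le> v x" "v x \<le> 1" "0 \<le> w x" "w x \<le> 1" for x
      using admD(2,3)[OF v(1), of x] admD(2,3)[OF w(1), of x] by auto
    have k: "v x \<le> k x" "k x \<le> 1" for x
    proof -
      have "0 \<le> (1 - v x) * w x" "0 \<le> (1 - v x) * (1 - w x)" using vw[of x] by auto
      then show "v x \<le> k x" "k x \<le> 1" by (auto simp: k_def algebra_simps)
    qed
    have kV: "k x \<le> indicator V x" for x
    proof (cases "x \<in> V")
      case False
      then have "x \<notin> supp v" "x \<notin> supp w"
        using admD(4)[OF v(1)] admD(4)[OF w(1)] by auto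
      then have "v x = 0" "w x = 0" by (auto dest: not_in_supp)
      then show ?thesis by (simp add: k_def)
    qed (use k in simp)
    have ku: "u x \<le> b * k x" for x
    proof (cases "x \<in> supp u")
      case True
      then have "k x = 1" using w by (auto simp: k_def)
      then show ?thesis using b(2)[of x] by simp
    next
      case False
      then have "u x = 0" by (rule not_in_supp)
      moreover have "0 \<le> k x" using k(1)[of x] vw(1)[of x] by (rule order_trans[rotated])
      ultimately show ?thesis using b(1) by simp
    qed
    have bkA: "(\<lambda>x. b * k x) \<in> A" by (rule A_scale[OF kA])
    have "\<Lambda> (\<lambda>x. b * k x - u x) \<le> (\<integral>x. b * k x - u x \<partial>?\<nu>)"
      using ku by (intro \<Lambda>_le_integral A_diff bkA u(1)) simp
    then have 1: "b * \<Lambda> k - \<Lambda> u \<le> b * (\<integral>x. k x \<partial>?\<nu>) - (\<integral>x. u x \<partial>?\<nu>)"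
      using int[OF kA] int[OF u(1)] by (simp add: \<Lambda>_diff[OF bkA u(1)] \<Lambda>_scale[OF kA])
    have "(\<integral>x. k x \<partial>?\<nu>) \<le> (\<integral>x. indicator V x \<partial>?\<nu>)"
      using kV V VE int[OF kA] by (intro integral_mono) auto
    also have "\<dots> = measure ?\<nu> V" using V by simp
    also have "\<dots> \<le> \<Lambda> k + \<epsilon>"
      using v(2) \<Lambda>_mono[OF admD(1)[OF v(1)] kA k(1)] by simp
    finally have "b * (\<integral>x. k x \<partial>?\<nu>) \<le> b * (\<Lambda> k + \<epsilon>)"
      using b by (intro mult_left_mono) auto
    then have "b * (\<integral>x. k x \<partial>?\<nu>) \<le> b * \<Lambda> k + \<epsilon>'"
      using b by (simp add: \<epsilon>_def distrib_left)
    with 1 show "(\<integral>x. u x \<partial>?\<nu>) \<le> \<Lambda> u + \<epsilon>'" by linarith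
  qed
qed

text \<open>A multiple of a cutoff that is 1 on supp u lifts u to a nonnegative function.\<close>

theorem riesz_representation:
  assumes u: "u \<in> A"
  shows "(\<integral>x. u x \<partial>riesz_measure) = \<Lambda> u"
proof -
  have int: "integrable riesz_measure v" if "v \<in> A" for v
    using Cc_integrable[OF radon_riesz_measure] that A_Cc by auto
  have uCc: "u \<in> Cc" using u A_Cc by auto
  obtain b where b: "0 < b" "\<And>x. \<bar>u x\<bar> \<le> b"
    by (rule Cc_bounded[OF uCc]) (rule that; assumption)
  obtain w W where w: "w \<in> adm UNIV" "open W" "supp u \<subseteq> W" "\<And>x. x \<in> W \<Longrightarrow> w x = 1"
    using cutoff[OF Cc_compact[OF uCc] open_UNIV] by blast
  have wA: "w \<in> A" by (rule admD(1)[OF w(1)])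
  have bw: "(\<lambda>x. b * w x) \<in> A" by (rule A_scale[OF wA])
  have w0: "0 \<le> w x" for x by (rule admD(2)[OF w(1)])
  have nn: "0 \<le> u x + b * w x" for x
  proof (cases "x \<in> supp u")
    case True
    then have "w x = 1" using w by auto
    then show ?thesis using b(2)[of x] by auto
  next
    case False
    then have "u x = 0" by (rule not_in_supp)
    then show ?thesis using b(1) w0[of x] by simp
  qed
  have "\<Lambda> u + b * \<Lambda> w = (\<integral>x. u x + b * w x \<partial>riesz_measure)"
    using \<Lambda>_eq_integral_nonneg[OF A_add[OF u bw] nn] by (simp add: \<Lambda>_add[OF u bw] \<Lambda>_scale[OF wA])
  also have "\<dots> = (\<integral>x. u x \<partial>riesz_measure) + b * (\<integral>x. w x \<partial>riesz_measure)"
    using int[OF u] int[OF wA] by simp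
  also have "(\<integral>x. w x \<partial>riesz_measure) = \<Lambda> w"
    using \<Lambda>_eq_integral_nonneg[OF wA w0] by simp
  finally show ?thesis by simp
qed

end

section \<open>Energy measures\<close>

lemma CcI:
  fixes u :: "'a::t2_space \<Rightarrow> real"
  assumes "continuous_on UNIV u" "compact S" "\<And>x. u x \<noteq> 0 \<Longrightarrow> x \<in> S"
  shows "u \<in> Cc"
proof -
  have "closure {x. u x \<noteq> 0} \<subseteq> S"
    using assms(2,3) by (intro closure_minimal compact_imp_closed) auto
  then have "compact (closure {x. u x \<noteq> 0})"
    using compact_Int_closed[OF assms(2) closed_closure, of "{x. u x \<noteq> 0}"] by (simp add: Int_absorb1)
  then show ?thesis using assms(1) by (simp add: Cc_def)
qed

lemma Cc_subset_C0: "Cc \<subseteq> C0"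
  by (force simp: C0_def)

lemma ennreal_le_mult_INF:
  fixes x :: ennreal and c :: real
  assumes "I \<noteq> {}" and le: "\<And>i. i \<in> I \<Longrightarrow> x \<le> ennreal c * f i"
  shows "x \<le> ennreal c * (INF i\<in>I. f i)"
proof (cases "ennreal c = 0")
  case True
  \<comment> \<open>Some index exists, and its bound reads x <= 0.\<close>
  then show ?thesis using assms by auto
next
  case False
  have "x / ennreal c \<le> (INF i\<in>I. f i)"
  proof (rule INF_greatest)
    fix i assume "i \<in> I"
    then have "x / ennreal c \<le> ennreal c * f i / ennreal c"
      using le by (intro divide_right_mono_ennreal) auto
    then show "x / ennreal c \<le> f i"
      using False ennreal_mult_divide_eq[of "ennreal c" "f i"] by (simp add: mult.commute)
  qed
  then have "ennreal c * (x / ennreal c) \<le> ennreal c * (INF i\<in>I. f i)"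
    by (rule mult_left_mono) simp
  then show ?thesis
    using False ennreal_mult_divide_eq[of "ennreal c" x] by (simp add: ennreal_times_divide mult.commute)
qed

context wBE_space
begin

section \<open>Cutoff functions in the form domain\<close>

lemma compact_closed_bounded:
  assumes "closed S" "S \<subseteq> ball (z::'a) r" "0 < r"
  shows "compact S"
proof -
  have "S = closure (ball z r) \<inter> S"
    using assms(2) closure_subset[of "ball z r"] by blast
  then show ?thesis
    using compact_Int_closed[OF relatively_compact_balls[OF assms(3), of z] assms(1)] by simp
qed

lemma Cc_L2b:
  assumes "u \<in> F \<inter> Cc"
  shows "u \<in> L2b"
proof -
  obtain b where "0 < b" "\<And>x. \<bar>u x\<bar> \<le> b"
    by (rule Cc_bounded[of u]) (use assms in auto)
  then show ?thesis using F_L2[of u] assms by (auto simp: L2b_def)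
qed

text \<open>The margins prepare a perturbation: an approximation of g up to 1/4, lowered by 1/2 and
  clipped at 0 and 1, is exactly 1 on K and vanishes off S.\<close>

lemma Cc_cutoff:
  assumes K: "compact K" and U: "open U" and KU: "K \<subseteq> (U :: 'a set)"
  obtains g S where "g \<in> Cc" "\<And>x. x \<in> K \<Longrightarrow> 2 \<le> g x" "closed S" "S \<subseteq> U" "\<And>x. 0 < g x \<Longrightarrow> x \<in> S"
proof -
  obtain a :: "'a \<Rightarrow> real" and \<delta> where a: "continuous_on UNIV a" "0 < \<delta>" "\<And>x. x \<in> K \<Longrightarrow> \<delta> \<le> a x"
      "\<And>x. x \<notin> U \<Longrightarrow> a x \<le> 0"
  \<comment> \<open>\<open>infdist\<close> to the empty set is 0, so U = UNIV calls for a constant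
    function instead; for empty K there is no point at which to attain the infimum.\<close>
  proof (cases "U = UNIV \<or> K = {}")
    case True
    then show ?thesis
      by (intro that[of "\<lambda>_. if K = {} then 0 else 1" 1]) auto
  next
    case False
    let ?a = "\<lambda>x. infdist x (- U)"
    have cont: "continuous_on UNIV ?a" by (intro continuous_on_infdist continuous_on_id)
    obtain k where k: "k \<in> K" "\<And>x. x \<in> K \<Longrightarrow> ?a k \<le> ?a x"
      using continuous_attains_inf[OF K, of ?a] False continuous_on_subset[OF cont] by auto
    have "?a k \<noteq> 0"
      using in_closed_iff_infdist_zero[of "- U" k] U KU k(1) False by auto
    then have "0 < ?a k" using infdist_nonneg[of k "- U"] by simp
    then show ?thesis using k cont by (intro that[of ?a "?a k"]) auto
  qed
  define z :: 'a where "z = undefined"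
  obtain R where R: "0 < R" "K \<subseteq> ball z R"
    using bounded_subset_ballD[OF compact_imp_bounded[OF K], of z] by auto
  \<comment> \<open>The first factor is at least 2 where a >= \<delta> and vanishes where a <=
    \<delta> / 2; the second is 1 on the ball of radius R and makes the support bounded.\<close>
  define g where "g x = max 0 (a x * (4 / \<delta>) - 2) * max 0 (min 1 (R + 1 - dist z x))" for x
  define S where "S = {x. \<delta> / 2 \<le> a x} \<inter> cball z (R + 1)"
  have closed_S: "closed S"
    unfolding S_def by (intro closed_Int closed_Collect_le continuous_on_const a closed_cball)
  have S_U: "S \<subseteq> U" using a(2,4) by (force simp: S_def)
  have gS: "x \<in> S" if "0 < g x" for x
  proof -
    have "0 < a x * (4 / \<delta>) - 2" "0 < R + 1 - dist z x"
      using that by (auto simp: g_def zero_less_mult_iff max_def min_def split: if_splits)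
    then show ?thesis using a(2) by (auto simp: S_def field_simps)
  qed
  have g0: "0 \<le> g x" for x by (simp add: g_def)
  have "compact S"
    by (rule compact_closed_bounded[OF closed_S, of z "R + 2"]) (use R in \<open>auto simp: S_def\<close>)
  then have "g \<in> Cc"
  proof (rule CcI[rotated])
    show "continuous_on UNIV g"
      unfolding g_def[abs_def] by (intro continuous_intros a)
    show "x \<in> S" if "g x \<noteq> 0" for x using gS[of x] g0[of x] that by simp
  qed
  moreover have "2 \<le> g x" if "x \<in> K" for x
  proof -
    have "4 \<le> a x * (4 / \<delta>)" using a(2) a(3)[OF that] by (simp add: field_simps)
    moreover have "dist z x < R" using R that by auto
    ultimately show ?thesis by (simp add: g_def)
  qed
  ultimately show ?thesis using closed_S S_U gS by (rule that)
qed

lemma form_domain_clip: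
  assumes u: "u \<in> F \<inter> Cc" and b: "0 \<le> b" and c: "0 \<le> c"
  shows "(\<lambda>x. min c (max 0 (u x - b))) \<in> F \<inter> Cc"
proof
  let ?v = "\<lambda>x. min c (max 0 (u x - b))"
  have uL: "u \<in> L2b" by (rule Cc_L2b[OF u])
  have cont: "continuous_on UNIV u" using u by (auto intro: Cc_continuous)
  have vL: "?v \<in> L2b"
    by (rule L2b_dominated[OF _ uL, of _ 1]) (use L2b_measurable[OF uL] b c in auto)
  show "?v \<in> F"
  proof (rule form_domain_dominated[OF vL uL _ uL, of 1 0])
    fix x y
    have "\<bar>?v x - ?v y\<bar> \<le> \<bar>u x - u y\<bar>" by (simp add: min_def max_def)
    then show "(?v x - ?v y)\<^sup>2 \<le> 1 * (u x - u y)\<^sup>2 + 0 * (u x - u y)\<^sup>2"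
      by (simp add: abs_le_square_iff)
  qed (use u in auto)
  show "?v \<in> Cc"
  proof (rule CcI[where S = "supp u"])
    show "continuous_on UNIV ?v" by (intro continuous_intros cont)
    show "compact (supp u)" using u by (auto intro: Cc_compact)
    show "x \<in> supp u" if "?v x \<noteq> 0" for x
      using that b c not_in_supp[of x u] by (auto simp: min_def max_def split: if_splits)
  qed
qed

sublocale cutoff_algebra "F \<inter> Cc"
proof
  show "F \<inter> Cc \<subseteq> Cc" by simp
next
  fix a b u v assume u: "u \<in> F \<inter> Cc" and v: "v \<in> F \<inter> Cc"
  have c: "compact (supp u \<union> supp v)" using u v by (auto intro: Cc_compact)
  have cont: "continuous_on UNIV u" "continuous_on UNIV v" using u v by (auto intro: Cc_continuous)
  have "(\<lambda>x. a * u x + b * v x) \<in> Cc"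
    by (rule CcI[OF _ c]) (use not_in_supp[of _ u] not_in_supp[of _ v] in \<open>force intro!: continuous_intros cont\<close>)+
  moreover have "(\<lambda>x. u x * v x) \<in> Cc"
    by (rule CcI[OF _ c]) (use not_in_supp[of _ u] not_in_supp[of _ v] in \<open>force intro!: continuous_intros cont\<close>)+
  ultimately show "(\<lambda>x. a * u x + b * v x) \<in> F \<inter> Cc" "(\<lambda>x. u x * v x) \<in> F \<inter> Cc"
    using F_lincomb form_domain_mult[OF Cc_L2b[OF u] _ Cc_L2b[OF v]] u v by auto
next
  fix u and b c :: real assume "u \<in> F \<inter> Cc" "0 \<le> b" "0 \<le> c"
  then show "(\<lambda>x. min c (max 0 (u x - b))) \<in> F \<inter> Cc" by (rule form_domain_clip)
next
  fix K U :: "'a set" assume KU: "compact K" "open U" "K \<subseteq> U"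
  obtain g S where g: "g \<in> Cc" "\<And>x. x \<in> K \<Longrightarrow> 2 \<le> g x" "closed S" "S \<subseteq> U" "\<And>x. 0 < g x \<Longrightarrow> x \<in> S"
    by (rule Cc_cutoff[OF KU]) (rule that; assumption)
  \<comment> \<open>Uniform approximation from regularity of the form, with the tolerance for which
    g was prepared.\<close>
  obtain w where w: "w \<in> F \<inter> Cc" "\<And>x. \<bar>g x - w x\<bar> < 1 / 4"
    using regular g(1) unfolding regular_form_def by (metis divide_pos_pos zero_less_numeral zero_less_one)
  let ?u = "\<lambda>x. min 1 (max 0 (w x - 1 / 2))"
  have "?u \<in> F \<inter> Cc" by (rule form_domain_clip[OF w(1)]) auto
  moreover have "?u x = 1" if "x \<in> K" for x
  proof -
    have "1 \<le> w x - 1 / 2" using g(2)[OF that] w(2)[of x] by linarith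
    then show ?thesis by simp
  qed
  moreover have "supp ?u \<subseteq> S"
  proof (rule supp_subset[OF g(3)])
    fix x assume "?u x \<noteq> 0"
    then have "1 / 2 < w x" by (auto simp: min_def max_def split: if_splits)
    then show "x \<in> S" using w(2)[of x] by (intro g(5)) linarith
  qed
  ultimately show "\<exists>u\<in>F \<inter> Cc. (\<forall>x. 0 \<le> u x \<and> u x \<le> 1) \<and> (\<forall>x\<in>K. u x = 1) \<and> supp u \<subseteq> U"
    using g(4) by (intro bexI[of _ ?u]) auto
qed

section \<open>Existence and uniqueness of energy measures\<close>

definition energy_functional :: "('a \<Rightarrow> real) \<Rightarrow> ('a \<Rightarrow> real) \<Rightarrow> real" where
  "energy_functional f \<phi> = E (\<lambda>x. f x * \<phi> x) f - 1 / 2 * E \<phi> (\<lambda>x. (f x)\<^sup>2)"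

text \<open>Positivity is not visible in the formula; it is inherited from the nonnegative densities
  whose integrals converge to it.\<close>

lemma positive_functional_energy:
  assumes f: "f \<in> L2b" "f \<in> F"
  shows "positive_functional (F \<inter> Cc) (energy_functional f)"
proof
  fix a b u v assume u: "u \<in> F \<inter> Cc" and v: "v \<in> F \<inter> Cc"
  have fu: "(\<lambda>x. f x * u x) \<in> F" and fv: "(\<lambda>x. f x * v x) \<in> F" and ff: "(\<lambda>x. (f x)\<^sup>2) \<in> F"
    using form_domain_mult[OF f Cc_L2b[OF u]] form_domain_mult[OF f Cc_L2b[OF v]] form_domain_square[OF f] u v by auto
  have "(\<lambda>x. f x * (a * u x + b * v x)) = (\<lambda>x. a * (f x * u x) + b * (f x * v x))"
    by (simp add: algebra_simps)
  then show "energy_functional f (\<lambda>x. a * u x + b * v x) = a * energy_functional f u + b * energy_functional f v"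
    using u v by (simp add: energy_functional_def E_lincomb[OF fu fv f(2)] E_lincomb[OF _ _ ff] algebra_simps)
next
  fix u assume u: "u \<in> F \<inter> Cc" and nn: "\<And>x. 0 \<le> u x"
  show "0 \<le> energy_functional f u"
  proof (rule tendsto_lowerbound)
    show "((\<lambda>t. \<integral>x. u x * energy_density t f x \<partial>M) \<longlongrightarrow> energy_functional f u) (at_right 0)"
      unfolding energy_functional_def using u by (intro energy_density_tendsto f Cc_L2b) auto
    show "\<forall>\<^sub>F t in at_right 0. 0 \<le> (\<integral>x. u x * energy_density t f x \<partial>M)"
      using eventually_at_right_less[of 0]
    proof eventually_elim
      case (elim t)
      show ?case
        using energy_density_nonneg[OF elim f(1)] nn by (intro integral_nonneg_AE) (auto elim: eventually_mono)
    qed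
  qed simp
qed

text \<open>f is bounded, so \<open>energy_measure\<close> takes its first branch. The definite
  description there is justified by the Riesz measure and by uniqueness on
  \<open>F \<inter> Cc\<close>.\<close>

theorem energy_measure:
  assumes f: "f \<in> L2b" "f \<in> F"
  shows "is_energy_measure F E f (energy_measure M F E f)"
proof -
  interpret P: positive_functional "F \<inter> Cc" "energy_functional f"
    by (rule positive_functional_energy[OF f])
  have ex: "is_energy_measure F E f P.riesz_measure"
    unfolding is_energy_measure_def using P.radon_riesz_measure P.riesz_representation
    by (simp add: energy_functional_def)
  obtain b where b: "0 < b" "\<And>x. \<bar>f x\<bar> \<le> b"
    by (rule L2b_bounded[OF f(1)]) (rule that; assumption)
  have "f \<in> Linf M"
    by (rule bounded_Linf[OF L2b_measurable[OF f(1)] b(2)])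
  moreover have "(THE \<nu>. is_energy_measure F E f \<nu>) = P.riesz_measure"
  proof (rule the_equality[of "is_energy_measure F E f", OF ex])
    fix \<nu> assume "is_energy_measure F E f \<nu>"
    then show "\<nu> = P.riesz_measure"
      using ex unfolding is_energy_measure_def by (intro radon_measure_eqI) auto
  qed
  ultimately show ?thesis using ex by (simp add: energy_measure_def)
qed

section \<open>BV functions\<close>

text \<open>Balls are the sections of the open set {d(x,y) < r}, so joint measurability yields
  measurability in the centre.\<close>

lemma M_op_measurable:
  assumes f: "f \<in> borel_measurable M"
  shows "osc r f \<in> borel_measurable M"
proof -
  let ?Q = "{p :: 'a \<times> 'a. dist (fst p) (snd p) < r}"
  have "open ?Q" by (intro open_Collect_less continuous_intros)
  moreover have "sets (M \<Otimes>\<^sub>M M) = sets (borel :: ('a \<times> 'a) measure)"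
    using sets_pair_measure_cong[OF sets_M sets_M] by (simp only: borel_prod)
  ultimately have Q: "?Q \<in> sets (M \<Otimes>\<^sub>M M)"
    by simp
  have "Pair x -` ?Q = ball x r" for x by auto
  with MM.measurable_emeasure_Pair1[OF Q] have [measurable]: "(\<lambda>x. emeasure M (ball x r)) \<in> borel_measurable M"
    by (simp only:)
  have [measurable]: "(\<lambda>x. measure M (ball x r)) \<in> borel_measurable M"
    unfolding measure_def by measurable
  have "(\<lambda>x. \<integral>y. indicator ?Q (x, y) * \<bar>f y - f x\<bar> \<partial>M) \<in> borel_measurable M"
    using Q f by measurable
  moreover have "(\<integral>y. indicator ?Q (x, y) * \<bar>f y - f x\<bar> \<partial>M) = (LINT y:ball x r|M. \<bar>f y - f x\<bar>)" for x
    unfolding set_lebesgue_integral_def by (intro Bochner_Integration.integral_cong) (auto simp: indicator_def)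
  ultimately have [measurable]: "(\<lambda>x. LINT y:ball x r|M. \<bar>f y - f x\<bar>) \<in> borel_measurable M"
    by simp
  show ?thesis unfolding M_op_def[abs_def] by measurable
qed

text \<open>Translates membership in \<open>KS1\<close> with exponent dW - \<kappa> into boundedness
  of \<open>osc r f\<close> in L1 for small r.\<close>

lemma KS1_integrand:
  assumes f: "f \<in> L2b" and r: "0 < r"
  shows "(\<integral>\<^sup>+y. ennreal (\<bar>f y - f x\<bar> / (r powr (dW - \<kappa>) * measure M (ball x r)))
      * indicator (near_diagonal r) (x, y) \<partial>M) = ennreal (osc r f x)"
proof -
  let ?c = "r powr (dW - \<kappa>) * measure M (ball x r)"
  have c: "0 < ?c" using r ball_measure_pos[OF r] by simp
  have int: "integrable M (\<lambda>y. indicator (ball x r) y *\<^sub>R \<bar>f y - f x\<bar>)"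
    using set_integrable_oscillation[OF f] by (simp add: set_integrable_def)
  have "(\<integral>\<^sup>+y. ennreal (\<bar>f y - f x\<bar> / ?c) * indicator (near_diagonal r) (x, y) \<partial>M) =
      (\<integral>\<^sup>+y. ennreal (1 / ?c * (indicator (ball x r) y *\<^sub>R \<bar>f y - f x\<bar>)) \<partial>M)"
    by (intro nn_integral_cong) (auto simp: near_diagonal_def indicator_def)
  also have "\<dots> = ennreal (\<integral>y. 1 / ?c * (indicator (ball x r) y *\<^sub>R \<bar>f y - f x\<bar>) \<partial>M)"
    using int c by (intro nn_integral_eq_integral) auto
  also have "(\<integral>y. 1 / ?c * (indicator (ball x r) y *\<^sub>R \<bar>f y - f x\<bar>) \<partial>M) = osc r f x"
    by (simp add: M_op_def set_lebesgue_integral_def)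
  finally show ?thesis .
qed

lemma KS1_M_op_bound:
  assumes f: "f \<in> L2b" and KS: "f \<in> KS1 M (dW - \<kappa>)"
  obtains S where "0 \<le> S" "\<forall>\<^sub>F r in at_right 0. integrable M (osc r f) \<and> (\<integral>x. osc r f x \<partial>M) \<le> S"
proof -
  let ?L = "\<lambda>r. \<integral>\<^sup>+x. (\<integral>\<^sup>+y. ennreal (\<bar>f y - f x\<bar> / (r powr (dW - \<kappa>) * measure M (ball x r)))
      * indicator (near_diagonal r) (x, y) \<partial>M) \<partial>M"
  have "Limsup (at_right 0) ?L < \<top>" using KS by (simp add: KS1_def)
  then obtain s where s: "0 \<le> s" "Limsup (at_right 0) ?L = ennreal s"
    by (cases "Limsup (at_right 0) ?L") auto
  \<comment> \<open>An eventual bound needs a number strictly above the Limsup.\<close>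
  define S where "S = s + 1"
  have S: "Limsup (at_right 0) ?L < ennreal S" "0 \<le> S"
    unfolding s(2) S_def using s(1) by (auto simp: ennreal_less_iff)
  have "\<forall>\<^sub>F r in at_right 0. integrable M (osc r f) \<and> (\<integral>x. osc r f x \<partial>M) \<le> S"
    using Limsup_lessD[OF S(1)] eventually_at_right_less[of 0]
  proof eventually_elim
    case (elim r)
    have *: "(\<integral>\<^sup>+x. ennreal (osc r f x) \<partial>M) < ennreal S"
      using elim by (simp add: KS1_integrand[OF f])
    have int: "integrable M (osc r f)"
      using * by (intro integrableI_nonneg M_op_measurable L2b_measurable f AE_I2 M_op_nonneg)
        (auto intro: order_less_trans)
    with * show ?case
      using S(2) by (simp add: nn_integral_eq_integral M_op_nonneg ennreal_less_iff integral_nonneg_AE less_imp_le)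
  qed
  with S(2) show ?thesis by (rule that)
qed

text \<open>The Hoelder bound compares f(x) with the average of f over the unit ball, whose volume
  is bounded below; the average is controlled by the L1 norm.\<close>

lemma hoelder_L2b:
  assumes f: "f \<in> L2 M" "integrable M f" and hl: "\<And>x y. \<bar>f x - f y\<bar> \<le> L * dist x y powr \<kappa>" and L: "0 \<le> L"
  shows "f \<in> L2b"
proof -
  obtain c1 where c1: "0 < c1" and lb: "\<And>x r. 0 \<le> r \<Longrightarrow> c1 * r powr dH \<le> measure M (ball x r)"
    using ball_measure_lower by blast
  define N where "N = (\<integral>x. \<bar>f x\<bar> \<partial>M)"
  have N: "0 \<le> N" by (simp add: N_def)
  have "\<bar>f x\<bar> \<le> N / c1 + L" for x
  proof -
    let ?B = "ball x 1"
    have "\<bar>f x\<bar> * measure M ?B = (\<integral>y. \<bar>f x\<bar> * indicator ?B y \<partial>M)" by simp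
    also have "\<dots> \<le> (\<integral>y. \<bar>f y\<bar> + L * indicator ?B y \<partial>M)"
    proof (rule integral_mono)
      show "integrable M (\<lambda>y. \<bar>f x\<bar> * indicator ?B y)" "integrable M (\<lambda>y. \<bar>f y\<bar> + L * indicator ?B y)"
        using finite_ball[of x 1] f(2) by simp_all
      fix y
      show "\<bar>f x\<bar> * indicator ?B y \<le> \<bar>f y\<bar> + L * indicator ?B y"
      proof (cases "y \<in> ?B")
        case True
        then have "dist x y powr \<kappa> \<le> 1 powr \<kappa>" using kappa by (intro powr_mono2) auto
        then have "L * dist x y powr \<kappa> \<le> L * 1" using L by (intro mult_left_mono) auto
        then show ?thesis using hl[of x y] True by simp
      qed simp
    qed
    also have "\<dots> = N + L * measure M ?B" using f(2) finite_ball[of x 1] by (simp add: N_def)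
    finally have "(\<bar>f x\<bar> - L) * measure M ?B \<le> N" by (simp add: algebra_simps)
    moreover have "c1 \<le> measure M ?B" using lb[of 1 x] by simp
    ultimately have "(\<bar>f x\<bar> - L) * c1 \<le> N"
      using N c1 by (smt (verit) mult_left_mono mult_nonpos_nonneg)
    then show ?thesis using c1 by (simp add: field_simps)
  qed
  then show ?thesis using f by (auto simp: L2b_def)
qed

text \<open>In a one-point space the unit ball would be null. The lemma makes the set in
  \<open>hoelder_seminorm\<close> nonempty, so that its \<open>Sup\<close> is a genuine
  supremum.\<close>

lemma ex_distinct_points: "\<exists>x y :: 'a. x \<noteq> y"
proof (rule ccontr)
  assume "\<not> ?thesis"
  then have eq: "\<And>x y :: 'a. x = y" by blast
  obtain c1 where c1: "0 < c1" and lb: "\<And>x r. 0 \<le> r \<Longrightarrow> c1 * r powr dH \<le> measure M (ball x r)"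
    using ball_measure_lower by blast
  define z :: 'a where "z = undefined"
  have "AE y in M. False" using AE_neq[of z] by eventually_elim (use eq in blast)
  then have "emeasure M (ball z 1) = 0"
    using AE_iff_measurable[of "space M" M "\<lambda>_. False"] emeasure_space[of M "ball z 1"] by simp
  then have "measure M (ball z 1) = 0" by (simp add: measure_def)
  then show False using lb[of 1 z] c1 by simp
qed

lemma hoelder_seminorm:
  assumes "hoelder \<kappa> f"
  shows "0 \<le> hoelder_seminorm \<kappa> f" "\<bar>f x - f y\<bar> \<le> hoelder_seminorm \<kappa> f * dist x (y::'a) powr \<kappa>"
proof -
  let ?S = "{\<bar>f x - f y\<bar> / dist x y powr \<kappa> | x y. x \<noteq> y}"
  obtain L where L: "\<And>x y. \<bar>f x - f y\<bar> \<le> L * dist x y powr \<kappa>" using assms by (auto simp: hoelder_def)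
  have bdd: "bdd_above ?S"
    using L by (intro bdd_aboveI[of _ L]) (auto simp: divide_le_eq)
  have le: "\<bar>f x - f y\<bar> / dist x y powr \<kappa> \<le> hoelder_seminorm \<kappa> f" if "x \<noteq> y" for x y
    unfolding hoelder_seminorm_def using that by (intro cSup_upper bdd) auto
  obtain a b :: 'a where "a \<noteq> b" using ex_distinct_points by blast
  have "0 \<le> \<bar>f a - f b\<bar> / dist a b powr \<kappa>" by simp
  also have "\<dots> \<le> hoelder_seminorm \<kappa> f" by (rule le[OF \<open>a \<noteq> b\<close>])
  finally show "0 \<le> hoelder_seminorm \<kappa> f" .
  show "\<bar>f x - f y\<bar> \<le> hoelder_seminorm \<kappa> f * dist x y powr \<kappa>"
    using le[of x y] by (cases "x = y") (auto simp: divide_le_eq)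
qed

section \<open>Comparison of energy and oscillation\<close>

lemma scale_filterlim:
  fixes A c :: real
  assumes "0 < A" "0 < c"
  shows "filterlim (\<lambda>t. A * t powr c) (at_right 0) (at_right 0)"
proof (rule tendsto_imp_filterlim_at_right)
  have "((\<lambda>t. A * t powr c) \<longlongrightarrow> A * 0 powr c) (at_right 0)"
    using assms by (intro tendsto_intros tendsto_powr2) (auto simp: eventually_at_filter)
  then show "((\<lambda>t. A * t powr c) \<longlongrightarrow> 0) (at_right 0)" by simp
  show "\<forall>\<^sub>F t in at_right 0. 0 < A * t powr c"
    using eventually_at_right_less[of 0] by eventually_elim (use assms in simp)
qed

text \<open>\<open>energy_functional f \<phi>\<close> is at most \<open>c\<close> times the lower limit of \<open>\<integral> \<phi> (osc r f) dM\<close>, stated through a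
  minorant \<open>l\<close> so that it can be evaluated along any null sequence of radii.\<close>

definition osc_dominated :: "real \<Rightarrow> ('a \<Rightarrow> real) \<Rightarrow> ('a \<Rightarrow> real) \<Rightarrow> bool" where
  "osc_dominated c f \<phi> \<longleftrightarrow> (\<exists>l. (l \<longlongrightarrow> energy_functional f \<phi>) (at_right 0) \<and>
     (\<forall>\<^sub>F r in at_right 0. integrable M (\<lambda>x. \<phi> x * osc r f x) \<and> l r \<le> c * (\<integral>x. \<phi> x * osc r f x \<partial>M)))"

text \<open>One inequality is used twice: integrated over the space it puts f in \<open>F\<close>,
  and weighted with \<phi> it gives the comparison. Absorbing the halves doubles the
  constant.\<close>

theorem KS1_hoelder_comparison:
  "\<exists>K>0. \<forall>f L. f \<in> L2b \<longrightarrow> f \<in> KS1 M (dW - \<kappa>) \<longrightarrow> 0 \<le> L \<longrightarrow> (\<forall>x y. \<bar>f x - f y\<bar> \<le> L * dist x y powr \<kappa>) \<longrightarrow>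
     f \<in> F \<and> (\<forall>\<phi>\<in>F \<inter> Cc. (\<forall>x. 0 \<le> \<phi> x) \<longrightarrow> osc_dominated (K * L) f \<phi>)"
proof -
  obtain A K m where A: "0 < A" and K: "0 < K" and split: "\<And>f L t. f \<in> L2b \<Longrightarrow> 0 \<le> L \<Longrightarrow>
     (\<forall>x y. \<bar>f x - f y\<bar> \<le> L * dist x y powr \<kappa>) \<Longrightarrow> 0 < t \<Longrightarrow> AE x in M. energy_density t f x \<le>
        K * L * osc (A * t powr (1 / dW)) f x + energy_density (2 ^ m * t) f x / 2"
    using energy_density_split by (elim exE conjE) (rule that; blast)
  have dW: "0 < dW" using dW_gt_2 by simp
  have "f \<in> F \<and> (\<forall>\<phi>\<in>F \<inter> Cc. (\<forall>x. 0 \<le> \<phi> x) \<longrightarrow> osc_dominated (2 * K * L) f \<phi>)"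
    if f: "f \<in> L2b" and KS: "f \<in> KS1 M (dW - \<kappa>)" and L: "0 \<le> L" and hl: "\<forall>x y. \<bar>f x - f y\<bar> \<le> L * dist x y powr \<kappa>"
    for f L
  proof
    note fL = L2b_L2[OF f]
    note split' = split[OF f L hl]
    obtain S where S: "0 \<le> S" and ev: "\<forall>\<^sub>F r in at_right 0. integrable M (osc r f) \<and> (\<integral>x. osc r f x \<partial>M) \<le> S"
      by (rule KS1_M_op_bound[OF f KS]) (rule that; assumption)
    have "\<forall>\<^sub>F t in at_right 0. integrable M (osc (A * t powr (1 / dW)) f) \<and>
        (\<integral>x. osc (A * t powr (1 / dW)) f x \<partial>M) \<le> S"
      using eventually_compose_filterlim[OF ev scale_filterlim[OF A, of "1 / dW"]] dW by simp
    then have "\<forall>\<^sub>F t in at_right 0. approx_form t f f \<le> 2 * K * L * S"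
      using eventually_at_right_less[of 0]
    proof eventually_elim
      case (elim t)
      have t: "0 < t" and Ct: "0 < 2 ^ m * t" using elim by auto
      have "approx_form t f f \<le> (\<integral>x. K * L * osc (A * t powr (1 / dW)) f x + energy_density (2 ^ m * t) f x / 2 \<partial>M)"
        unfolding energy_density_integral(2)[OF t f, symmetric]
        using elim split'[OF t] energy_density_integral(1)[OF t f] energy_density_integral(1)[OF Ct f]
        by (intro integral_mono_AE) auto
      also have "\<dots> = K * L * (\<integral>x. osc (A * t powr (1 / dW)) f x \<partial>M) + approx_form (2 ^ m * t) f f / 2"
        using elim energy_density_integral[OF Ct f] by simp
      \<comment> \<open>The dyadic comparison puts half of the left-hand side on the right, where it
        can be absorbed.\<close>
      also have "\<dots> \<le> K * L * S + approx_form t f f / 2"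
        using elim K L approx_form_dyadic[OF t fL, of m] by (intro add_mono mult_left_mono divide_right_mono) auto
      finally show ?case by simp
    qed
    then show fF: "f \<in> F" by (rule mem_form_domain(1)[OF fL])
    show "\<forall>\<phi>\<in>F \<inter> Cc. (\<forall>x. 0 \<le> \<phi> x) \<longrightarrow> osc_dominated (2 * K * L) f \<phi>"
    proof (intro ballI impI)
      fix \<phi> assume \<phi>: "\<phi> \<in> F \<inter> Cc" and nn: "\<forall>x. 0 \<le> \<phi> x"
      have \<phi>L: "\<phi> \<in> L2b" by (rule Cc_L2b[OF \<phi>])
      obtain b where b: "0 < b" "\<And>x. \<bar>\<phi> x\<bar> \<le> b"
        by (rule L2b_bounded[OF \<phi>L]) (rule that; assumption)
      define I where "I t = (\<integral>x. \<phi> x * energy_density t f x \<partial>M)" for t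
      have I_lim: "(I \<longlongrightarrow> energy_functional f \<phi>) (at_right 0)"
        unfolding I_def energy_functional_def using \<phi> by (intro energy_density_tendsto f fF \<phi>L) auto
      \<comment> \<open>The inverse of t -> A t^(1/dW), so that \<open>osc\<close> appears at
        exactly the radius r.\<close>
      define \<tau> where "\<tau> r = (1 / A) powr dW * r powr dW" for r
      have \<tau>_lim: "filterlim \<tau> (at_right 0) (at_right 0)"
        unfolding \<tau>_def[abs_def] using A dW by (intro scale_filterlim) auto
      have C\<tau>_lim: "filterlim (\<lambda>r. 2 ^ m * \<tau> r) (at_right 0) (at_right 0)"
        unfolding \<tau>_def mult.assoc[symmetric] using A dW by (intro scale_filterlim) auto
      \<comment> \<open>Both integrals tend to the same limit, hence so does this combination, and
        the inequality solved for it has \<open>osc\<close> alone on the right.\<close>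
      define l where "l r = 2 * I (\<tau> r) - I (2 ^ m * \<tau> r)" for r
      have "(l \<longlongrightarrow> 2 * energy_functional f \<phi> - energy_functional f \<phi>) (at_right 0)"
        unfolding l_def by (intro tendsto_intros filterlim_compose[OF I_lim] \<tau>_lim C\<tau>_lim)
      then have "(l \<longlongrightarrow> energy_functional f \<phi>) (at_right 0)" by simp
      moreover have "\<forall>\<^sub>F r in at_right 0. integrable M (\<lambda>x. \<phi> x * osc r f x) \<and>
           l r \<le> 2 * K * L * (\<integral>x. \<phi> x * osc r f x \<partial>M)"
        using ev eventually_at_right_less[of 0]
      proof eventually_elim
        case (elim r)
        have \<tau>: "0 < \<tau> r" and C\<tau>: "0 < 2 ^ m * \<tau> r" using elim A by (auto simp: \<tau>_def)
        have r: "A * \<tau> r powr (1 / dW) = r"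
          using elim A dW by (simp add: \<tau>_def powr_mult powr_powr)
        have int: "integrable M (\<lambda>x. \<phi> x * osc r f x)"
        proof (rule Bochner_Integration.integrable_bound)
          show "integrable M (\<lambda>x. b * osc r f x)" using elim by simp
          show "(\<lambda>x. \<phi> x * osc r f x) \<in> borel_measurable M"
            using L2b_measurable[OF \<phi>L] M_op_measurable[OF L2b_measurable[OF f]] by (rule borel_measurable_times)
          show "AE x in M. norm (\<phi> x * osc r f x) \<le> norm (b * osc r f x)"
            using b M_op_nonneg by (intro AE_I2) (auto simp: abs_mult intro!: mult_right_mono)
        qed
        have "I (\<tau> r) \<le> (\<integral>x. K * L * (\<phi> x * osc r f x) + \<phi> x * energy_density (2 ^ m * \<tau> r) f x / 2 \<partial>M)"
          unfolding I_def
        proof (rule integral_mono_AE)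
          show "AE x in M. \<phi> x * energy_density (\<tau> r) f x \<le>
              K * L * (\<phi> x * osc r f x) + \<phi> x * energy_density (2 ^ m * \<tau> r) f x / 2"
            using split'[OF \<tau>]
          proof eventually_elim
            case (elim x)
            from mult_left_mono[OF elim, of "\<phi> x"] nn show ?case
              unfolding r by (simp add: algebra_simps)
          qed
        qed (use int energy_density_integral_mult(1)[OF \<tau> f \<phi>L] energy_density_integral_mult(1)[OF C\<tau> f \<phi>L] in auto)
        also have "\<dots> = K * L * (\<integral>x. \<phi> x * osc r f x \<partial>M) + I (2 ^ m * \<tau> r) / 2"
          using int energy_density_integral_mult(1)[OF C\<tau> f \<phi>L] by (simp add: I_def)
        finally show ?case using int by (simp add: l_def)
      qed
      ultimately show "osc_dominated (2 * K * L) f \<phi>"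
        unfolding osc_dominated_def by blast
    qed
  qed
  with K show ?thesis by (intro exI[of _ "2 * K"]) simp
qed

text \<open>Open sets come first, since there the energy measure is a supremum of integrals of
  admissible functions. Outer regularity carries the bound to Borel sets, which gives absolute
  continuity; for the lower limit, countable subadditivity handles the open covers and inner
  regularity the passage from compact to open sets.\<close>

theorem energy_measure_bounds:
  "\<exists>C>0. \<forall>f. f \<in> KS1 M (dW - \<kappa>) \<inter> L2 M \<and> hoelder \<kappa> f \<longrightarrow>
     f \<in> F \<and>
     (\<forall>\<gamma>. bv_measure M dW \<kappa> f \<gamma> \<longrightarrow> absolutely_continuous \<gamma> (energy_measure M F E f)) \<and>
     (\<forall>A\<in>sets borel. emeasure (energy_measure M F E f) A
        \<le> ennreal (C * hoelder_seminorm \<kappa> f) * liminf_measure (\<lambda>r. density M (\<lambda>y. ennreal (osc r f y))) A)"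
  (is "\<exists>C>0. \<forall>f. _ \<longrightarrow> ?bound C f")
proof -
  obtain K where K: "0 < K" and comparison: "\<And>f L. f \<in> L2b \<Longrightarrow> f \<in> KS1 M (dW - \<kappa>) \<Longrightarrow> 0 \<le> L \<Longrightarrow>
     (\<forall>x y. \<bar>f x - f y\<bar> \<le> L * dist x y powr \<kappa>) \<Longrightarrow>
     f \<in> F \<and> (\<forall>\<phi>\<in>F \<inter> Cc. (\<forall>x. 0 \<le> \<phi> x) \<longrightarrow> osc_dominated (K * L) f \<phi>)"
    using KS1_hoelder_comparison by (elim exE conjE) (rule that; blast)
  have "?bound K f" if KS: "f \<in> KS1 M (dW - \<kappa>)" and f2: "f \<in> L2 M" and hf: "hoelder \<kappa> f" for f
  proof -
    define L where "L = hoelder_seminorm \<kappa> f"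
    have L: "0 \<le> L" and hl: "\<And>x y. \<bar>f x - f y\<bar> \<le> L * dist x y powr \<kappa>"
      unfolding L_def by (rule hoelder_seminorm[OF hf])+
    have "integrable M f" using KS by (simp add: KS1_def)
    from hoelder_L2b[OF f2 this hl L] have f: "f \<in> L2b" .
    have "\<forall>x y. \<bar>f x - f y\<bar> \<le> L * dist x y powr \<kappa>" using hl by blast
    note comp = comparison[OF f KS L this]
    have fF: "f \<in> F" using comp by blast
    define \<nu> where "\<nu> = energy_measure M F E f"
    have \<nu>: "radon_measure \<nu>" and \<nu>_int: "\<And>u. u \<in> F \<inter> Cc \<Longrightarrow> (\<integral>x. u x \<partial>\<nu>) = energy_functional f u"
      using energy_measure[OF f fF] by (auto simp: is_energy_measure_def \<nu>_def energy_functional_def)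
    define c where "c = K * L"
    have c: "0 \<le> c" using K L by (simp add: c_def)
    have adm_comp: "\<exists>l. (l \<longlongrightarrow> (\<integral>x. u x \<partial>\<nu>)) (at_right 0) \<and>
        (\<forall>\<^sub>F r in at_right 0. integrable M (\<lambda>x. u x * osc r f x) \<and> l r \<le> c * (\<integral>x. u x * osc r f x \<partial>M))"
      if u: "u \<in> adm U" for u U
    proof -
      have uA: "u \<in> F \<inter> Cc" and "\<forall>x. 0 \<le> u x" using admD[OF u] by auto
      then have "osc_dominated c f u" using comp by (simp add: c_def)
      then show ?thesis unfolding osc_dominated_def \<nu>_int[OF uA] .
    qed
    have outer: "emeasure \<nu> A \<le> ennreal c * emeasure \<gamma> A"
      if \<gamma>: "radon_measure \<gamma>" and le: "\<And>U. open U \<Longrightarrow> emeasure \<nu> U \<le> ennreal c * emeasure \<gamma> U" and A: "A \<in> sets borel"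
      for \<gamma> A
      unfolding radon_outer[OF \<gamma> A]
    proof (rule ennreal_le_mult_INF)
      fix U assume "U \<in> {U. open U \<and> A \<subseteq> U}"
      then have U: "open U" "A \<subseteq> U" by auto
      then have "emeasure \<nu> A \<le> emeasure \<nu> U"
        by (intro emeasure_mono) (auto simp: radon_sets[OF \<nu>])
      also have "\<dots> \<le> ennreal c * emeasure \<gamma> U" by (rule le[OF U(1)])
      finally show "emeasure \<nu> A \<le> ennreal c * emeasure \<gamma> U" .
    qed auto
    have "absolutely_continuous \<gamma> \<nu>" if bv: "bv_measure M dW \<kappa> f \<gamma>" for \<gamma>
    proof -
      obtain r where \<gamma>: "radon_measure \<gamma>" and r: "\<And>n. 0 < r n" "r \<longlonglongrightarrow> 0"
        and lim: "\<And>g. g \<in> C0 \<Longrightarrow> (\<lambda>n::nat. \<integral>x. g x * osc (r n) f x \<partial>M) \<longlonglongrightarrow> (\<integral>x. g x \<partial>\<gamma>)"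
        using bv unfolding bv_measure_def by blast
      \<comment> \<open>The minorant converges as r tends to 0 through all radii, hence along those
        that define \<gamma>.\<close>
      have r_lim: "filterlim r (at_right 0) sequentially"
        using r by (intro tendsto_imp_filterlim_at_right) auto
      have "emeasure \<nu> U \<le> ennreal c * emeasure \<gamma> U" if U: "open U" for U
        unfolding radon_open_eq[OF \<nu> U]
      proof (rule SUP_least)
        fix u assume u: "u \<in> adm U"
        obtain l where l: "(l \<longlongrightarrow> (\<integral>x. u x \<partial>\<nu>)) (at_right 0)"
          and ev: "\<forall>\<^sub>F r in at_right 0. integrable M (\<lambda>x. u x * osc r f x) \<and>
             l r \<le> c * (\<integral>x. u x * osc r f x \<partial>M)"
          using adm_comp[OF u] by blast
        have "(\<integral>x. u x \<partial>\<nu>) \<le> c * (\<integral>x. u x \<partial>\<gamma>)"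
        proof (rule tendsto_le[OF trivial_limit_sequentially])
          show "(\<lambda>n. l (r n)) \<longlonglongrightarrow> (\<integral>x. u x \<partial>\<nu>)" by (rule filterlim_compose[OF l r_lim])
          show "(\<lambda>n. c * (\<integral>x. u x * osc (r n) f x \<partial>M)) \<longlonglongrightarrow> c * (\<integral>x. u x \<partial>\<gamma>)"
            using admD(1)[OF u] Cc_subset_C0 by (intro tendsto_mult_left lim) auto
          show "\<forall>\<^sub>F n in sequentially. l (r n) \<le> c * (\<integral>x. u x * osc (r n) f x \<partial>M)"
            using eventually_compose_filterlim[OF ev r_lim] by eventually_elim simp
        qed
        then have "ennreal (\<integral>x. u x \<partial>\<nu>) \<le> ennreal c * ennreal (\<integral>x. u x \<partial>\<gamma>)"
          using c by (simp add: ennreal_mult'[symmetric] ennreal_leI)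
        also have "\<dots> \<le> ennreal c * emeasure \<gamma> U"
          unfolding radon_open_eq[OF \<gamma> U] using u by (intro mult_left_mono SUP_upper) auto
        finally show "ennreal (\<integral>x. u x \<partial>\<nu>) \<le> ennreal c * emeasure \<gamma> U" .
      qed
      from outer[OF \<gamma> this] have "emeasure \<nu> N = 0" if "N \<in> null_sets \<gamma>" for N
        using that radon_sets[OF \<gamma>] by (metis le_zero_eq mult_zero_right null_setsD1 null_setsD2)
      then show ?thesis
        using radon_sets[OF \<gamma>] radon_sets[OF \<nu>] by (auto simp: absolutely_continuous_def null_sets_def)
    qed
    moreover have "emeasure \<nu> A \<le> ennreal c * liminf_measure (\<lambda>r. density M (\<lambda>y. ennreal (osc r f y))) A"
      (is "_ \<le> _ * liminf_measure ?\<mu> A") if A: "A \<in> sets borel" for A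
    proof -
      have open_le: "emeasure \<nu> U \<le> ennreal c * Liminf (at_right 0) (\<lambda>r. emeasure (?\<mu> r) U)" if U: "open U" for U
        unfolding radon_open_eq[OF \<nu> U]
      proof (rule SUP_least)
        fix u assume u: "u \<in> adm U"
        obtain l where l: "(l \<longlongrightarrow> (\<integral>x. u x \<partial>\<nu>)) (at_right 0)"
          and ev: "\<forall>\<^sub>F r in at_right 0. integrable M (\<lambda>x. u x * osc r f x) \<and>
             l r \<le> c * (\<integral>x. u x * osc r f x \<partial>M)"
          using adm_comp[OF u] by blast
        show "ennreal (\<integral>x. u x \<partial>\<nu>) \<le> ennreal c * Liminf (at_right 0) (\<lambda>r. emeasure (?\<mu> r) U)"
        proof (cases "c = 0")
          \<comment> \<open>For c = 0 there is no dividing by c; the minorant is then eventually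
            nonpositive, and so is its limit.\<close>
          case True
          have "(\<integral>x. u x \<partial>\<nu>) \<le> 0"
          proof (rule tendsto_upperbound[OF l])
            show "\<forall>\<^sub>F r in at_right 0. l r \<le> 0" using ev by eventually_elim (simp add: True)
          qed simp
          then show ?thesis by (simp add: ennreal_neg)
        next
          case False
          then have c0: "0 < c" using c by simp
          have "((\<lambda>r. ennreal (l r / c)) \<longlongrightarrow> ennreal ((\<integral>x. u x \<partial>\<nu>) / c)) (at_right 0)"
            using c0 by (intro tendsto_ennrealI tendsto_divide l tendsto_const) auto
          then have "ennreal ((\<integral>x. u x \<partial>\<nu>) / c) = Liminf (at_right 0) (\<lambda>r. ennreal (l r / c))"
            by (intro lim_imp_Liminf[symmetric]) auto
          also have "\<dots> \<le> Liminf (at_right 0) (\<lambda>r. emeasure (?\<mu> r) U)"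
          proof (rule Liminf_mono)
            show "\<forall>\<^sub>F r in at_right 0. ennreal (l r / c) \<le> emeasure (?\<mu> r) U"
              using ev
            proof eventually_elim
              case (elim r)
              have "l r / c \<le> (\<integral>x. u x * osc r f x \<partial>M)"
                using elim c0 by (simp add: field_simps)
              then have "ennreal (l r / c) \<le> ennreal (\<integral>x. u x * osc r f x \<partial>M)"
                by (rule ennreal_leI)
              also have "\<dots> = (\<integral>\<^sup>+x. ennreal (u x * osc r f x) \<partial>M)"
                using elim admD(2)[OF u] M_op_nonneg by (intro nn_integral_eq_integral[symmetric]) auto
              also have "\<dots> \<le> (\<integral>\<^sup>+x. ennreal (osc r f x) * indicator U x \<partial>M)"
              proof (rule nn_integral_mono)
                fix x
                show "ennreal (u x * osc r f x) \<le> ennreal (osc r f x) * indicator U x"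
                proof (cases "x \<in> U")
                  case True
                  then show ?thesis
                    using admD(2,3)[OF u, of x] M_op_nonneg[of r f x] by (simp add: ennreal_leI mult_left_le_one_le)
                next
                  case False
                  then have "u x = 0" using admD(4)[OF u] by (intro not_in_supp) blast
                  then show ?thesis by simp
                qed
              qed
              also have "\<dots> = emeasure (?\<mu> r) U"
                using U M_op_measurable[OF L2b_measurable[OF f]] by (intro emeasure_density[symmetric]) auto
              finally show ?case .
            qed
          qed
          finally have "ennreal c * ennreal ((\<integral>x. u x \<partial>\<nu>) / c) \<le> ennreal c * Liminf (at_right 0) (\<lambda>r. emeasure (?\<mu> r) U)"
            by (rule mult_left_mono) simp
          then show ?thesis using c0 by (simp add: ennreal_mult'[symmetric])
        qed
      qed
      have compact_le: "emeasure \<nu> K \<le> ennreal c * liminf_premeasure ?\<mu> K" if K: "compact K" for K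
        unfolding liminf_premeasure_def setcompr_eq_image
      proof (rule ennreal_le_mult_INF)
        show "{U. (\<forall>i. open (U i)) \<and> K \<subseteq> (\<Union>i. U i)} \<noteq> {}"
          by (auto intro!: exI[of _ "\<lambda>_. UNIV"])
        fix U :: "nat \<Rightarrow> 'a set" assume "U \<in> {U. (\<forall>i. open (U i)) \<and> K \<subseteq> (\<Union>i. U i)}"
        then have U: "\<And>i. open (U i)" "K \<subseteq> (\<Union>i. U i)" by auto
        have "emeasure \<nu> K \<le> emeasure \<nu> (\<Union>i. U i)"
          using U by (intro emeasure_mono) (auto simp: radon_sets[OF \<nu>])
        also have "\<dots> \<le> (\<Sum>i. emeasure \<nu> (U i))"
          using U by (intro emeasure_subadditive_countably) (auto simp: radon_sets[OF \<nu>])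
        also have "\<dots> \<le> (\<Sum>i. ennreal c * Liminf (at_right 0) (\<lambda>r. emeasure (?\<mu> r) (U i)))"
          by (intro suminf_le open_le U) auto
        also have "\<dots> = ennreal c * (\<Sum>i. Liminf (at_right 0) (\<lambda>r. emeasure (?\<mu> r) (U i)))"
          by (rule ennreal_suminf_cmult)
        finally show "emeasure \<nu> K \<le> ennreal c * (\<Sum>i. Liminf (at_right 0) (\<lambda>r. emeasure (?\<mu> r) (U i)))" .
      qed
      show ?thesis
        unfolding liminf_measure_def
      proof (rule ennreal_le_mult_INF)
        fix U assume "U \<in> {U. open U \<and> A \<subseteq> U}"
        then have U: "open U" "A \<subseteq> U" by auto
        then have "emeasure \<nu> A \<le> emeasure \<nu> U"
          by (intro emeasure_mono) (auto simp: radon_sets[OF \<nu>])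
        also have "\<dots> = (SUP K\<in>{K. compact K \<and> K \<subseteq> U}. emeasure \<nu> K)"
          by (rule radon_inner[OF \<nu> U(1)])
        also have "\<dots> \<le> (SUP K\<in>{K. compact K \<and> K \<subseteq> U}. ennreal c * liminf_premeasure ?\<mu> K)"
          by (rule SUP_mono) (use compact_le in blast)
        also have "\<dots> = ennreal c * (SUP K\<in>{K. compact K \<and> K \<subseteq> U}. liminf_premeasure ?\<mu> K)"
          by (rule SUP_mult_left_ennreal[symmetric])
        finally show "emeasure \<nu> A \<le> ennreal c * (SUP K\<in>{K. compact K \<and> K \<subseteq> U}. liminf_premeasure ?\<mu> K)" .
      qed auto
    qed
    ultimately show ?thesis using fF unfolding \<nu>_def c_def L_def by blast
  qed
  with K show ?thesis by (intro exI[of _ K]) auto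
qed

end

theorem theorem4p31:
  fixes M :: "'a::{metric_space, second_countable_topology} measure"
    and F :: "('a \<Rightarrow> real) set"
    and E :: "('a \<Rightarrow> real) \<Rightarrow> ('a \<Rightarrow> real) \<Rightarrow> real"
    and p :: "real \<Rightarrow> 'a \<Rightarrow> 'a \<Rightarrow> real"
    and dH dW \<kappa> :: real
  assumes "sub_gaussian_dirichlet_space M F E p dH dW"
    and "wBE M p dW \<kappa>"
    and "ereal \<kappa> = ereal dW - lambda1 M"
  shows "\<exists>C>0. \<forall>f. f \<in> BV M \<inter> L2 M \<and> hoelder \<kappa> f \<longrightarrow>
           f \<in> F \<and>
           (\<forall>\<gamma>. bv_measure M dW \<kappa> f \<gamma> \<longrightarrow> absolutely_continuous \<gamma> (energy_measure M F E f)) \<and>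
           (\<forall>A\<in>sets borel. emeasure (energy_measure M F E f) A
              \<le> ennreal (C * hoelder_seminorm \<kappa> f) *
                liminf_measure (\<lambda>r. density M (\<lambda>y. ennreal (M_op M dW \<kappa> r f y))) A)"
proof -
  interpret sub_gaussian_dirichlet_space M F E p dH dW by (rule assms(1))
  interpret wBE_space M F E p dH dW \<kappa> by unfold_locales (rule assms(2))
  \<comment> \<open>The equation for \<kappa> excludes an infinite \<open>lambda1\<close>, so the
    conversion to a real loses nothing.\<close>
  have "real_of_ereal (lambda1 M) = dW - \<kappa>"
    using assms(3) by (cases "lambda1 M") auto
  then have "BV M = KS1 M (dW - \<kappa>)" by (simp add: BV_def)
  with energy_measure_bounds show ?thesis by simp
qed

end
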